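(* Let $\mu$ be a probability measure on $\mathbb{R}_{+}=(0,\infty)$ with mean $1$, and assume that $\int x^{1+\varepsilon}\,\mathrm{d}\mu(x)<\infty$ for some $\varepsilon>0$. Let $\widehat{\mu}(k)=\int e^{-2\pi i k x}\,\mathrm{d}\mu(x)$. Then the point sets obtained from the stationary renewal process on $\mathbb{R}$ with waiting-time distribution $\mu$ almost surely have a diffraction measure of the form \[ \widehat{\gamma}=(\widehat{\gamma})_{\mathsf{pp}}+(1-h)\,\lambda , \] where $\lambda$ is Lebesgue measure on $\mathbb{R}$ and $h$ is a locally integrable function on $\mathbb{R}$ that is continuous except for at most countably many points, given (at all $k$ with $\widehat{\mu}(k)\neq 1$) by \[ h(k)=\frac{2\bigl(\lvert\widehat{\mu}(k)\rvert^{2}-\mathrm{Re}(\widehat{\mu}(k))\bigr)}{\lvert 1-\widehat{\mu}(k)\rvert^{2}} . \] Moreover, the pure point part is \[ (\widehat{\gamma})_{\mathsf{pp}}=\begin{cases}\delta_{0}, & \text{if } \mathrm{supp}(\mu) \text{ is not a subset of a lattice},\\ \delta_{\mathbb{Z}/b}, & \text{if } b\mathbb{Z} \text{ is the coarsest lattice that contains } \mathrm{supp}(\mu),\end{cases} \] where $\delta_{\mathbb{Z}/b}=\sum_{n\in\mathbb{Z}}\delta_{n/b}$.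
   Context: The stationary renewal process with waiting-time distribution $\mu$ (a probability measure on the positive reals with mean $1$) is the point process on $\mathbb{R}$ obtained by placing points successively so that the gaps between consecutive points are i.i.d. with law $\mu$, started at $-\infty$ (equivalently, the stationary version of this process); almost every realisation is a simple point set of density $1$. For a realisation $\varLambda$, with Dirac comb $\omega=\sum_{x\in\varLambda}\delta_x$, the autocorrelation is the vague limit $\gamma=\lim_{R\to\infty}(\omega_R*\widetilde{\omega_R})/\mathrm{vol}(B_R)$, where $\omega_R$ is the restriction of $\omega$ to $(-R,R)$, $\mathrm{vol}(B_R)=2R$, and $\widetilde{\omega}(g)=\overline{\omega(\widetilde g)}$ with $\widetilde g(x)=\overline{g(-x)}$. The diffraction measure $\widehat{\gamma}$ is its Fourier transform (kernel $e^{-2\pi i kx}$), and $(\widehat\gamma)_{\mathsf{pp}}$ denotes its pure point part (the atomic part in the Lebesgue decomposition). *)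

theory Defs
  imports "HOL-Probability.Probability"
begin

definition msupport :: "real measure \<Rightarrow> real set" where
  "msupport \<mu> = {x. \<forall>e>0. emeasure \<mu> (ball x e) > 0}"

definition ft_measure :: "real measure \<Rightarrow> real \<Rightarrow> complex" where
  "ft_measure \<mu> k = integral\<^sup>L \<mu> (\<lambda>x. cis (- 2 * pi * k * x))"

definition Cc :: "(real \<Rightarrow> 'b::real_normed_vector) \<Rightarrow> bool" where
  "Cc \<phi> \<longleftrightarrow> continuous_on UNIV \<phi> \<and> bounded {x. \<phi> x \<noteq> 0}"

definition locally_finite_borel :: "real measure \<Rightarrow> bool" where
  "locally_finite_borel \<gamma> \<longleftrightarrow> sets \<gamma> = sets borel \<and> (\<forall>K. compact K \<longrightarrow> emeasure \<gamma> K < \<infinity>)"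

text \<open>Autocorrelation of a point set (locally finite): vague limit of
  (omega_R * omega_R~)/(2R), where omega_R * omega_R~ = sum of Dirac measures at x - y,
  x, y in Lambda \<inter> (-R,R).\<close>
definition autocorrelation :: "real set \<Rightarrow> real measure \<Rightarrow> bool" where
  "autocorrelation \<Lambda> \<gamma> \<longleftrightarrow>
     (\<forall>R. finite (\<Lambda> \<inter> {-R<..<R})) \<and> locally_finite_borel \<gamma> \<and>
     (\<forall>\<phi>::real \<Rightarrow> real. Cc \<phi> \<longrightarrow>
        ((\<lambda>R. (\<Sum>(x, y) \<in> (\<Lambda> \<inter> {-R<..<R}) \<times> (\<Lambda> \<inter> {-R<..<R}). \<phi> (x - y)) / (2 * R))
           \<longlongrightarrow> integral\<^sup>L \<gamma> \<phi>) at_top)"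

definition ift :: "(real \<Rightarrow> complex) \<Rightarrow> real \<Rightarrow> complex" where
  "ift \<phi> k = integral\<^sup>L lborel (\<lambda>x. \<phi> x * cis (2 * pi * k * x))"

text \<open>nu is the Fourier transform of the positive definite measure gamma:
  gamma(phi * phi~) = nu(|ift phi|^2) for all phi in C_c, where
  (phi * phi~)(x) = int phi(y) conj(phi(y - x)) dy.  This determines nu uniquely.\<close>
definition fourier_transform_measure :: "real measure \<Rightarrow> real measure \<Rightarrow> bool" where
  "fourier_transform_measure \<gamma> \<nu> \<longleftrightarrow>
     locally_finite_borel \<nu> \<and>
     (\<forall>\<phi>::real \<Rightarrow> complex. Cc \<phi> \<longrightarrow>
        integral\<^sup>L \<gamma> (\<lambda>x. integral\<^sup>L lborel (\<lambda>y. \<phi> y * cnj (\<phi> (y - x))))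
        = complex_of_real (integral\<^sup>L \<nu> (\<lambda>k. (cmod (ift \<phi> k))\<^sup>2)))"

text \<open>Points of the (stationary) renewal process built from gaps G n (n in Z) and U:
  x_0 = - U * G 0, x_{n+1} = x_n + G n.\<close>
definition renewal_points :: "(int \<Rightarrow> 'a \<Rightarrow> real) \<Rightarrow> ('a \<Rightarrow> real) \<Rightarrow> 'a \<Rightarrow> real set" where
  "renewal_points G U \<omega> =
     {- U \<omega> * G 0 \<omega> + (\<Sum>j\<in>{0..<n}. G j \<omega>) | n. n \<ge> 0} \<union>
     {- U \<omega> * G 0 \<omega> - (\<Sum>j\<in>{n..<0}. G j \<omega>) | n. n < 0}"

end

theory Submission
  imports Defs "HOL-Library.Discrete_Functions"
begin

text \<open>
  Write \<open>w\<close> for the Fourier transform of the waiting-time law, \<open>Z = {k. w k = 1}\<close> and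
  \<open>\<eta> = \<Sum>\<^sub>n \<mu>\<^sup>*\<^sup>n\<close> for the renewal measure. Almost surely, the autocorrelation is
  \<open>\<gamma> = \<delta>\<^sub>0 + \<eta> + reflected \<eta>\<close>: the exponential pair sums \<open>B\<^sub>j = \<Sum>\<^sub>i\<^sub><\<^sub>j exp (- s (x\<^sub>j - x\<^sub>i))\<close> satisfy
  \<open>B\<^sub>j\<^sub>+\<^sub>1 = exp (- s X\<^sub>j) (1 + B\<^sub>j)\<close>, so a strong law for orthogonal variables identifies their averages with
  the Laplace transform of \<open>\<eta>\<close>, and by Weierstrass' theorem in the variable \<open>exp (- x)\<close> countably many \<open>s\<close>
  suffice for all test functions. The moment condition enters only through the law of large numbers for the gaps.

  On the Fourier side, Abel summation turns \<open>\<gamma>\<close> into the density \<open>(1 - r\<^sup>2 |w|\<^sup>2) / |1 - r w|\<^sup>2\<close>.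
  This is the sum of \<open>r\<^sup>2 (1 - |w|\<^sup>2) / |1 - r w|\<^sup>2\<close>, which converges to \<open>1 - h\<close> and is dominated by \<open>4 (1 - h)\<close>, and
  of \<open>(1 - r\<^sup>2) / |1 - r w|\<^sup>2\<close>, which concentrates with unit mass at each point of \<open>Z\<close> since the mean is \<open>1\<close>.
  Everything is tested against Gaussians, whose integrals against the Abel densities are bounded uniformly in \<open>r\<close>
  by positive definiteness; a mollification then yields all functions \<open>\<phi> * \<phi>~\<close>.
\<close>

section \<open>Almost sure convergence of averages\<close>

text \<open>Two obstacles shape the Fourier side. The density 1 - h can be unbounded at points of
  \<open>Z\<close>, and for a support in no lattice \<open>w\<close> may return arbitrarily close to
  1 far from the origin, so |1 - w| has no global lower bound away from the peaks. What is
  controlled uniformly in r is the integral of the Abel density against a Gaussian: on the side of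
  \<open>\<gamma>\<close> it is a series of nonnegative terms, so it is at most the smoothed
  \<open>\<gamma>\<close> at 0. Through Fatou this makes 1 - h locally integrable, and 1 - h then
  serves as majorant; applied to a wider Gaussian it makes the contribution outside a large window
  negligible. Gaussians fit because they and their transforms decay faster than exp (- |x|), a
  weight with finite \<open>\<gamma>\<close>-integral since the Laplace transform of
  \<open>\<eta>\<close> at 1 is finite. On the probabilistic side the stationary start is harmless:
  the size-biased gap \<open>G 0\<close> separates two half-lines, and only finitely many pairs of
  points on different sides of it lie within a given distance.\<close>

lemma AE_tendsto_0_of_summable_integrals:
  fixes Y :: "nat \<Rightarrow> 'a \<Rightarrow> real"
  assumes int: "\<And>i. integrable M (Y i)" and nonneg: "\<And>i x. x \<in> space M \<Longrightarrow> 0 \<le> Y i x"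
    and sum: "summable c" and le: "\<And>i. integral\<^sup>L M (Y i) \<le> c i"
  shows "AE x in M. (\<lambda>i. Y i x) \<longlonglongrightarrow> 0"
proof -
  have [measurable]: "Y i \<in> borel_measurable M" for i
    using int by auto
  have c0: "0 \<le> c i" for i
    using le[of i] Bochner_Integration.integral_nonneg[of M "Y i", OF nonneg] by linarith
  have "(\<integral>\<^sup>+x. (\<Sum>i. ennreal (Y i x)) \<partial>M) = (\<Sum>i. \<integral>\<^sup>+x. ennreal (Y i x) \<partial>M)"
    by (intro nn_integral_suminf) simp
  also have "\<dots> = (\<Sum>i. ennreal (integral\<^sup>L M (Y i)))"
    using int nonneg by (simp add: nn_integral_eq_integral)
  also have "\<dots> \<le> (\<Sum>i. ennreal (c i))"
    by (intro suminf_le ennreal_leI le) auto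
  also have "\<dots> < \<infinity>"
    using suminf_ennreal_eq[OF c0 summable_sums[OF sum]] by simp
  finally have "AE x in M. (\<Sum>i. ennreal (Y i x)) \<noteq> \<infinity>"
    by (intro nn_integral_PInf_AE) auto
  then show ?thesis
  proof (rule AE_mp[OF _ AE_I2], intro impI)
    fix x assume x: "x \<in> space M" and "(\<Sum>i. ennreal (Y i x)) \<noteq> \<infinity>"
    then have "summable (\<lambda>i. Y i x)"
      using nonneg[OF x] by (intro summable_suminf_not_top) auto
    then show "(\<lambda>i. Y i x) \<longlonglongrightarrow> 0"
      by (rule summable_LIMSEQ_zero)
  qed
qed

lemma integral_square_sum_orthogonal:
  fixes X :: "'i \<Rightarrow> 'a \<Rightarrow> real"
  assumes "finite I" and int: "\<And>i j. i \<in> I \<Longrightarrow> j \<in> I \<Longrightarrow> integrable M (\<lambda>x. X i x * X j x)"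
    and orth: "\<And>i j. i \<in> I \<Longrightarrow> j \<in> I \<Longrightarrow> i \<noteq> j \<Longrightarrow> (LINT x|M. X i x * X j x) = 0"
  shows "(LINT x|M. (\<Sum>i\<in>I. X i x)\<^sup>2) = (\<Sum>i\<in>I. (LINT x|M. (X i x)\<^sup>2))"
    and "integrable M (\<lambda>x. (\<Sum>i\<in>I. X i x)\<^sup>2)"
proof -
  have eq: "(\<Sum>i\<in>I. X i x)\<^sup>2 = (\<Sum>i\<in>I. \<Sum>j\<in>I. X i x * X j x)" for x
    by (simp add: power2_eq_square sum_product)
  have "(LINT x|M. (\<Sum>i\<in>I. X i x)\<^sup>2) = (\<Sum>i\<in>I. \<Sum>j\<in>I. (LINT x|M. X i x * X j x))"
    unfolding eq by (subst Bochner_Integration.integral_sum; (intro sum.cong refl Bochner_Integration.integral_sum Bochner_Integration.integrable_sum int)?)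
  also have "\<dots> = (\<Sum>i\<in>I. \<Sum>j\<in>I. if i = j then (LINT x|M. (X i x)\<^sup>2) else 0)"
    by (intro sum.cong refl) (auto simp: orth power2_eq_square)
  also have "\<dots> = (\<Sum>i\<in>I. (LINT x|M. (X i x)\<^sup>2))"
    using \<open>finite I\<close> by (simp add: sum.delta)
  finally show "(LINT x|M. (\<Sum>i\<in>I. X i x)\<^sup>2) = (\<Sum>i\<in>I. (LINT x|M. (X i x)\<^sup>2))" .
  show "integrable M (\<lambda>x. (\<Sum>i\<in>I. X i x)\<^sup>2)"
    unfolding eq using int by simp
qed

text \<open>Rajchman's strong law: squares \<open>k\<^sup>2\<close> form a subsequence along which the variances are summable,
  and the blocks between consecutive squares are short enough to be controlled crudely.\<close>
lemma AE_averages_orthogonal: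
  fixes X :: "nat \<Rightarrow> 'a \<Rightarrow> real"
  assumes int: "\<And>i j. integrable M (\<lambda>x. X i x * X j x)"
    and orth: "\<And>i j. i \<noteq> j \<Longrightarrow> (LINT x|M. X i x * X j x) = 0"
    and bound: "\<And>i. (LINT x|M. (X i x)\<^sup>2) \<le> C"
    and meas: "\<And>i. X i \<in> borel_measurable M"
  shows "AE x in M. (\<lambda>n. (\<Sum>i<n. X i x) / real n) \<longlonglongrightarrow> 0"
proof -
  note [measurable] = meas
  define A where "A k x = ((\<Sum>i<Suc k ^ 2. X i x) / real (Suc k ^ 2))\<^sup>2" for k x
  \<comment> \<open>Between (k+1)^2 and (k+2)^2 there are 2k + 3 \<le> 3 (k + 1) terms.
    Cauchy-Schwarz alone bounds the integral of \<open>B k\<close> by (2k + 3)^2 C / (k + 1)^4,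
    hence by 9 C / (k + 1)^2; this is the 9 below.\<close>
  define B where "B k x = ((\<Sum>i\<in>{Suc k ^ 2..<Suc (Suc k) ^ 2}. \<bar>X i x\<bar>) / real (Suc k ^ 2))\<^sup>2" for k x
  have C0: "0 \<le> C"
    using bound[of 0] by (rule order_trans[OF Bochner_Integration.integral_nonneg, rotated]) simp
  have sq: "integrable M (\<lambda>x. (X i x)\<^sup>2)" for i
    using int[of i i] by (simp add: power2_eq_square)
  have sumS: "summable (\<lambda>k. c * (1 / real (Suc k ^ 2)))" for c
    using inverse_squares_sums by (intro summable_mult) (auto simp: sums_iff add.commute)
  have A: "AE x in M. (\<lambda>k. A k x) \<longlonglongrightarrow> 0"
  proof (rule AE_tendsto_0_of_summable_integrals[OF _ _ sumS[of C]])
    fix k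
    note * = integral_square_sum_orthogonal[of "{..<Suc k ^ 2}" M X, OF _ int orth]
    show "integrable M (A k)"
      unfolding A_def power_divide using * by auto
    have "integral\<^sup>L M (A k) = (\<Sum>i<Suc k ^ 2. (LINT x|M. (X i x)\<^sup>2)) / (real (Suc k ^ 2))\<^sup>2"
      unfolding A_def power_divide using * by simp
    also have "\<dots> \<le> (\<Sum>i<Suc k ^ 2. C) / (real (Suc k ^ 2))\<^sup>2"
      by (intro divide_right_mono sum_mono bound) auto
    also have "\<dots> = C * (1 / real (Suc k ^ 2))"
      by (simp add: power2_eq_square)
    finally show "integral\<^sup>L M (A k) \<le> C * (1 / real (Suc k ^ 2))" .
  qed (simp add: A_def)
  have B: "AE x in M. (\<lambda>k. B k x) \<longlonglongrightarrow> 0"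
  proof (rule AE_tendsto_0_of_summable_integrals[OF _ _ sumS[of "9 * C"]])
    fix k
    let ?I = "{Suc k ^ 2..<Suc (Suc k) ^ 2}"
    have card: "card ?I = 2 * k + 3"
      by (simp add: power2_eq_square)
    have le: "B k x \<le> (2 * k + 3) * (\<Sum>i\<in>?I. (X i x)\<^sup>2) / (real (Suc k ^ 2))\<^sup>2" for x
    proof -
      have "(\<Sum>i\<in>?I. \<bar>X i x\<bar>)\<^sup>2 \<le> real (card ?I) * (\<Sum>i\<in>?I. (X i x)\<^sup>2)"
        using Cauchy_Schwarz_ineq_sum[of "\<lambda>_. 1" "\<lambda>i. \<bar>X i x\<bar>" ?I] by simp
      then show ?thesis
        unfolding B_def power_divide card by (intro divide_right_mono) (simp_all add: add.commute)
    qed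
    have int': "integrable M (\<lambda>x. (2 * k + 3) * (\<Sum>i\<in>?I. (X i x)\<^sup>2) / (real (Suc k ^ 2))\<^sup>2)"
      using sq by auto
    have [measurable]: "B k \<in> borel_measurable M"
      unfolding B_def by measurable
    have "0 \<le> B k x" for x
      by (simp add: B_def)
    with le have "norm (B k x) \<le> norm ((2 * k + 3) * (\<Sum>i\<in>?I. (X i x)\<^sup>2) / (real (Suc k ^ 2))\<^sup>2)" for x
      by (metis abs_of_nonneg order_trans real_norm_def)
    then show intB: "integrable M (B k)"
      by (intro Bochner_Integration.integrable_bound[OF int']) auto
    have "integral\<^sup>L M (B k) \<le> (LINT x|M. (2 * k + 3) * (\<Sum>i\<in>?I. (X i x)\<^sup>2) / (real (Suc k ^ 2))\<^sup>2)"
      by (intro integral_mono intB int' le)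
    also have "\<dots> = (2 * k + 3) * (\<Sum>i\<in>?I. (LINT x|M. (X i x)\<^sup>2)) / (real (Suc k ^ 2))\<^sup>2"
      using sq by simp
    also have "\<dots> \<le> (2 * k + 3) * (\<Sum>i\<in>?I. C) / (real (Suc k ^ 2))\<^sup>2"
      by (intro divide_right_mono mult_left_mono sum_mono bound) auto
    also have "\<dots> = (2 * k + 3)\<^sup>2 * C / (real (Suc k ^ 2))\<^sup>2"
      unfolding sum_constant card by (simp add: power2_eq_square)
    also have "\<dots> \<le> (3 * real (Suc k))\<^sup>2 * C / (real (Suc k ^ 2))\<^sup>2"
      by (intro divide_right_mono mult_right_mono C0 power_mono) auto
    also have "\<dots> = 9 * C * (1 / real (Suc k ^ 2))"
      by (simp only: of_nat_power power_mult_distrib) (simp add: power2_eq_square)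
    finally show "integral\<^sup>L M (B k) \<le> 9 * C * (1 / real (Suc k ^ 2))" .
  qed (simp add: B_def)
  show ?thesis
    using A B
  proof eventually_elim
    case (elim x)
    define a where "a k = \<bar>(\<Sum>i<Suc k ^ 2. X i x) / real (Suc k ^ 2)\<bar>" for k
    define b where "b k = \<bar>(\<Sum>i\<in>{Suc k ^ 2..<Suc (Suc k) ^ 2}. \<bar>X i x\<bar>) / real (Suc k ^ 2)\<bar>" for k
    have "a \<longlonglongrightarrow> 0"
      using tendsto_real_sqrt[OF elim(1)] unfolding a_def[abs_def] A_def by (simp only: real_sqrt_abs real_sqrt_zero)
    moreover have "b \<longlonglongrightarrow> 0"
      using tendsto_real_sqrt[OF elim(2)] unfolding b_def[abs_def] B_def by (simp only: real_sqrt_abs real_sqrt_zero)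
    ultimately have ab: "(\<lambda>k. a k + b k) \<longlonglongrightarrow> 0"
      by (rule tendsto_add_zero)
    \<comment> \<open>The shift matches \<open>Suc k ^ 2\<close> in \<open>A\<close> and
      \<open>B\<close>: for n \<ge> 1 the largest square not above n is
      \<open>Suc (q n) ^ 2\<close>.\<close>
    define q where "q n = floor_sqrt n - 1" for n
    have q: "filterlim q at_top sequentially"
      unfolding filterlim_at_top
    proof
      fix Z
      have "\<forall>n\<ge>(Z + 1)\<^sup>2. Z \<le> q n"
        unfolding q_def by (metis add_le_imp_le_diff mono_floor_sqrt' floor_sqrt_inverse_power2)
      then show "\<forall>\<^sub>F n in sequentially. Z \<le> q n"
        by (auto simp: eventually_at_top_linorder)
    qed
    have le: "norm ((\<Sum>i<n. X i x) / real n) \<le> a (q n) + b (q n)" if "n \<ge> 1" for n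
    proof -
      define k where "k = q n"
      have pos: "floor_sqrt n \<ge> 1"
        using mono_floor_sqrt'[OF that] by simp
      have k1: "Suc k ^ 2 \<le> n" and k2: "n < Suc (Suc k) ^ 2"
        using floor_sqrt_power2_le[of n] Suc_floor_sqrt_power2_gt[of n] pos
        unfolding k_def q_def by (simp_all del: floor_sqrt_power2_le add: Suc_diff_le[symmetric])
      have "(\<Sum>i<n. X i x) = (\<Sum>i<Suc k ^ 2. X i x) + (\<Sum>i\<in>{Suc k ^ 2..<n}. X i x)"
        using k1 by (metis sum.atLeastLessThan_concat le0 atLeast0LessThan)
      then have "\<bar>\<Sum>i<n. X i x\<bar> \<le> \<bar>\<Sum>i<Suc k ^ 2. X i x\<bar> + (\<Sum>i\<in>{Suc k ^ 2..<n}. \<bar>X i x\<bar>)"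
        using sum_abs[of "\<lambda>i. X i x" "{Suc k ^ 2..<n}"] by linarith
      also have "(\<Sum>i\<in>{Suc k ^ 2..<n}. \<bar>X i x\<bar>) \<le> (\<Sum>i\<in>{Suc k ^ 2..<Suc (Suc k) ^ 2}. \<bar>X i x\<bar>)"
        using k2 by (intro sum_mono2) auto
      finally have "\<bar>\<Sum>i<n. X i x\<bar> / real n \<le> (\<bar>\<Sum>i<Suc k ^ 2. X i x\<bar> + (\<Sum>i\<in>{Suc k ^ 2..<Suc (Suc k) ^ 2}. \<bar>X i x\<bar>)) / real (Suc k ^ 2)"
        using k1 by (intro frac_le) (auto simp: sum_nonneg simp flip: of_nat_power)
      then show ?thesis
        unfolding a_def b_def k_def[symmetric]
        by (simp add: add_divide_distrib sum_nonneg abs_of_nonneg)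
    qed
    show ?case
      by (rule Lim_null_comparison[OF _ filterlim_compose[OF ab q]])
        (use le in \<open>auto simp: eventually_at_top_linorder\<close>)
  qed
qed

text \<open>Independence in the form used below: a function of one variable against a function of
  variables with other indices, in particular of the past \<open>{..<j}\<close>.\<close>

lemma (in prob_space) indep_var_functions_of_restrict:
  assumes "indep_vars M' X UNIV" "A \<inter> B = {}"
    and "f \<in> measurable (PiM A M') N1" "g \<in> measurable (PiM B M') N2"
  shows "indep_var N1 (\<lambda>x. f (restrict (\<lambda>i. X i x) A)) N2 (\<lambda>x. g (restrict (\<lambda>i. X i x) B))"
  using indep_var_compose[OF indep_var_restrict[OF assms(1,2)] assms(3,4)] by (simp add: comp_def)

lemma AE_averages_iid_bounded:
  fixes X :: "nat \<Rightarrow> 'a \<Rightarrow> real"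
  assumes "prob_space M" and ind: "prob_space.indep_vars M (\<lambda>_. borel) X UNIV"
    and bd: "\<And>i x. \<bar>X i x\<bar> \<le> C" and mean: "\<And>i. integral\<^sup>L M (X i) = m"
  shows "AE x in M. (\<lambda>n. (\<Sum>i<n. X i x) / real n) \<longlonglongrightarrow> m"
proof -
  interpret prob_space M by fact
  have [measurable]: "X i \<in> borel_measurable M" for i
    using ind by (auto simp: indep_vars_def)
  have C0: "0 \<le> C"
    using bd[of undefined undefined] by linarith
  have bd': "\<bar>X i x - m\<bar> \<le> C + \<bar>m\<bar>" for i x
    using bd[of i x] by linarith
  have int: "integrable M (\<lambda>x. (X i x - m) * (X j x - m))" for i j
    by (rule integrable_const_bound[of _ "(C + \<bar>m\<bar>) * (C + \<bar>m\<bar>)"])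
      (auto simp: abs_mult C0 intro!: AE_I2 mult_mono bd' add_nonneg_nonneg)
  have intX: "integrable M (X i)" for i
    by (rule integrable_const_bound[of _ C]) (auto simp: bd)
  have "AE x in M. (\<lambda>n. (\<Sum>i<n. X i x - m) / real n) \<longlonglongrightarrow> 0"
  proof (rule AE_averages_orthogonal[OF int])
    fix i j :: nat assume "i \<noteq> j"
    then have "indep_var borel (\<lambda>x. X i x - m) borel (\<lambda>x. X j x - m)"
      using indep_var_functions_of_restrict[OF ind, of "{i}" "{j}" "\<lambda>h. h i - m" borel "\<lambda>h. h j - m" borel]
      by simp
    then show "(LINT x|M. (X i x - m) * (X j x - m)) = 0"
      by (subst indep_var_lebesgue_integral) (auto simp: intX mean prob_space)
  next
    fix i
    have "(LINT x|M. (X i x - m)\<^sup>2) \<le> (LINT x|M. (C + \<bar>m\<bar>)\<^sup>2)"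
      using int[of i i] power_mono[OF bd', of i _ 2] by (intro integral_mono) (auto simp: power2_eq_square)
    then show "(LINT x|M. (X i x - m)\<^sup>2) \<le> (C + \<bar>m\<bar>)\<^sup>2"
      by (simp add: prob_space)
  qed simp
  then show ?thesis
  proof eventually_elim
    case (elim x)
    have "(\<lambda>n. (\<Sum>i<n. X i x - m) / real n + m) \<longlonglongrightarrow> m"
      using tendsto_add[OF elim tendsto_const[of m]] by simp
    then show ?case
      by (rule Lim_transform_eventually[OF _ eventually_mono[OF eventually_gt_at_top[of 0]]])
        (auto simp: sum_subtractf field_simps)
  qed
qed


section \<open>Averages of exponential pair sums\<close>

text \<open>For the gaps \<open>X\<close> of a point sequence \<open>x\<close>, this is \<open>\<Sum>\<^sub>i\<^sub><\<^sub>j exp (- s (x\<^sub>j - x\<^sub>i))\<close>.\<close>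
primrec perpetuity :: "real \<Rightarrow> (nat \<Rightarrow> real) \<Rightarrow> nat \<Rightarrow> real" where
  "perpetuity s X 0 = 0"
| "perpetuity s X (Suc j) = exp (- s * X j) * (1 + perpetuity s X j)"

lemma perpetuity_cong: "(\<And>i. i < j \<Longrightarrow> X i = Y i) \<Longrightarrow> perpetuity s X j = perpetuity s Y j"
  by (induction j) auto

lemma perpetuity_nonneg: "0 \<le> perpetuity s X j"
  by (induction j) auto

lemma perpetuity_le: "s \<ge> 0 \<Longrightarrow> (\<And>i. X i \<ge> 0) \<Longrightarrow> perpetuity s X j \<le> real j"
proof (induction j)
  case (Suc j)
  have "exp (- s * X j) * (1 + perpetuity s X j) \<le> 1 * (1 + real j)"
    using Suc by (intro mult_mono) (auto simp: perpetuity_nonneg)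
  then show ?case by simp
qed simp

text \<open>The product over \<open>{..<n}\<close> records that the j-th value depends on the first
  j gaps only, which is what independence from the next gap requires.\<close>

lemma measurable_perpetuity [measurable]:
  assumes "j \<le> n" shows "(\<lambda>X. perpetuity s X j) \<in> borel_measurable (PiM {..<n} (\<lambda>_. borel))"
  using assms
proof (induction j)
  case (Suc j)
  then have [measurable]: "(\<lambda>X. perpetuity s X j) \<in> borel_measurable (PiM {..<n} (\<lambda>_. borel))"
    and "j < n"
    by simp_all
  then have "(\<lambda>X. X j) \<in> borel_measurable (PiM {..<n} (\<lambda>_. borel))"
    by (intro measurable_component_singleton) simp
  note [measurable] = this
  show ?case
    by (simp only: perpetuity.simps) measurable
qed simp

text \<open>The differences \<open>B\<^sub>j\<^sub>+\<^sub>1 - \<rho> (1 + B\<^sub>j)\<close> are orthogonal, so the averages of \<open>B\<close> solve \<open>m = \<rho> (1 + m)\<close>.\<close>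
lemma AE_averages_perpetuity:
  fixes X :: "nat \<Rightarrow> 'a \<Rightarrow> real"
  assumes "prob_space M" and ind: "prob_space.indep_vars M (\<lambda>_. borel) X UNIV"
    and nonneg: "\<And>i x. 0 \<le> X i x" and s: "0 < s"
    and mean: "\<And>i. (LINT x|M. exp (- s * X i x)) = \<rho>" and \<rho>: "0 \<le> \<rho>" "\<rho> < 1"
  shows "AE x in M. (\<lambda>n. (\<Sum>j<n. perpetuity s (\<lambda>i. X i x) j) / real n) \<longlonglongrightarrow> \<rho> / (1 - \<rho>)"
proof -
  interpret prob_space M by fact
  define B where "B j x = perpetuity s (\<lambda>i. X i x) j" for j x
  define D where "D j x = (exp (- s * X j x) - \<rho>) * (1 + B j x)" for j x
  have [measurable]: "X i \<in> borel_measurable M" for i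
    using ind by (auto simp: indep_vars_def)
  have B_restrict: "B j x = perpetuity s (restrict (\<lambda>i. X i x) {..<n}) j" if "j \<le> n" for j n x
    unfolding B_def using that by (intro perpetuity_cong) auto
  have B_meas [measurable]: "B j \<in> borel_measurable M" for j
    by (induction j) (auto simp: B_def)
  have B0: "0 \<le> B j x" and Bj: "B j x \<le> real j" for j x
    unfolding B_def using perpetuity_nonneg perpetuity_le nonneg s by (auto intro: less_imp_le)
  have e: "0 < exp (- s * X i x)" "exp (- s * X i x) \<le> 1" for i x
    using nonneg s by auto
  have e\<rho>: "\<bar>exp (- s * X i x) - \<rho>\<bar> \<le> 1" for i x
    using e[of i x] \<rho> unfolding abs_le_iff by linarith
  have intB: "integrable M (B j)" for j
    by (rule integrable_const_bound[of _ "real j"]) (use B0 Bj in auto)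
  have intB2: "integrable M (\<lambda>x. (B j x)\<^sup>2)" for j
    by (rule integrable_const_bound[of _ "(real j)\<^sup>2"]) (use B0 Bj in \<open>auto intro!: power_mono\<close>)
  have D_abs: "\<bar>D j x\<bar> \<le> 1 + B j x" for j x
    unfolding D_def abs_mult using mult_mono[OF e\<rho>, of "\<bar>1 + B j x\<bar>" "1 + B j x"] B0[of j x] by simp
  have intexp: "integrable M (\<lambda>x. exp (- s * X i x))" for i
    by (rule integrable_const_bound[of _ 1]) (use e in auto)
  have indep_fun: "(LINT x|M. (h (X j x)) * F (restrict (\<lambda>i. X i x) {..<j})) = (LINT x|M. h (X j x)) * (LINT x|M. F (restrict (\<lambda>i. X i x) {..<j}))"
    if "h \<in> borel_measurable borel" "F \<in> borel_measurable (PiM {..<j} (\<lambda>_. borel))"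
      "integrable M (\<lambda>x. h (X j x))" "integrable M (\<lambda>x. F (restrict (\<lambda>i. X i x) {..<j}))" for h j and F :: "_ \<Rightarrow> real"
  proof -
    have hm: "(\<lambda>g. h (g j)) \<in> borel_measurable (PiM {j} (\<lambda>_. borel))"
      by (rule measurable_compose[of "\<lambda>g. g j" _ borel h, OF measurable_component_singleton that(1)]) simp
    show ?thesis
      using indep_var_lebesgue_integral[OF _ that(3,4)] indep_var_functions_of_restrict[OF ind _ hm that(2)]
      by simp
  qed
  \<comment> \<open>Since exp (- 2 s X) \<le> exp (- s X), the L2 norms satisfy b_{j+1}^2 \<le>
    \<rho> (1 + b_j)^2. The bound b = 2 / (1 - \<rho>) is preserved: 1 + b = (3 - \<rho>) / (1 -
    \<rho>), and 4 - \<rho> (3 - \<rho>)^2 = (1 - \<rho>)^2 (4 - \<rho>) \<ge> 0.\<close>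
  have second: "(LINT x|M. (B j x)\<^sup>2) \<le> 4 / (1 - \<rho>)\<^sup>2" for j
  proof (induction j)
    case (Suc j)
    let ?E = "\<lambda>f. integral\<^sup>L M f :: real"
    have EB: "(?E (B j))\<^sup>2 \<le> ?E (\<lambda>x. (B j x)\<^sup>2)"
      using variance_positive[of "B j"] variance_eq[OF intB intB2] by simp
    have "?E (\<lambda>x. (B (Suc j) x)\<^sup>2) \<le> ?E (\<lambda>x. exp (- s * X j x) * (1 + B j x)\<^sup>2)"
    proof (rule integral_mono)
      show "integrable M (\<lambda>x. (B (Suc j) x)\<^sup>2)" by (rule intB2)
      have "exp (- s * X j x) * (1 + B j x)\<^sup>2 \<le> 1 * (1 + real j)\<^sup>2" for x
        by (intro mult_mono power_mono e add_left_mono Bj) (simp_all add: B0)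
      then show "integrable M (\<lambda>x. exp (- s * X j x) * (1 + B j x)\<^sup>2)"
        by (intro integrable_const_bound[of _ "1 * (1 + real j)\<^sup>2"] AE_I2) (simp_all add: abs_mult)
      fix x
      have "B (Suc j) x = exp (- s * X j x) * (1 + B j x)"
        by (simp add: B_def)
      moreover have "(exp (- s * X j x))\<^sup>2 \<le> exp (- s * X j x)"
        using e[of j x] by (simp add: power2_eq_square mult_left_le)
      ultimately show "(B (Suc j) x)\<^sup>2 \<le> exp (- s * X j x) * (1 + B j x)\<^sup>2"
        by (simp add: power_mult_distrib mult_right_mono)
    qed
    also have "\<dots> = \<rho> * ?E (\<lambda>x. (1 + B j x)\<^sup>2)"
      using indep_fun[of "\<lambda>y. exp (- s * y)" "\<lambda>g. (1 + perpetuity s g j)\<^sup>2" j] intexp intB2[of j] intB[of j]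
      by (simp add: mean[simplified] B_restrict[symmetric] power2_sum prob_space)
    also have "?E (\<lambda>x. (1 + B j x)\<^sup>2) = 1 + 2 * ?E (B j) + ?E (\<lambda>x. (B j x)\<^sup>2)"
      using intB2[of j] intB[of j] by (simp add: power2_sum prob_space)
    also have "\<dots> \<le> (1 + 2 / (1 - \<rho>))\<^sup>2"
    proof -
      have "(?E (B j))\<^sup>2 \<le> (2 / (1 - \<rho>))\<^sup>2"
        using EB Suc by (simp add: power_divide)
      then have "?E (B j) \<le> 2 / (1 - \<rho>)"
        by (rule power2_le_imp_le) (use \<rho> in simp)
      moreover have "(1 + 2 / (1 - \<rho>))\<^sup>2 = 1 + 2 * (2 / (1 - \<rho>)) + 4 / (1 - \<rho>)\<^sup>2"
        by (simp only: power2_sum power_divide) simp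
      ultimately show ?thesis
        using Suc by linarith
    qed
    also have "\<rho> * (1 + 2 / (1 - \<rho>))\<^sup>2 \<le> 4 / (1 - \<rho>)\<^sup>2"
    proof -
      have "(1 + 2 / (1 - \<rho>))\<^sup>2 = (3 - \<rho>)\<^sup>2 / (1 - \<rho>)\<^sup>2"
        using \<rho> by (simp add: add_divide_eq_iff power_divide)
      moreover have "\<rho> * (3 - \<rho>)\<^sup>2 \<le> 4"
      proof -
        have "4 - \<rho> * (3 - \<rho>)\<^sup>2 = (1 - \<rho>)\<^sup>2 * (4 - \<rho>)"
          by (simp add: power2_eq_square algebra_simps)
        moreover have "0 \<le> (1 - \<rho>)\<^sup>2 * (4 - \<rho>)"
          using \<rho> by simp
        ultimately show ?thesis by linarith
      qed
      ultimately show ?thesis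
        by (simp add: divide_right_mono)
    qed
    finally show ?case
      using \<rho> by (simp add: mult_left_mono)
  qed (simp add: B_def)
  have "AE x in M. (\<lambda>n. (\<Sum>i<n. D i x) / real n) \<longlonglongrightarrow> 0"
  proof (rule AE_averages_orthogonal)
    show "D i \<in> borel_measurable M" for i
      unfolding D_def by measurable
    then have [measurable]: "D i \<in> borel_measurable M" for i .
    show int: "integrable M (\<lambda>x. D i x * D j x)" for i j
      by (rule integrable_const_bound[of _ "(1 + real i) * (1 + real j)"])
        (auto simp: abs_mult intro!: AE_I2 mult_mono order_trans[OF D_abs] Bj)
    have orth: "(LINT x|M. D i x * D j x) = 0" if "i < j" for i j
    proof -
      \<comment> \<open>For i < j the product (1 + B_j) D_i depends only on the first j gaps, hence
        is independent of X_j, and the remaining factor exp (- s X_j) - \<rho> has mean 0.\<close>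
      define F where "F g = (1 + perpetuity s g j) * ((exp (- s * g i) - \<rho>) * (1 + perpetuity s g i))" for g
      have F: "F (restrict (\<lambda>i. X i x) {..<j}) = (1 + B j x) * D i x" for x
        using that by (simp add: F_def D_def B_restrict[of _ j, symmetric])
      have Fm: "F \<in> borel_measurable (PiM {..<j} (\<lambda>_. borel))"
        unfolding F_def
        by (intro borel_measurable_times borel_measurable_add borel_measurable_diff borel_measurable_exp
            borel_measurable_const measurable_perpetuity measurable_component_singleton) (use that in auto)
      have "integrable M (\<lambda>x. (1 + B j x) * D i x)"
        by (rule integrable_const_bound[of _ "(1 + real j) * (1 + real i)"])
          (use B0 in \<open>auto simp: abs_mult abs_of_nonneg intro!: AE_I2 mult_mono order_trans[OF D_abs] Bj\<close>)
      then have "(LINT x|M. (exp (- s * X j x) - \<rho>) * ((1 + B j x) * D i x)) = 0"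
        using indep_fun[of "\<lambda>y. exp (- s * y) - \<rho>" F j, OF _ Fm] intexp[of j] by (simp add: F mean[simplified] prob_space)
      then show ?thesis
        by (simp add: D_def[of j] mult_ac)
    qed
    show "(LINT x|M. D i x * D j x) = 0" if "i \<noteq> j" for i j
      using orth[of i j] orth[of j i] that by (cases i j rule: linorder_cases) (auto simp: mult.commute)
    show "(LINT x|M. (D i x)\<^sup>2) \<le> 2 + 2 * (4 / (1 - \<rho>)\<^sup>2)" for i
    proof -
      have "(LINT x|M. (D i x)\<^sup>2) \<le> (LINT x|M. 2 + 2 * (B i x)\<^sup>2)"
      proof (rule integral_mono)
        show "integrable M (\<lambda>x. (D i x)\<^sup>2)" using int[of i i] by (simp add: power2_eq_square)
        show "integrable M (\<lambda>x. 2 + 2 * (B i x)\<^sup>2)" using intB2 by simp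
        fix x
        have "(D i x)\<^sup>2 \<le> (1 + B i x)\<^sup>2"
          using power_mono[OF D_abs[of i x], of 2] by simp
        also have "\<dots> \<le> 2 + 2 * (B i x)\<^sup>2"
          using sum_squares_bound[of 1 "B i x"] by (simp add: power2_sum)
        finally show "(D i x)\<^sup>2 \<le> 2 + 2 * (B i x)\<^sup>2" .
      qed
      also have "\<dots> \<le> 2 + 2 * (4 / (1 - \<rho>)\<^sup>2)"
        using second[of i] intB2 by (simp add: prob_space)
      finally show ?thesis .
    qed
  qed
  \<comment> \<open>Summing B_{j+1} = D_j + \<rho> (1 + B_j) over j < n leaves the boundary term
    B_n, which must be o(n). Bounded second moments divided by n^2 are summable, so B_n / n tends to
    0 almost surely.\<close>
  moreover have "AE x in M. (\<lambda>n. (B (Suc n) x / real (Suc n))\<^sup>2) \<longlonglongrightarrow> 0"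
  proof (rule AE_tendsto_0_of_summable_integrals)
    show "integrable M (\<lambda>x. (B (Suc i) x / real (Suc i))\<^sup>2)" for i
      unfolding power_divide using intB2 by simp
    show "summable (\<lambda>k. 4 / (1 - \<rho>)\<^sup>2 * (1 / real (Suc k ^ 2)))"
      using inverse_squares_sums by (intro summable_mult) (auto simp: sums_iff add.commute)
    show "(LINT x|M. (B (Suc i) x / real (Suc i))\<^sup>2) \<le> 4 / (1 - \<rho>)\<^sup>2 * (1 / real (Suc i ^ 2))" for i
      unfolding power_divide using divide_right_mono[OF second[of "Suc i"], of "(real (Suc i))\<^sup>2"] intB2 by simp
  qed simp
  ultimately show ?thesis
  proof eventually_elim
    case (elim x)
    have "(\<lambda>n. \<bar>B (Suc n) x / real (Suc n)\<bar>) \<longlonglongrightarrow> 0"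
      using tendsto_real_sqrt[OF elim(2)] by simp
    then have BS: "(\<lambda>n. B n x / real n) \<longlonglongrightarrow> 0"
      by (subst filterlim_sequentially_Suc[symmetric]) (simp add: B0 abs_of_nonneg)
    have eq: "(\<Sum>j<n. B j x) * (1 - \<rho>) = (\<Sum>j<n. D j x) + \<rho> * real n - B n x" for n
    proof (induction n)
      case (Suc n)
      have "B (Suc n) x = exp (- s * X n x) * (1 + B n x)"
        by (simp add: B_def)
      then show ?case
        using Suc unfolding sum.lessThan_Suc of_nat_Suc D_def by algebra
    qed (simp add: B_def)
    have "(\<lambda>n. ((\<Sum>j<n. D j x) / real n + \<rho> - B n x / real n) / (1 - \<rho>)) \<longlonglongrightarrow> (0 + \<rho> - 0) / (1 - \<rho>)"
      using \<rho> by (intro tendsto_intros elim BS) auto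
    then have "(\<lambda>n. ((\<Sum>j<n. D j x) / real n + \<rho> - B n x / real n) / (1 - \<rho>)) \<longlonglongrightarrow> \<rho> / (1 - \<rho>)"
      by simp
    then have "(\<lambda>n. (\<Sum>j<n. B j x) / real n) \<longlonglongrightarrow> \<rho> / (1 - \<rho>)"
    proof (rule Lim_transform_eventually)
      show "\<forall>\<^sub>F n in sequentially. ((\<Sum>j<n. D j x) / real n + \<rho> - B n x / real n) / (1 - \<rho>) = (\<Sum>j<n. B j x) / real n"
        using eventually_gt_at_top[of 0]
      proof eventually_elim
        case (elim n)
        then have "((\<Sum>j<n. D j x) / real n + \<rho> - B n x / real n) = (\<Sum>j<n. B j x) * (1 - \<rho>) / real n"
          unfolding eq by (simp add: field_simps)
        then show ?case
          using \<rho> by simp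
      qed
    qed
    then show ?case
      by (simp add: B_def)
  qed
qed

section \<open>Strong law of large numbers under a moment of order 1 + \<epsilon>\<close>

text \<open>Splitting each term at height \<open>c\<close>, the excess over \<open>c\<close> has small averages along powers of two, hence by
  monotonicity of its partial sums small averages everywhere, up to a factor of two.\<close>
lemma averages_tendsto_of_dyadic:
  fixes X :: "nat \<Rightarrow> real"
  assumes dyadic: "(\<lambda>i. (\<Sum>k<2 ^ i. X k) / 2 ^ i) \<longlonglongrightarrow> m"
    and trunc: "\<And>c::nat. (\<lambda>n. (\<Sum>i<n. min (X i) (real c)) / real n) \<longlonglongrightarrow> e c"
    and e: "e \<longlonglongrightarrow> m"
  shows "(\<lambda>n. (\<Sum>i<n. X i) / real n) \<longlonglongrightarrow> m"
proof (rule tendstoI)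
  fix \<epsilon> :: real assume "0 < \<epsilon>"
  \<comment> \<open>One \<delta> for the truncated averages, one for \<open>e c\<close>, and two for
    the excess \<open>Z\<close>, whose dyadic control costs a factor of two.\<close>
  define \<delta> where "\<delta> = \<epsilon> / 4"
  have "0 < \<delta>" using \<open>0 < \<epsilon>\<close> by (simp add: \<delta>_def)
  from tendstoD[OF e this] obtain c where c: "\<bar>e c - m\<bar> < \<delta>"
    by (auto simp: eventually_sequentially dist_real_def)
  define T where "T n = (\<Sum>i<n. min (X i) (real c))" for n
  define Z where "Z n = (\<Sum>i<n. X i - min (X i) (real c))" for n
  have Z_mono: "Z n \<le> Z n'" if "n \<le> n'" for n n'
    unfolding Z_def using that by (intro sum_mono2) auto
  have Z0: "0 \<le> Z n" for n
    unfolding Z_def by (intro sum_nonneg) auto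
  have S: "(\<Sum>i<n. X i) = T n + Z n" for n
    by (simp add: T_def Z_def sum_subtractf)
  have "filterlim (\<lambda>i::nat. (2::nat) ^ i) at_top sequentially"
    by (rule filterlim_subseq) (simp add: strict_mono_def)
  from filterlim_compose[OF trunc this] have "(\<lambda>i. T (2 ^ i) / 2 ^ i) \<longlonglongrightarrow> e c"
    by (simp add: T_def)
  from tendsto_diff[OF dyadic this] have "(\<lambda>i. Z (2 ^ i) / 2 ^ i) \<longlonglongrightarrow> m - e c"
    by (simp add: S add_divide_distrib)
  then have "\<forall>\<^sub>F i in sequentially. Z (2 ^ i) / 2 ^ i < \<delta>"
    by (rule order_tendstoD(2)) (use c in linarith)
  then obtain i0 where i0: "Z (2 ^ i) / 2 ^ i < \<delta>" if "i \<ge> i0" for i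
    by (auto simp: eventually_sequentially)
  have "\<forall>\<^sub>F n in sequentially. \<bar>T n / real n - e c\<bar> < \<delta>"
    using tendstoD[OF trunc[of c] \<open>0 < \<delta>\<close>] by (simp add: T_def dist_real_def)
  then show "\<forall>\<^sub>F n in sequentially. dist ((\<Sum>i<n. X i) / real n) m < \<epsilon>"
    using eventually_ge_at_top[of "2 ^ i0"]
  proof eventually_elim
    case (elim n)
    have npos: "n > 0" using elim(2) by (meson less_le_trans zero_less_power zero_less_numeral)
    define i where "i = floor_log n"
    have i: "2 ^ i \<le> n" "n < 2 * 2 ^ i"
      using floor_log_exp2_le[OF npos] floor_log_exp2_gt[of n] by (auto simp: i_def)
    have "(2::nat) ^ i0 < 2 ^ Suc i"
      using elim(2) i by simp
    then have "i0 \<le> Suc i"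
      by (intro less_imp_le) (rule power_less_imp_less_exp[of 2], auto)
    have "Z n / real n \<le> Z (2 ^ Suc i) / real (2 ^ i)"
      using i npos Z0 by (intro frac_le Z_mono) (auto simp flip: of_nat_power)
    also have "\<dots> = 2 * (Z (2 ^ Suc i) / 2 ^ Suc i)"
      by simp
    also have "\<dots> < 2 * \<delta>"
      using i0[OF \<open>i0 \<le> Suc i\<close>] by simp
    finally have "\<bar>T n / real n + Z n / real n - m\<bar> < 4 * \<delta>"
      using elim(1) c Z0[of n] divide_nonneg_nonneg[of "Z n" "real n"] by linarith
    then show ?case
      by (simp add: S add_divide_distrib dist_real_def \<delta>_def)
  qed
qed

text \<open>Write y^2 = y^(1+\<epsilon>) y^(1-\<epsilon>) and y = y^(1+\<epsilon>) y^(-\<epsilon>)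
  and compare the last factor with the same power of t; the first comparison is monotone because
  \<epsilon> \<le> 1. With t = 2^i the bounds control the variance of the truncated variables and
  the mean of the part cut off.\<close>

lemma truncation_bounds:
  fixes y t \<epsilon> :: real
  assumes "0 \<le> y" "0 < t" "0 < \<epsilon>" "\<epsilon> \<le> 1"
  shows "(min y t)\<^sup>2 \<le> y powr (1 + \<epsilon>) * t powr (1 - \<epsilon>)"
    and "y - min y t \<le> y powr (1 + \<epsilon>) * t powr - \<epsilon>"
proof -
  consider "y = 0" | "0 < y" "y \<le> t" | "t < y" "0 < y"
    using assms by linarith
  then have "(min y t)\<^sup>2 \<le> y powr (1 + \<epsilon>) * t powr (1 - \<epsilon>) \<and> y - min y t \<le> y powr (1 + \<epsilon>) * t powr - \<epsilon>"
  proof cases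
    case 2
    have "y\<^sup>2 = y powr (1 + \<epsilon>) * y powr (1 - \<epsilon>)"
      using 2 by (simp add: powr_add[symmetric])
    also have "\<dots> \<le> y powr (1 + \<epsilon>) * t powr (1 - \<epsilon>)"
      using 2 assms by (intro mult_left_mono powr_mono2) auto
    finally show ?thesis using 2 by simp
  next
    case 3
    have "t\<^sup>2 = t powr (1 + \<epsilon>) * t powr (1 - \<epsilon>)"
      using assms by (simp add: powr_add[symmetric])
    also have "\<dots> \<le> y powr (1 + \<epsilon>) * t powr (1 - \<epsilon>)"
      using 3 assms by (intro mult_right_mono powr_mono2) auto
    finally have *: "t\<^sup>2 \<le> y powr (1 + \<epsilon>) * t powr (1 - \<epsilon>)" .
    have "y = y powr (1 + \<epsilon>) * y powr (- \<epsilon>)"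
      using 3 by (simp add: powr_add[symmetric])
    also have "\<dots> \<le> y powr (1 + \<epsilon>) * t powr (- \<epsilon>)"
      using 3 assms by (intro mult_left_mono powr_mono2') auto
    finally show ?thesis using 3 * assms by simp
  qed (use assms in auto)
  then show "(min y t)\<^sup>2 \<le> y powr (1 + \<epsilon>) * t powr (1 - \<epsilon>)"
    and "y - min y t \<le> y powr (1 + \<epsilon>) * t powr - \<epsilon>" by auto
qed

text \<open>Truncate the first 2^i variables at height 2^i. The mean excess and the variance of the
  truncated average are both at most K q^i with q = 2^(-\<epsilon>), hence summable, so the averages
  converge along powers of two. Truncations at fixed heights are bounded and already covered;
  \<open>averages_tendsto_of_dyadic\<close> passes to all n.\<close>

lemma AE_averages_iid_moment:
  fixes X :: "nat \<Rightarrow> 'a \<Rightarrow> real"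
  assumes "prob_space M" and ind: "prob_space.indep_vars M (\<lambda>_. borel) X UNIV"
    and nonneg: "\<And>i x. 0 \<le> X i x" and law: "\<And>i. distr M borel (X i) = N"
    and \<epsilon>: "0 < \<epsilon>" "\<epsilon> \<le> 1" and moment: "integrable N (\<lambda>y. \<bar>y\<bar> powr (1 + \<epsilon>))"
    and mean: "integrable N (\<lambda>y. y)" "(LINT y|N. y) = m"
  shows "AE x in M. (\<lambda>n. (\<Sum>i<n. X i x) / real n) \<longlonglongrightarrow> m"
proof -
  interpret prob_space M by fact
  have [measurable]: "X i \<in> borel_measurable M" for i
    using ind by (auto simp: indep_vars_def)
  have [measurable_cong]: "sets N = sets borel"
    using law by (metis sets_distr)
  have tr: "(LINT x|M. g (X i x)) = integral\<^sup>L N g" if "g \<in> borel_measurable borel" for g :: "real \<Rightarrow> real" and i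
    using that by (subst law[of i, symmetric], subst integral_distr) auto
  have tri: "integrable M (\<lambda>x. g (X i x)) = integrable N g" if "g \<in> borel_measurable borel" for g :: "real \<Rightarrow> real" and i
    using that by (subst law[of i, symmetric], subst integrable_distr_eq) auto
  have AE_N: "AE y in N. 0 \<le> y"
    using nonneg by (subst law[of 0, symmetric], subst AE_distr_iff) auto
  have intX: "integrable M (X i)" and EX: "integral\<^sup>L M (X i) = m" for i
  proof -
    have id: "(\<lambda>y::real. y) \<in> borel_measurable borel" by simp
    show "integrable M (X i)" using tri[OF id, of i] mean(1) by (rule iffD2)
    show "integral\<^sup>L M (X i) = m" using tr[OF id, of i] mean(2) by (rule trans)
  qed
  define K where "K = (LINT y|N. \<bar>y\<bar> powr (1 + \<epsilon>))"
  have intK: "integrable M (\<lambda>x. X i x powr (1 + \<epsilon>))" and EK: "(LINT x|M. X i x powr (1 + \<epsilon>)) = K" for i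
  proof -
    have m: "(\<lambda>y::real. \<bar>y\<bar> powr (1 + \<epsilon>)) \<in> borel_measurable borel" by measurable
    have *: "(\<lambda>x. \<bar>X i x\<bar> powr (1 + \<epsilon>)) = (\<lambda>x. X i x powr (1 + \<epsilon>))"
      using nonneg by simp
    show "integrable M (\<lambda>x. X i x powr (1 + \<epsilon>))"
      using tri[OF m, of i] moment unfolding * by (rule iffD2)
    show "(LINT x|M. X i x powr (1 + \<epsilon>)) = K"
      using tr[OF m, of i] unfolding * K_def .
  qed
  define q where "q = 2 powr (- \<epsilon>)"
  have q: "0 < q" "q < 1"
    using \<epsilon> by (auto simp: q_def powr_less_one)
  have q_pow: "(2 ^ i) powr (- \<epsilon>) = q ^ i" for i :: nat
  proof -
    have "(2 ^ i) powr (- \<epsilon>) = (2 powr real i) powr (- \<epsilon>)"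
      by (simp add: powr_realpow)
    also have "\<dots> = q powr real i"
      by (simp add: q_def powr_powr mult.commute)
    finally show ?thesis
      using q by (simp add: powr_realpow)
  qed
  have summ: "summable (\<lambda>i. K * q ^ i)"
    using q by (intro summable_mult summable_geometric) auto
  have Eq0: "(\<lambda>i. K * q ^ i) \<longlonglongrightarrow> 0"
    by (rule summable_LIMSEQ_zero[OF summ])
  define Y where "Y i k x = min (X k x) (2 ^ i)" for i k x
  define E where "E i = (LINT y|N. min y (2 ^ i))" for i :: nat
  have Y_meas [measurable]: "Y i k \<in> borel_measurable M" for i k
    unfolding Y_def by measurable
  have Y: "0 \<le> Y i k x" "Y i k x \<le> 2 ^ i" for i k x
    using nonneg by (auto simp: Y_def)
  have EY: "integral\<^sup>L M (Y i k) = E i" for i k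
    using tr[of "\<lambda>y. min y (2 ^ i)"] by (simp add: Y_def[abs_def] E_def)
  have intY: "integrable M (Y i k)" for i k
    by (rule integrable_const_bound[of _ "2 ^ i"]) (use Y in auto)
  have intYY: "integrable M (\<lambda>x. (Y i k x)\<^sup>2)" for i k
    by (rule integrable_const_bound[of _ "(2 ^ i)\<^sup>2"]) (use Y in \<open>auto intro!: power_mono\<close>)
  have gap: "(LINT x|M. X k x - Y i k x) \<le> K * q ^ i" for i k
  proof -
    have "(LINT x|M. X k x - Y i k x) \<le> (LINT x|M. X k x powr (1 + \<epsilon>) * q ^ i)"
      using truncation_bounds(2)[OF nonneg _ \<epsilon>, of "2 ^ i"] intX intY intK
      by (intro integral_mono) (auto simp: Y_def q_pow)
    then show ?thesis by (simp add: EK)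
  qed
  have "AE x in M. (\<lambda>i. (\<Sum>k<2 ^ i. X k x - Y i k x) / 2 ^ i) \<longlonglongrightarrow> 0"
  proof (rule AE_tendsto_0_of_summable_integrals[OF _ _ summ])
    show "integrable M (\<lambda>x. (\<Sum>k<2 ^ i. X k x - Y i k x) / 2 ^ i)" for i :: nat
      using intX intY by auto
    show "0 \<le> (\<Sum>k<2 ^ i. X k x - Y i k x) / 2 ^ i" for i :: nat and x
      by (auto simp: Y_def intro!: divide_nonneg_nonneg sum_nonneg)
    show "(LINT x|M. (\<Sum>k<2 ^ i. X k x - Y i k x) / 2 ^ i) \<le> K * q ^ i" for i :: nat
    proof -
      have "(LINT x|M. (\<Sum>k<2 ^ i. X k x - Y i k x) / 2 ^ i)
          = (\<Sum>k<2 ^ i. (LINT x|M. X k x - Y i k x)) / 2 ^ i"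
        using intX intY by (simp add: Bochner_Integration.integral_sum)
      also have "\<dots> \<le> (\<Sum>k<(2::nat) ^ i. K * q ^ i) / 2 ^ i"
        by (intro divide_right_mono sum_mono gap) auto
      finally show ?thesis by simp
    qed
  qed
  moreover have "AE x in M. (\<lambda>i. ((\<Sum>k<2 ^ i. Y i k x - E i) / 2 ^ i)\<^sup>2) \<longlonglongrightarrow> 0"
  proof (rule AE_tendsto_0_of_summable_integrals[OF _ _ summ])
    fix i :: nat
    have int: "integrable M (\<lambda>x. (Y i k x - E i) * (Y i l x - E i))" for k l
    proof (rule integrable_const_bound[of _ "(2 ^ i + \<bar>E i\<bar>) * (2 ^ i + \<bar>E i\<bar>)"])
      have "\<bar>Y i k x - E i\<bar> \<le> 2 ^ i + \<bar>E i\<bar>" for k x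
        using Y[of i k x] by linarith
      then show "AE x in M. norm ((Y i k x - E i) * (Y i l x - E i)) \<le> (2 ^ i + \<bar>E i\<bar>) * (2 ^ i + \<bar>E i\<bar>)"
        by (intro AE_I2) (auto simp: abs_mult intro!: mult_mono)
    qed simp
    have orth: "(LINT x|M. (Y i k x - E i) * (Y i l x - E i)) = 0" if "k \<noteq> l" for k l
    proof -
      have "indep_var borel (\<lambda>x. Y i k x - E i) borel (\<lambda>x. Y i l x - E i)"
        using indep_var_functions_of_restrict[OF ind, of "{k}" "{l}" "\<lambda>h. min (h k) (2 ^ i) - E i" borel "\<lambda>h. min (h l) (2 ^ i) - E i" borel] that
        by (simp add: Y_def)
      then show ?thesis
        by (subst indep_var_lebesgue_integral) (auto simp: intY EY prob_space)
    qed
    note sq = integral_square_sum_orthogonal[of "{..<2 ^ i}" M "\<lambda>k x. Y i k x - E i", OF _ int orth]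
    show "integrable M (\<lambda>x. ((\<Sum>k<2 ^ i. Y i k x - E i) / 2 ^ i)\<^sup>2)"
      unfolding power_divide using sq by auto
    have var: "(LINT x|M. (Y i k x - E i)\<^sup>2) \<le> K * q ^ i * 2 ^ i" for k
    proof -
      have "(LINT x|M. (Y i k x - E i)\<^sup>2) \<le> (LINT x|M. (Y i k x)\<^sup>2)"
        using variance_eq[OF intY intYY, of i k] by (simp add: EY)
      also have "\<dots> \<le> (LINT x|M. X k x powr (1 + \<epsilon>) * (2 ^ i) powr (1 - \<epsilon>))"
        using truncation_bounds(1)[OF nonneg _ \<epsilon>, of "2 ^ i"] intYY intK
        by (intro integral_mono) (auto simp: Y_def)
      also have "\<dots> = K * q ^ i * 2 ^ i"
        using powr_add[of "2 ^ i" 1 "- \<epsilon>"] by (simp add: EK q_pow)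
      finally show ?thesis .
    qed
    have "(LINT x|M. ((\<Sum>k<2 ^ i. Y i k x - E i) / 2 ^ i)\<^sup>2)
        = (\<Sum>k<2 ^ i. (LINT x|M. (Y i k x - E i)\<^sup>2)) / (2 ^ i)\<^sup>2"
      unfolding power_divide using sq by simp
    also have "\<dots> \<le> (\<Sum>k<(2::nat) ^ i. K * q ^ i * 2 ^ i) / (2 ^ i)\<^sup>2"
      by (intro divide_right_mono sum_mono var) auto
    also have "\<dots> = K * q ^ i"
      by (simp add: power2_eq_square)
    finally show "(LINT x|M. ((\<Sum>k<2 ^ i. Y i k x - E i) / 2 ^ i)\<^sup>2) \<le> K * q ^ i" .
  qed simp
  moreover have "AE x in M. \<forall>c::nat. (\<lambda>n. (\<Sum>i<n. min (X i x) (real c)) / real n) \<longlonglongrightarrow> (LINT y|N. min y (real c))"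
    unfolding AE_all_countable
  proof
    fix c :: nat
    show "AE x in M. (\<lambda>n. (\<Sum>i<n. min (X i x) (real c)) / real n) \<longlonglongrightarrow> (LINT y|N. min y (real c))"
    proof (rule AE_averages_iid_bounded[OF prob_space_axioms, where C="real c"])
      show "indep_vars (\<lambda>_. borel) (\<lambda>i x. min (X i x) (real c)) UNIV"
        by (rule indep_vars_compose2[OF ind]) auto
      show "(LINT x|M. min (X i x) (real c)) = (LINT y|N. min y (real c))" for i
        using tr[of "\<lambda>y. min y (real c)"] by simp
    qed (use nonneg in \<open>auto simp: abs_le_iff le_minus_iff\<close>)
  qed
  ultimately show ?thesis
  proof eventually_elim
    case (elim x)
    have ED: "m - E i = (LINT x|M. X 0 x - Y i 0 x)" for i
      using intX intY by (simp add: EX EY)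
    have "(\<lambda>i. m - E i) \<longlonglongrightarrow> 0"
    proof (rule tendsto_sandwich[OF _ _ tendsto_const Eq0])
      show "\<forall>\<^sub>F i in sequentially. 0 \<le> m - E i"
        unfolding ED by (intro always_eventually allI Bochner_Integration.integral_nonneg) (auto simp: Y_def)
      show "\<forall>\<^sub>F i in sequentially. m - E i \<le> K * q ^ i"
        unfolding ED by (intro always_eventually allI gap)
    qed
    then have E: "E \<longlonglongrightarrow> m"
      using tendsto_diff[OF tendsto_const[of m], of "\<lambda>i. m - E i" 0] by simp
    have "(\<lambda>i. \<bar>(\<Sum>k<2 ^ i. Y i k x - E i) / 2 ^ i\<bar>) \<longlonglongrightarrow> 0"
      using tendsto_real_sqrt[OF elim(2)] by (simp only: real_sqrt_abs real_sqrt_zero)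
    then have "(\<lambda>i. (\<Sum>k<2 ^ i. Y i k x - E i) / 2 ^ i) \<longlonglongrightarrow> 0"
      by (simp only: tendsto_rabs_zero_iff)
    from tendsto_add[OF tendsto_add[OF elim(1) this] E]
    have dyadic: "(\<lambda>i. (\<Sum>k<2 ^ i. X k x) / 2 ^ i) \<longlonglongrightarrow> m"
      by (simp add: sum_subtractf diff_divide_distrib)
    show ?case
    proof (rule averages_tendsto_of_dyadic[OF dyadic elim(3)[rule_format]])
      show "(\<lambda>c::nat. (LINT y|N. min y (real c))) \<longlonglongrightarrow> m"
        unfolding mean(2)[symmetric]
      proof (rule integral_dominated_convergence[OF _ _ mean(1)])
        show "AE y in N. (\<lambda>c. min y (real c)) \<longlonglongrightarrow> y"
        proof (rule AE_I2)
          fix y :: real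
          show "(\<lambda>c. min y (real c)) \<longlonglongrightarrow> y"
            by (rule tendsto_eventually, rule eventually_mono[OF eventually_ge_at_top[of "nat \<lceil>y\<rceil>"]]) linarith
        qed
        show "AE y in N. norm (min y (real c)) \<le> y" for c
          using AE_N by eventually_elim auto
      qed simp_all
    qed
  qed
qed

section \<open>From Laplace transforms to autocorrelations\<close>

text \<open>There are quadratically many pairs and \<open>\<eta>\<close> need not be finite, so a
  uniform approximation of \<open>\<psi>\<close> would not do: the error must be a small multiple of
  exp (- t). Therefore Weierstrass is applied to \<psi> (t) / exp (- t) as a function of u = exp (-
  t), and the exponents of the resulting sum \<open>P\<close> start at 1.\<close>

lemma pair_averages_tendsto_of_laplace:
  fixes y :: "nat \<Rightarrow> real" and \<eta> :: "real measure"
  assumes y: "mono y"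
    and sets: "sets \<eta> = sets borel" and AE_nonneg: "AE t in \<eta>. 0 \<le> t"
    and int: "\<And>s::nat. 1 \<le> s \<Longrightarrow> integrable \<eta> (\<lambda>t. exp (- real s * t))"
    and lap: "\<And>s::nat. 1 \<le> s \<Longrightarrow>
      (\<lambda>n. (\<Sum>j<n. \<Sum>i<j. exp (- real s * (y j - y i))) / real n) \<longlonglongrightarrow> (LINT t|\<eta>. exp (- real s * t))"
    and \<psi>: "continuous_on UNIV \<psi>" "\<And>t. K < t \<Longrightarrow> \<psi> t = 0"
  shows "(\<lambda>n. (\<Sum>j<n. \<Sum>i<j. \<psi> (y j - y i)) / real n) \<longlonglongrightarrow> (LINT t|\<eta>. \<psi> t)"
proof (rule tendstoI)
  fix \<delta> :: real assume "0 < \<delta>"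
  note [measurable_cong] = sets
  define T where "T f n = (\<Sum>j<n. \<Sum>i<j. f (y j - y i)) / real n" for f :: "real \<Rightarrow> real" and n
  define m where "m = (LINT t|\<eta>. exp (- t))"
  have int1: "integrable \<eta> (\<lambda>t. exp (- t))"
    using int[of 1] by simp
  have m0: "0 \<le> m"
    unfolding m_def by simp
  \<comment> \<open>The averages of exp (- t) converge to \<open>m\<close>, so they are eventually
    below m + 1; each use of the approximation then costs at most \<delta> / 4.\<close>
  define \<epsilon> where "\<epsilon> = \<delta> / (4 * (m + 1))"
  have \<epsilon>: "0 < \<epsilon>"
    using \<open>0 < \<delta>\<close> m0 by (simp add: \<epsilon>_def)
  define k where "k = max 0 K + 1"
  \<comment> \<open>The cut-off at exp (- k) removes the singularity at u = 0. Since k > K, both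
    \<psi> k and the values of \<psi> beyond k are 0, so on the cut-off range g is 0, in agreement
    with \<psi>.\<close>
  define g where "g u = \<psi> (- ln (max u (exp (- k)))) / max u (exp (- k))" for u
  have "max u (exp (- k)) \<noteq> 0" for u
    using exp_gt_zero[of "- k"] by linarith
  then have "continuous_on {0..1} g"
    unfolding g_def by (intro continuous_intros continuous_on_compose2[OF \<psi>(1)]) auto
  then obtain p where p: "real_polynomial_function p" "\<And>u. u \<in> {0..1} \<Longrightarrow> \<bar>g u - p u\<bar> < \<epsilon>"
    using Stone_Weierstrass_real_polynomial_function[of "{0..1::real}" g \<epsilon>] \<epsilon> by auto
  then obtain a d where p_eq: "p = (\<lambda>u. \<Sum>i\<le>d. a i * u ^ i)"
    by (auto simp: real_polynomial_function_iff_sum)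
  define P where "P t = (\<Sum>i\<le>d. a i * exp (- real (Suc i) * t))" for t
  have approx: "\<bar>\<psi> t - P t\<bar> \<le> \<epsilon> * exp (- t)" if "0 \<le> t" for t
  proof -
    have "\<psi> t = exp (- t) * g (exp (- t))"
    proof (cases "t \<le> k")
      case True
      then have "max (exp (- t)) (exp (- k)) = exp (- t)" by (simp add: max_def)
      then show ?thesis by (simp add: g_def)
    next
      case False
      then have "max (exp (- t)) (exp (- k)) = exp (- k)" by (simp add: max_def)
      moreover have "\<psi> t = 0" "\<psi> k = 0"
        using False by (auto simp: k_def intro!: \<psi>(2))
      ultimately show ?thesis by (simp add: g_def)
    qed
    moreover have "P t = exp (- t) * p (exp (- t))"
      by (simp add: P_def p_eq sum_distrib_left exp_of_nat_mult[symmetric] mult_exp_exp algebra_simps)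
    ultimately have "\<bar>\<psi> t - P t\<bar> = exp (- t) * \<bar>g (exp (- t)) - p (exp (- t))\<bar>"
      by (simp add: right_diff_distrib[symmetric] abs_mult)
    also have "\<dots> \<le> exp (- t) * \<epsilon>"
      using p(2)[of "exp (- t)"] that by (intro mult_left_mono less_imp_le) auto
    finally show ?thesis by (simp add: mult.commute)
  qed
  have \<psi>_meas [measurable]: "\<psi> \<in> borel_measurable borel"
    using \<psi>(1) by (rule borel_measurable_continuous_onI)
  have intP: "integrable \<eta> P" and LP: "(LINT t|\<eta>. P t) = (\<Sum>i\<le>d. a i * (LINT t|\<eta>. exp (- real (Suc i) * t)))"
    unfolding P_def using int by (auto intro!: Bochner_Integration.integrable_sum simp: Bochner_Integration.integral_sum simp del: of_nat_Suc)
  have intd: "integrable \<eta> (\<lambda>t. \<psi> t - P t)"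
  proof (rule Bochner_Integration.integrable_bound)
    show "integrable \<eta> (\<lambda>t. \<epsilon> * exp (- t))" using int1 by simp
    show "AE t in \<eta>. norm (\<psi> t - P t) \<le> norm (\<epsilon> * exp (- t))"
      using AE_nonneg by eventually_elim (use approx \<epsilon> in \<open>auto simp: abs_mult\<close>)
  qed (use intP in measurable)
  have L: "\<bar>(LINT t|\<eta>. \<psi> t) - (LINT t|\<eta>. P t)\<bar> \<le> \<epsilon> * m"
  proof -
    have int\<psi>: "integrable \<eta> \<psi>"
      using Bochner_Integration.integrable_add[OF intd intP] by simp
    have "\<bar>(LINT t|\<eta>. \<psi> t) - (LINT t|\<eta>. P t)\<bar> = \<bar>LINT t|\<eta>. \<psi> t - P t\<bar>"
      using int\<psi> intP by simp
    also have "\<dots> \<le> (LINT t|\<eta>. \<bar>\<psi> t - P t\<bar>)"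
      by (rule integral_abs_bound)
    also have "\<dots> \<le> (LINT t|\<eta>. \<epsilon> * exp (- t))"
      using AE_nonneg intd int1 approx by (intro integral_mono_AE) (auto elim!: eventually_mono)
    finally show ?thesis by (simp add: m_def)
  qed
  have TP: "T P \<longlonglongrightarrow> (LINT t|\<eta>. P t)"
  proof -
    have "T P n = (\<Sum>i\<le>d. a i * T (\<lambda>t. exp (- real (Suc i) * t)) n)" for n
    proof -
      have "(\<Sum>j<n. \<Sum>i<j. P (y j - y i)) = (\<Sum>l\<le>d. a l * (\<Sum>j<n. \<Sum>i<j. exp (- real (Suc l) * (y j - y i))))"
        unfolding P_def sum_distrib_left
        by (subst (2) sum.swap, subst sum.swap) (intro sum.cong refl sum.swap)
      then show ?thesis
        unfolding T_def by (simp only: sum_divide_distrib[of _ "{..d}"] times_divide_eq_right)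
    qed
    moreover have "(\<lambda>n. \<Sum>i\<le>d. a i * T (\<lambda>t. exp (- real (Suc i) * t)) n) \<longlonglongrightarrow> (LINT t|\<eta>. P t)"
      unfolding LP T_def by (intro tendsto_sum tendsto_mult tendsto_const lap) simp
    ultimately show ?thesis by presburger
  qed
  have Tdiff: "\<bar>T \<psi> n - T P n\<bar> \<le> \<epsilon> * T (\<lambda>t. exp (- t)) n" for n
  proof -
    have "\<bar>T \<psi> n - T P n\<bar> = \<bar>\<Sum>j<n. \<Sum>i<j. \<psi> (y j - y i) - P (y j - y i)\<bar> / real n"
      by (simp only: T_def sum_subtractf diff_divide_distrib[symmetric] abs_divide abs_of_nat)
    also have "\<dots> \<le> (\<Sum>j<n. \<Sum>i<j. \<epsilon> * exp (- (y j - y i))) / real n"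
    proof (intro divide_right_mono order_trans[OF sum_abs] sum_mono)
      fix j i :: nat assume "i \<in> {..<j}"
      then show "\<bar>\<psi> (y j - y i) - P (y j - y i)\<bar> \<le> \<epsilon> * exp (- (y j - y i))"
        using monoD[OF y, of i j] by (intro approx) simp
    qed simp
    finally show ?thesis
      by (simp add: T_def sum_distrib_left)
  qed
  have "T (\<lambda>t. exp (- t)) \<longlonglongrightarrow> m"
    using lap[of 1] unfolding T_def[abs_def] m_def by simp
  then have "\<forall>\<^sub>F n in sequentially. T (\<lambda>t. exp (- t)) n < m + 1"
    by (rule order_tendstoD(2)) simp
  moreover have "\<forall>\<^sub>F n in sequentially. \<bar>T P n - (LINT t|\<eta>. P t)\<bar> < \<delta> / 4"
    using tendstoD[OF TP, of "\<delta> / 4"] \<open>0 < \<delta>\<close> by (simp add: dist_real_def)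
  ultimately have "\<forall>\<^sub>F n in sequentially. dist (T \<psi> n) (LINT t|\<eta>. \<psi> t) < \<delta>"
  proof eventually_elim
    case (elim n)
    have "\<epsilon> * T (\<lambda>t. exp (- t)) n \<le> \<epsilon> * (m + 1)"
      using elim(1) \<epsilon> by (intro mult_left_mono) auto
    moreover have "\<epsilon> * m \<le> \<epsilon> * (m + 1)"
      using \<epsilon> by simp
    moreover have "\<epsilon> * (m + 1) = \<delta> / 4"
      using m0 by (simp add: \<epsilon>_def field_simps)
    ultimately show ?case
      using Tdiff[of n] L elim(2) \<open>0 < \<delta>\<close> unfolding dist_real_def by linarith
  qed
  then show "\<forall>\<^sub>F n in sequentially. dist ((\<Sum>j<n. \<Sum>i<j. \<psi> (y j - y i)) / real n) (LINT t|\<eta>. \<psi> t) < \<delta>"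
    by (simp add: T_def)
qed

text \<open>The counting function N inverts the increasing sequence: y (N - 1) < R \<le> y N.
  Dividing by N squeezes R / N between quantities that tend to 1. This turns averages over the first
  n points into averages over windows.\<close>

lemma
  fixes y :: "nat \<Rightarrow> real"
  assumes y: "strict_mono y" and lim: "(\<lambda>n. y n / real n) \<longlonglongrightarrow> 1"
  shows less_set_eq_lessThan_card: "{j. y j < R} = {..<card {j. y j < R}}"
    and filterlim_card_less: "filterlim (\<lambda>R. card {j. y j < R}) at_top at_top"
    and card_less_over_tendsto: "((\<lambda>R. real (card {j. y j < R}) / R) \<longlongrightarrow> 1) at_top"
proof -
  define N where "N R = card {j. y j < R}" for R
  have y_top: "filterlim y at_top sequentially"
  proof -
    have "filterlim (\<lambda>n. (y n / real n) * real n) at_top sequentially"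
      by (rule filterlim_tendsto_pos_mult_at_top[OF lim _ filterlim_real_sequentially]) simp
    moreover have "\<forall>\<^sub>F n in sequentially. (y n / real n) * real n = y n"
      using eventually_gt_at_top[of "0::nat"] by eventually_elim simp
    ultimately show ?thesis
      by (rule filterlim_cong[OF refl refl, THEN iffD1, rotated])
  qed
  have set_eq: "{j. y j < R} = {..<N R}" for R
  proof -
    obtain n where "R \<le> y n"
      using y_top unfolding filterlim_at_top eventually_sequentially by blast
    then have ex: "\<exists>n. R \<le> y n" ..
    define n where "n = (LEAST n. R \<le> y n)"
    have "{j. y j < R} = {..<n}"
    proof (intro set_eqI iffI; simp)
      fix j assume "y j < R"
      then show "j < n"
        using LeastI_ex[OF ex] strict_mono_less_eq[OF y, of n j] unfolding n_def[symmetric] by linarith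
    next
      fix j assume "j < n"
      then show "y j < R"
        unfolding n_def using not_less_Least by (metis not_le)
    qed
    then show ?thesis
      by (simp add: N_def)
  qed
  then show "{j. y j < R} = {..<card {j. y j < R}}"
    by (simp add: N_def)
  have le_iff: "j < N R \<longleftrightarrow> y j < R" for j R
    using set_eq[of R] by auto
  have N_top: "filterlim N at_top at_top"
    unfolding filterlim_at_top
  proof
    fix Z
    show "\<forall>\<^sub>F R in at_top. Z \<le> N R"
      using eventually_gt_at_top[of "y Z"] by eventually_elim (simp add: le_iff less_imp_le)
  qed
  then show "filterlim (\<lambda>R. card {j. y j < R}) at_top at_top"
    unfolding N_def[abs_def] .
  have upper: "((\<lambda>R. y (N R) / real (N R)) \<longlongrightarrow> 1) at_top"
    by (rule filterlim_compose[OF lim N_top])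
  have "\<forall>\<^sub>F n in sequentially. y n / real n * (real n / real (Suc n)) = y n / real (Suc n)"
    using eventually_gt_at_top[of "0::nat"] by eventually_elim simp
  from Lim_transform_eventually[OF tendsto_mult[OF lim LIMSEQ_n_over_Suc_n] this]
  have "(\<lambda>n. y n / real (Suc n)) \<longlonglongrightarrow> 1"
    by simp
  then have "(\<lambda>n. y (n - 1) / real n) \<longlonglongrightarrow> 1"
    by (subst filterlim_sequentially_Suc[symmetric]) simp
  then have lower: "((\<lambda>R. y (N R - 1) / real (N R)) \<longlongrightarrow> 1) at_top"
    by (rule filterlim_compose[OF _ N_top])
  have pos: "\<forall>\<^sub>F R in at_top. 0 < N R"
    using N_top[unfolded filterlim_at_top, rule_format, of 1] by eventually_elim simp
  have "((\<lambda>R. R / real (N R)) \<longlongrightarrow> 1) at_top"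
  proof (rule tendsto_sandwich[OF _ _ lower upper])
    show "\<forall>\<^sub>F R in at_top. y (N R - 1) / real (N R) \<le> R / real (N R)"
      using pos
    proof eventually_elim
      case (elim R)
      then have "y (N R - 1) < R" by (simp add: le_iff[symmetric])
      then show ?case by (simp add: divide_right_mono)
    qed
    show "\<forall>\<^sub>F R in at_top. R / real (N R) \<le> y (N R) / real (N R)"
    proof (intro always_eventually allI divide_right_mono)
      show "R \<le> y (N R)" for R
        using le_iff[of "N R" R] by (simp add: not_less)
    qed simp
  qed
  then have "((\<lambda>R. inverse (R / real (N R))) \<longlongrightarrow> inverse 1) at_top"
    by (rule tendsto_inverse) simp
  then show "((\<lambda>R. real (card {j. y j < R}) / R) \<longlongrightarrow> 1) at_top"
    by (simp add: N_def)
qed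

lemma sum_square_split:
  fixes f :: "nat \<Rightarrow> nat \<Rightarrow> 'a::comm_monoid_add"
  shows "(\<Sum>(i, j)\<in>{..<n} \<times> {..<n}. f i j) = (\<Sum>j<n. f j j) + (\<Sum>j<n. \<Sum>i<j. f j i + f i j)"
  unfolding sum.cartesian_product[symmetric]
  by (induction n) (simp_all add: sum.distrib algebra_simps)


text \<open>The points are cut between x 0 and x 1. Pairs on the same side see only the gaps of one
  half-line, and each side contributes density 1 out of the window length 2 R, so both halves enter
  with weight 1/2. Pairs on different sides contribute a bounded amount.\<close>

lemma autocorrelation_two_sided:
  fixes x :: "int \<Rightarrow> real" and \<phi> :: "real \<Rightarrow> real"
  assumes x: "strict_mono x"
    and y_def: "\<And>j. y j = x (int j + 1)" and z_def: "\<And>j. z j = - x (- int j)"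
    and y: "(\<lambda>n. y n / real n) \<longlonglongrightarrow> 1" and z: "(\<lambda>n. z n / real n) \<longlonglongrightarrow> 1"
    and ylim: "(\<lambda>n. (\<Sum>j<n. \<Sum>i<j. \<phi> (y j - y i) + \<phi> (y i - y j)) / real n) \<longlonglongrightarrow> L"
    and zlim: "(\<lambda>n. (\<Sum>j<n. \<Sum>i<j. \<phi> (z j - z i) + \<phi> (z i - z j)) / real n) \<longlonglongrightarrow> L"
    and K: "\<And>t. K < \<bar>t\<bar> \<Longrightarrow> \<phi> t = 0"
  shows "finite (range x \<inter> {-R<..<R})"
    and "((\<lambda>R. (\<Sum>(s, t) \<in> (range x \<inter> {-R<..<R}) \<times> (range x \<inter> {-R<..<R}). \<phi> (s - t)) / (2 * R))
           \<longlongrightarrow> \<phi> 0 + L) at_top"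
proof -
  have y_mono: "strict_mono y"
    unfolding y_def by (intro strict_monoI strict_monoD[OF x]) simp
  have z_mono: "strict_mono z"
    unfolding z_def by (intro strict_monoI) (simp add: strict_monoD[OF x])
  define n where "n R = card {j. y j < R}" for R
  define n' where "n' R = card {j. z j < R}" for R
  have n_set: "{j. y j < R} = {..<n R}" and n'_set: "{j. z j < R} = {..<n' R}" for R
    unfolding n_def n'_def using less_set_eq_lessThan_card[OF y_mono y] less_set_eq_lessThan_card[OF z_mono z] by blast+
  have finy: "finite {j. y j < R}" and finz: "finite {j. z j < R}" for R
    unfolding n_set n'_set by auto
  define p where "p j = int j + 1" for j
  define q where "q j = - int j" for j
  have p_inj: "inj_on p A" and q_inj: "inj_on q A" for A
    by (auto simp: inj_on_def p_def q_def)
  have pq: "i \<in> range p \<union> range q" for i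
  proof (cases "i \<ge> 1")
    case True
    then have "i = p (nat (i - 1))" by (simp add: p_def)
    then show ?thesis by blast
  next
    case False
    then have "i = q (nat (- i))" by (simp add: q_def)
    then show ?thesis by blast
  qed
  have yx: "y j = x (p j)" and zx: "z j = - x (q j)" for j
    by (simp_all add: y_def z_def p_def q_def)
  have window_sub: "{i. \<bar>x i\<bar> < R} \<subseteq> p ` {..<n R} \<union> q ` {..<n' R}" for R
  proof
    fix i assume "i \<in> {i. \<bar>x i\<bar> < R}"
    then have "\<bar>x i\<bar> < R" by simp
    moreover from pq[of i] obtain j where "i = p j \<or> i = q j" by blast
    ultimately have "(i = p j \<and> y j < R) \<or> (i = q j \<and> z j < R)"
      by (auto simp: yx zx)
    then have "(i = p j \<and> j < n R) \<or> (i = q j \<and> j < n' R)"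
      using n_set[of R] n'_set[of R] by blast
    then show "i \<in> p ` {..<n R} \<union> q ` {..<n' R}" by auto
  qed
  have range_eq: "range x \<inter> {-R<..<R} = x ` {i. \<bar>x i\<bar> < R}" for R
    by (auto simp: abs_less_iff)
  show "finite (range x \<inter> {-R<..<R})"
    unfolding range_eq by (intro finite_imageI finite_subset[OF window_sub]) auto
  \<comment> \<open>y i + z j = x (i + 1) - x (- j) is the distance across the cut. Both summands
    are bounded below by their values at index 0, so distances up to K force both indices into
    finite sets.\<close>
  define S where "S = {(i, j). y i + z j \<le> K}"
  have "S \<subseteq> {i. y i < K - z 0 + 1} \<times> {j. z j < K - y 0 + 1}"
  proof
    fix u assume "u \<in> S"
    then obtain i j where u: "u = (i, j)" "y i + z j \<le> K" by (auto simp: S_def)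
    have "y 0 \<le> y i" "z 0 \<le> z j"
      using y_mono z_mono by (auto simp: strict_mono_less_eq)
    with u show "u \<in> {i. y i < K - z 0 + 1} \<times> {j. z j < K - y 0 + 1}" by auto
  qed
  then have "finite S"
    using finy finz finite_cartesian_product finite_subset by blast
  define C where "C = (\<Sum>(i, j)\<in>S. \<bar>\<phi> (y i + z j)\<bar> + \<bar>\<phi> (- y i - z j)\<bar>)"
  define cross where "cross R = (\<Sum>(i, j)\<in>{..<n R} \<times> {..<n' R}. \<phi> (y i + z j) + \<phi> (- y i - z j))" for R
  have cross: "\<bar>cross R\<bar> \<le> C" for R
  proof -
    have "\<bar>cross R\<bar> \<le> (\<Sum>(i, j)\<in>{..<n R} \<times> {..<n' R}. \<bar>\<phi> (y i + z j)\<bar> + \<bar>\<phi> (- y i - z j)\<bar>)"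
      unfolding cross_def by (rule order_trans[OF sum_abs sum_mono]) (auto simp: split_beta)
    also have "\<dots> = (\<Sum>(i, j)\<in>({..<n R} \<times> {..<n' R}) \<inter> S. \<bar>\<phi> (y i + z j)\<bar> + \<bar>\<phi> (- y i - z j)\<bar>)"
    proof (rule sum.mono_neutral_right)
      show "\<forall>u\<in>{..<n R} \<times> {..<n' R} - {..<n R} \<times> {..<n' R} \<inter> S.
          (case u of (i, j) \<Rightarrow> \<bar>\<phi> (y i + z j)\<bar> + \<bar>\<phi> (- y i - z j)\<bar>) = 0"
      proof (clarsimp simp: S_def not_le)
        fix i j assume "K < y i + z j"
        then show "\<bar>\<phi> (y i + z j)\<bar> + \<bar>\<phi> (- y i - z j)\<bar> = 0"
          using K[of "y i + z j"] K[of "- y i - z j"] by simp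
      qed
    qed auto
    also have "\<dots> \<le> C"
      unfolding C_def using \<open>finite S\<close> by (intro sum_mono2) auto
    finally show ?thesis .
  qed
  define A where "A n = (\<Sum>j<n. \<Sum>i<j. \<phi> (y j - y i) + \<phi> (y i - y j))" for n
  define B where "B n = (\<Sum>j<n. \<Sum>i<j. \<phi> (z j - z i) + \<phi> (z i - z j))" for n
  define total where "total R = (\<Sum>(s, t) \<in> (range x \<inter> {-R<..<R}) \<times> (range x \<inter> {-R<..<R}). \<phi> (s - t))" for R
  \<comment> \<open>For such R no point of the right half is below - R and none of the left half
    above R, so membership in the window is one inequality per side and the index ranges are initial
    segments.\<close>
  have total: "total R = real (n R) * \<phi> 0 + A (n R) + real (n' R) * \<phi> 0 + B (n' R) + cross R"
    if R: "R > \<bar>x 0\<bar> + \<bar>x 1\<bar>" for R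
  proof -
    have "- R < y j" "- R < z j" for j
      using R strict_mono_less_eq[OF y_mono, of 0 j] strict_mono_less_eq[OF z_mono, of 0 j]
      by (auto simp: y_def z_def)
    then have "p ` {..<n R} \<union> q ` {..<n' R} \<subseteq> {i. \<bar>x i\<bar> < R}"
      unfolding n_set[symmetric] n'_set[symmetric] by (auto simp: yx zx abs_less_iff minus_less_iff)
    then have win: "{i. \<bar>x i\<bar> < R} = p ` {..<n R} \<union> q ` {..<n' R}"
      using window_sub by blast
    let ?P = "p ` {..<n R}" and ?Q = "q ` {..<n' R}"
    let ?f = "\<lambda>(i, j). \<phi> (x i - x j)"
    have inj: "inj_on (map_prod x x) A" for A
      by (auto simp: inj_on_def strict_mono_eq[OF x])
    have "total R = (\<Sum>(s, t) \<in> map_prod x x ` ((?P \<union> ?Q) \<times> (?P \<union> ?Q)). \<phi> (s - t))"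
      unfolding total_def range_eq win by (intro sum.cong) (auto simp: map_prod_surj_on)
    also have "\<dots> = sum ?f ((?P \<union> ?Q) \<times> (?P \<union> ?Q))"
      by (subst sum.reindex[OF inj]) (auto intro!: sum.cong)
    also have "(?P \<union> ?Q) \<times> (?P \<union> ?Q) = (?P \<times> ?P \<union> ?Q \<times> ?Q) \<union> (?P \<times> ?Q \<union> ?Q \<times> ?P)"
      by auto
    also have "sum ?f \<dots> = (sum ?f (?P \<times> ?P) + sum ?f (?Q \<times> ?Q)) + (sum ?f (?P \<times> ?Q) + sum ?f (?Q \<times> ?P))"
    proof -
      have "?P \<inter> ?Q = {}" by (auto simp: p_def q_def)
      then show ?thesis
        by (subst sum.union_disjoint; (subst sum.union_disjoint)?; (subst sum.union_disjoint)?) auto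
    qed
    also have "sum ?f (?P \<times> ?P) = (\<Sum>(i, j)\<in>{..<n R} \<times> {..<n R}. \<phi> (y i - y j))"
      by (simp add: sum.cartesian_product[symmetric] sum.reindex p_inj yx)
    also have "\<dots> = real (n R) * \<phi> 0 + A (n R)"
      unfolding sum_square_split A_def by simp
    also have "sum ?f (?Q \<times> ?Q) = (\<Sum>(i, j)\<in>{..<n' R} \<times> {..<n' R}. \<phi> (z j - z i))"
      by (simp add: sum.cartesian_product[symmetric] sum.reindex q_inj zx add.commute)
    also have "\<dots> = real (n' R) * \<phi> 0 + B (n' R)"
      unfolding sum_square_split B_def by (simp add: add.commute)
    also have "sum ?f (?P \<times> ?Q) + sum ?f (?Q \<times> ?P) = cross R"
    proof -
      have "sum ?f (?P \<times> ?Q) = (\<Sum>i<n R. \<Sum>j<n' R. \<phi> (y i + z j))"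
        by (simp add: sum.cartesian_product[symmetric] sum.reindex p_inj q_inj yx zx)
      moreover have "sum ?f (?Q \<times> ?P) = (\<Sum>i<n R. \<Sum>j<n' R. \<phi> (- y i - z j))"
        by (subst sum.swap) (simp add: sum.cartesian_product[symmetric] sum.reindex p_inj q_inj yx zx add.commute)
      ultimately show ?thesis
        by (simp add: cross_def sum.cartesian_product[symmetric] sum.distrib)
    qed
    finally show ?thesis by simp
  qed
  have n: "((\<lambda>R. real (n R) / R) \<longlongrightarrow> 1) at_top" "filterlim n at_top at_top"
    unfolding n_def[abs_def] by (rule card_less_over_tendsto[OF y_mono y] filterlim_card_less[OF y_mono y])+
  have n': "((\<lambda>R. real (n' R) / R) \<longlongrightarrow> 1) at_top" "filterlim n' at_top at_top"
    unfolding n'_def[abs_def] by (rule card_less_over_tendsto[OF z_mono z] filterlim_card_less[OF z_mono z])+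
  have A: "((\<lambda>R. A (n R) / real (n R)) \<longlongrightarrow> L) at_top"
    unfolding A_def by (rule filterlim_compose[OF ylim n(2)])
  have B: "((\<lambda>R. B (n' R) / real (n' R)) \<longlongrightarrow> L) at_top"
    unfolding B_def by (rule filterlim_compose[OF zlim n'(2)])
  have c: "((\<lambda>R. cross R / (2 * R)) \<longlongrightarrow> 0) at_top"
  proof (rule Lim_null_comparison)
    show "((\<lambda>R::real. C / (2 * R)) \<longlongrightarrow> 0) at_top"
      by (intro real_tendsto_divide_at_top[OF tendsto_const] filterlim_tendsto_pos_mult_at_top[OF tendsto_const] filterlim_ident) simp
    show "\<forall>\<^sub>F R in at_top. norm (cross R / (2 * R)) \<le> C / (2 * R)"
      using eventually_gt_at_top[of "0::real"] by eventually_elim (simp add: cross divide_right_mono)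
  qed
  have "((\<lambda>R. (real (n R) / R) * ((\<phi> 0 + A (n R) / real (n R)) / 2) + (real (n' R) / R) * ((\<phi> 0 + B (n' R) / real (n' R)) / 2) + cross R / (2 * R))
      \<longlongrightarrow> 1 * ((\<phi> 0 + L) / 2) + 1 * ((\<phi> 0 + L) / 2) + 0) at_top"
    by (intro tendsto_add tendsto_mult n(1) n'(1) tendsto_divide tendsto_const A B c) simp_all
  moreover have "\<forall>\<^sub>F R in at_top. (real (n R) / R) * ((\<phi> 0 + A (n R) / real (n R)) / 2) + (real (n' R) / R) * ((\<phi> 0 + B (n' R) / real (n' R)) / 2) + cross R / (2 * R) = total R / (2 * R)"
    using eventually_gt_at_top[of "\<bar>x 0\<bar> + \<bar>x 1\<bar>"]
  proof eventually_elim
    case (elim R)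
    \<comment> \<open>If \<open>n R\<close> or \<open>n' R\<close> is 0, the quotient is 0 by
      convention; the product is still right because the sums are empty.\<close>
    have "A 0 = 0" "B 0 = 0" by (simp_all add: A_def B_def)
    then have "real (n R) * (A (n R) / real (n R)) = A (n R)" "real (n' R) * (B (n' R) / real (n' R)) = B (n' R)"
      by (cases "n R = 0"; cases "n' R = 0"; simp)+
    then have "total R = real (n R) * (\<phi> 0 + A (n R) / real (n R)) + real (n' R) * (\<phi> 0 + B (n' R) / real (n' R)) + cross R"
      using total[OF elim] by (simp add: distrib_left)
    then show ?case
      by (simp only: times_divide_times_eq add_divide_distrib[of _ _ "2 * R"] mult.commute[of R 2])
  qed
  ultimately show "((\<lambda>R. (\<Sum>(s, t) \<in> (range x \<inter> {-R<..<R}) \<times> (range x \<inter> {-R<..<R}). \<phi> (s - t)) / (2 * R))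
      \<longlongrightarrow> \<phi> 0 + L) at_top"
    unfolding total_def[symmetric] using Lim_transform_eventually by fastforce
qed

section \<open>The Fourier transform of the waiting time\<close>

lemma measurable_cis [measurable]: "cis \<in> borel_measurable borel"
  by (intro borel_measurable_continuous_onI continuous_intros)

locale waiting_law = prob_space \<mu> for \<mu> :: "real measure" +
  assumes sets_mu [measurable_cong, simp]: "sets \<mu> = sets borel"
    and pos: "AE x in \<mu>. 0 < x"
    and mean: "integrable \<mu> (\<lambda>x. x)" "(LINT x|\<mu>. x) = 1"
begin

abbreviation w :: "real \<Rightarrow> complex" where
  "w \<equiv> ft_measure \<mu>"

text \<open>The set of periods of \<open>w\<close>, a discrete subgroup of the reals which turns out
  to carry the atoms of the diffraction measure.\<close>

definition Z :: "real set" where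
  "Z = {k. w k = 1}"

lemma space_mu [simp]: "space \<mu> = UNIV"
  using sets_eq_imp_space_eq[OF sets_mu] by simp

lemma prob_UNIV [simp]: "prob UNIV = 1"
  using prob_space by simp

lemma w_eq_char: "w k = char \<mu> (- 2 * pi * k)"
  by (simp add: ft_measure_def char_def cis_conv_exp)

sublocale real_distribution \<mu>
  by unfold_locales simp_all

lemma norm_w_le: "cmod (w k) \<le> 1"
  unfolding w_eq_char by (rule cmod_char_le_1)

lemma isCont_w: "isCont w k"
proof -
  have "isCont (\<lambda>k. char \<mu> (- 2 * pi * k)) k"
    by (rule isCont_o2[OF _ isCont_char]) (intro continuous_intros)
  then show ?thesis
    unfolding w_eq_char[symmetric] .
qed

lemma measurable_w [measurable]: "w \<in> borel_measurable borel"
  using isCont_w by (intro borel_measurable_continuous_onI continuous_at_imp_continuous_on) auto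

lemma integrable_cis_mu [simp]: "f \<in> borel_measurable borel \<Longrightarrow> integrable \<mu> (\<lambda>x. cis (f x))"
  by (rule integrable_const_bound[of _ 1]) auto

lemma w_0 [simp]: "w 0 = 1"
  by (simp add: ft_measure_def prob_space)

lemma zero_in_Z: "0 \<in> Z"
  by (simp add: Z_def)

text \<open>An average of numbers on the unit circle equals 1 only if almost all of them are 1: the
  nonnegative function 1 - cos has integral 0. This turns one equation about an integral into a
  pointwise one, from which the group structure of \<open>Z\<close> and the periodicity of
  \<open>w\<close> follow.\<close>

lemma Z_iff_AE: "z \<in> Z \<longleftrightarrow> (AE x in \<mu>. cis (- 2 * pi * z * x) = 1)"
proof
  assume z: "z \<in> Z"
  have cos: "integrable \<mu> (\<lambda>x. cos (2 * pi * z * x))"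
    by (rule integrable_const_bound[of _ 1]) auto
  have "Re (w z) = (LINT x|\<mu>. cos (2 * pi * z * x))"
    unfolding ft_measure_def using integral_Re[OF integrable_cis_mu[of "\<lambda>x. - 2 * pi * z * x"]] by simp
  then have "(LINT x|\<mu>. 1 - cos (2 * pi * z * x)) = 0"
    using z cos by (simp add: Z_def prob_space)
  then have "AE x in \<mu>. 1 - cos (2 * pi * z * x) = 0"
    using cos by (subst (asm) integral_nonneg_eq_0_iff_AE) auto
  then show "AE x in \<mu>. cis (- 2 * pi * z * x) = 1"
  proof eventually_elim
    case (elim x)
    then have "cos (2 * pi * z * x) = 1" by simp
    moreover then have "sin (2 * pi * z * x) = 0"
      by (rule cos_one_sin_zero)
    ultimately show ?case by (simp add: complex_eq_iff)
  qed
next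
  assume "AE x in \<mu>. cis (- 2 * pi * z * x) = 1"
  then have "w z = (LINT x|\<mu>. 1)"
    unfolding ft_measure_def by (intro integral_cong_AE) auto
  then show "z \<in> Z" by (simp add: Z_def prob_space)
qed

lemma Z_shift:
  assumes "z \<in> Z" shows "w (z + u) = w u"
  unfolding ft_measure_def
proof (rule integral_cong_AE)
  show "AE x in \<mu>. cis (- 2 * pi * (z + u) * x) = cis (- 2 * pi * u * x)"
    using assms unfolding Z_iff_AE
  proof eventually_elim
    case (elim x)
    have "cis (- 2 * pi * (z + u) * x) = cis (- 2 * pi * z * x) * cis (- 2 * pi * u * x)"
      by (simp add: cis_mult algebra_simps)
    with elim show ?case by simp
  qed
qed simp_all

lemma Z_diff: "z \<in> Z \<Longrightarrow> z' \<in> Z \<Longrightarrow> z - z' \<in> Z"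
  using Z_shift[of z' "z - z'"] by (simp add: Z_def)

lemma Z_uminus: "z \<in> Z \<Longrightarrow> - z \<in> Z"
  using Z_diff[OF zero_in_Z] by simp

lemma cmod_cis_minus_1_le: "cmod (cis t - 1) \<le> \<bar>t\<bar>"
  using iexp_approx1[of t 0] by (simp add: cis_conv_exp)

text \<open>Dominated convergence with majorant 2 pi |x|, which the finite mean makes integrable.
  The value of the mean fixes the constant, and this constant later gives every atom weight
  one.\<close>

lemma w_diff_quotient: "((\<lambda>u. (1 - w u) / of_real u) \<longlongrightarrow> 2 * pi * \<i>) (at 0)"
  unfolding tendsto_at_iff_sequentially
proof (intro allI impI)
  fix u :: "nat \<Rightarrow> real" assume u: "\<forall>i. u i \<in> UNIV - {0}" and lim: "u \<longlonglongrightarrow> 0"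
  have "(1 - w (u i)) / of_real (u i) = (LINT x|\<mu>. (1 - cis (- 2 * pi * u i * x)) / of_real (u i))" for i
    unfolding ft_measure_def by (simp add: prob_space)
  moreover have "(\<lambda>i. (LINT x|\<mu>. (1 - cis (- 2 * pi * u i * x)) / of_real (u i))) \<longlonglongrightarrow> (LINT x|\<mu>. 2 * pi * \<i> * of_real x)"
  proof (rule integral_dominated_convergence)
    show "integrable \<mu> (\<lambda>x. 2 * pi * \<bar>x\<bar>)"
      using mean(1) by (intro integrable_mult_right integrable_abs)
    show "AE x in \<mu>. norm ((1 - cis (- 2 * pi * u i * x)) / of_real (u i)) \<le> 2 * pi * \<bar>x\<bar>" for i
    proof (rule AE_I2)
      fix x
      have "norm (1 - cis (- 2 * pi * u i * x)) \<le> 2 * pi * \<bar>u i\<bar> * \<bar>x\<bar>"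
        using cmod_cis_minus_1_le[of "- 2 * pi * u i * x"] by (simp add: norm_minus_commute abs_mult)
      then show "norm ((1 - cis (- 2 * pi * u i * x)) / of_real (u i)) \<le> 2 * pi * \<bar>x\<bar>"
        using u by (simp add: norm_divide divide_le_eq mult_ac)
    qed
    show "AE x in \<mu>. (\<lambda>i. (1 - cis (- 2 * pi * u i * x)) / of_real (u i)) \<longlonglongrightarrow> 2 * pi * \<i> * of_real x"
    proof (rule AE_I2)
      fix x
      have "((\<lambda>t. exp (\<i> * of_real (- 2 * pi * x) * t)) has_field_derivative (\<i> * of_real (- 2 * pi * x)) * exp (\<i> * of_real (- 2 * pi * x) * 0)) (at 0)"
        by (auto intro!: derivative_eq_intros)
      then have "(\<lambda>t. (exp (\<i> * of_real (- 2 * pi * x) * t) - 1) / t) \<midarrow>0\<rightarrow> \<i> * of_real (- 2 * pi * x)"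
        by (simp add: DERIV_def)
      moreover have "filterlim (\<lambda>i. of_real (u i) :: complex) (at 0) sequentially"
        using u lim tendsto_of_real[OF lim, where 'a=complex] by (auto simp: filterlim_at)
      ultimately have "(\<lambda>i. (exp (\<i> * of_real (- 2 * pi * x) * of_real (u i)) - 1) / of_real (u i)) \<longlonglongrightarrow> \<i> * of_real (- 2 * pi * x)"
        by (rule filterlim_compose)
      from tendsto_minus[OF this] show "(\<lambda>i. (1 - cis (- 2 * pi * u i * x)) / of_real (u i)) \<longlonglongrightarrow> 2 * pi * \<i> * of_real x"
        by (simp add: cis_conv_exp mult_ac minus_divide_left)
    qed
  qed simp_all
  moreover have "(LINT x|\<mu>. 2 * pi * \<i> * of_real x) = 2 * pi * \<i>"
    using mean by simp
  ultimately show "((\<lambda>u. (1 - w u) / of_real u) \<circ> u) \<longlonglongrightarrow> 2 * pi * \<i>"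
    by (simp only: comp_def)
qed

text \<open>The quotient |1 - w u| / |u| tends to 2 pi; 1 is a convenient constant below
  that.\<close>

lemma w_lower_bound: "\<exists>\<delta>>0. \<forall>u. \<bar>u\<bar> < \<delta> \<longrightarrow> \<bar>u\<bar> \<le> cmod (1 - w u)"
proof -
  have "((\<lambda>u. cmod ((1 - w u) / of_real u)) \<longlongrightarrow> 2 * pi) (at 0)"
    using tendsto_norm[OF w_diff_quotient] by (simp add: norm_mult)
  then have "\<forall>\<^sub>F u in at 0. 1 < cmod ((1 - w u) / of_real u)"
    by (rule order_tendstoD(1)) (use pi_gt3 in linarith)
  then obtain \<delta> where "\<delta> > 0" "\<And>u. u \<noteq> 0 \<Longrightarrow> \<bar>u\<bar> < \<delta> \<Longrightarrow> 1 < cmod ((1 - w u) / of_real u)"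
    by (auto simp: eventually_at dist_real_def)
  then have "\<bar>u\<bar> \<le> cmod (1 - w u)" if "\<bar>u\<bar> < \<delta>" for u
    using that by (cases "u = 0") (auto simp: norm_divide less_divide_eq less_imp_le)
  with \<open>\<delta> > 0\<close> show ?thesis by blast
qed

text \<open>One radius with two uses: it separates the points of \<open>Z\<close>, and within it |u|
  \<le> |1 - w u| dominates the rescaled peaks.\<close>

definition gap :: real where
  "gap = (SOME \<delta>. \<delta> > 0 \<and> (\<forall>u. \<bar>u\<bar> < \<delta> \<longrightarrow> \<bar>u\<bar> \<le> cmod (1 - w u)))"

lemma gap_pos: "0 < gap" and gap: "\<bar>u\<bar> < gap \<Longrightarrow> \<bar>u\<bar> \<le> cmod (1 - w u)"
  using someI_ex[OF w_lower_bound] unfolding gap_def[symmetric] by auto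

lemma Z_separated: "z \<in> Z \<Longrightarrow> z' \<in> Z \<Longrightarrow> \<bar>z - z'\<bar> < gap \<Longrightarrow> z = z'"
  using gap[of "z - z'"] Z_diff[of z z'] by (auto simp: Z_def)

lemma finite_Z_bounded:
  assumes "bounded A" shows "finite (Z \<inter> A)"
proof (rule ccontr)
  assume "infinite (Z \<inter> A)"
  moreover have "bounded (Z \<inter> A)"
    using assms by (rule bounded_subset) auto
  ultimately obtain l where l: "l islimpt (Z \<inter> A)"
    using bounded_infinite_imp_islimpt by blast
  obtain z where z: "z \<in> Z" "z \<noteq> l" "dist z l < gap / 2"
    using l gap_pos unfolding islimpt_approachable by (metis IntD1 half_gt_zero)
  obtain z' where z': "z' \<in> Z" "z' \<noteq> l" "dist z' l < dist z l"
    using l z unfolding islimpt_approachable by (metis IntD1 zero_less_dist_iff)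
  have "\<bar>z - z'\<bar> < gap"
    using z z' unfolding dist_real_def by linarith
  with Z_separated[OF z(1) z'(1)] z' show False by auto
qed

lemma countable_Z: "countable Z"
proof -
  have "Z = (\<Union>n::nat. Z \<inter> {-real n..real n})"
  proof (intro equalityI subsetI)
    fix z assume "z \<in> Z"
    moreover obtain n :: nat where "\<bar>z\<bar> \<le> real n" using real_arch_simple by blast
    ultimately have "z \<in> Z \<inter> {-real n..real n}" by auto
    then show "z \<in> (\<Union>n::nat. Z \<inter> {-real n..real n})" by blast
  qed auto
  moreover have "countable (\<Union>n::nat. Z \<inter> {-real n..real n})"
    by (intro countable_UN[OF countableI_type] countable_finite finite_Z_bounded bounded_closed_interval)
  ultimately show ?thesis by simp
qed

lemma measurable_Z [measurable]: "Z \<in> sets borel"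
  using countable_Z by (rule sets.countable[rotated]) auto

section \<open>The group \<open>Z\<close> and the lattices that contain the support\<close>

lemma AE_msupport: "AE x in \<mu>. x \<in> msupport \<mu>"
proof -
  define B where "B = {(q, r). q \<in> \<rat> \<and> r \<in> \<rat> \<and> emeasure \<mu> (ball q r) = 0}"
  have "countable B"
    by (rule countable_subset[of _ "\<rat> \<times> \<rat>"]) (auto simp: B_def intro: countable_rat)
  then have "AE x in \<mu>. \<forall>(q, r)\<in>B. x \<notin> ball q r"
    by (subst AE_ball_countable) (auto simp: B_def simp del: mem_ball intro!: AE_not_in null_setsI)
  then show ?thesis
  proof eventually_elim
    case (elim x)
    show ?case
    proof (rule ccontr)
      assume "x \<notin> msupport \<mu>"
      then obtain e where e: "e > 0" "emeasure \<mu> (ball x e) = 0"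
        by (auto simp: msupport_def not_less)
      obtain r where r: "r \<in> \<rat>" "0 < r" "r < e / 2"
        using Rats_dense_in_real[of 0 "e / 2"] e by auto
      obtain q where q: "q \<in> \<rat>" "x < q" "q < x + r"
        using Rats_dense_in_real[of x "x + r"] r by auto
      have sub: "ball q r \<subseteq> ball x e"
        using q r by (auto simp: dist_real_def)
      then have "emeasure \<mu> (ball q r) \<le> emeasure \<mu> (ball x e)"
        by (intro emeasure_mono) auto
      then have "(q, r) \<in> B"
        using e q r by (simp add: B_def)
      moreover have "x \<in> ball q r"
        using q by (auto simp: dist_real_def)
      ultimately show False using elim by auto
    qed
  qed
qed

lemma cis_eq_1_iff_int: "cis (- 2 * pi * t) = 1 \<longleftrightarrow> t \<in> \<int>"
proof -
  have "cis (- 2 * pi * t) = 1 \<longleftrightarrow> cos (2 * pi * t) = 1"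
    by (auto simp: complex_eq_iff intro: cos_one_sin_zero)
  also have "\<dots> \<longleftrightarrow> (\<exists>n::int. 2 * pi * t = n * (2 * pi))"
    by (rule cos_one_2pi_int[simplified mult.assoc]) 
  also have "\<dots> \<longleftrightarrow> t \<in> \<int>"
    by (auto simp: Ints_def)
  finally show ?thesis .
qed

text \<open>Almost every y satisfies z y \<in> \<int>, and the set of these y is closed. A support
  point outside it would have a ball of measure 0 around it.\<close>

lemma msupport_subset_lattice:
  assumes "z \<in> Z" "z \<noteq> 0"
  shows "msupport \<mu> \<subseteq> range (\<lambda>n::int. 1 / \<bar>z\<bar> * of_int n)"
proof
  fix x assume x: "x \<in> msupport \<mu>"
  have "z * x \<in> \<int>"
  proof (rule ccontr)
    assume "z * x \<notin> \<int>"
    moreover have "open {y. z * y \<notin> \<int>}"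
      unfolding Compl_eq[symmetric] Collect_neg_eq[symmetric]
      by (intro open_Collect_neg closed_vimage[of "\<int>" "(*) z", unfolded vimage_def] closed_Ints continuous_intros)
    ultimately obtain e where e: "e > 0" "ball x e \<subseteq> {y. z * y \<notin> \<int>}"
      unfolding open_contains_ball by blast
    have "AE y in \<mu>. z * y \<in> \<int>"
      using assms(1) cis_eq_1_iff_int[of "z * _"] unfolding Z_iff_AE by (simp add: mult.assoc)
    then have "AE y in \<mu>. y \<notin> ball x e"
      by eventually_elim (use e in auto)
    then have "emeasure \<mu> (ball x e) = 0"
      by (subst (asm) AE_iff_measurable[of "ball x e"]) auto
    with x e show False by (auto simp: msupport_def)
  qed
  then have "\<bar>z\<bar> * x \<in> \<int>"
    by (cases "z \<ge> 0") (auto simp: abs_if)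
  then obtain n where "\<bar>z\<bar> * x = of_int n" by (auto elim: Ints_cases)
  then have "x = 1 / \<bar>z\<bar> * of_int n" using assms(2) by (simp add: field_simps)
  then show "x \<in> range (\<lambda>n::int. 1 / \<bar>z\<bar> * of_int n)" by blast
qed

lemma in_Z_if_lattice:
  assumes "0 < b" "msupport \<mu> \<subseteq> range (\<lambda>n::int. b * of_int n)"
  shows "of_int m / b \<in> Z"
  unfolding Z_iff_AE using AE_msupport
proof eventually_elim
  case (elim x)
  then obtain n :: int where "x = b * of_int n" using assms(2) by auto
  then have "of_int m / b * x = of_int (m * n)" using assms(1) by simp
  then have "of_int m / b * x \<in> \<int>" by (metis Ints_of_int)
  then show ?case
    using cis_eq_1_iff_int[of "of_int m / b * x"] by (simp add: mult.assoc)
qed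

lemma Z_nonlattice:
  assumes "\<not> (\<exists>b>0. msupport \<mu> \<subseteq> range (\<lambda>n::int. b * of_int n))"
  shows "Z = {0}"
proof -
  have "z = 0" if "z \<in> Z" for z
  proof (rule ccontr)
    assume "z \<noteq> 0"
    then have "1 / \<bar>z\<bar> > 0" by simp
    with msupport_subset_lattice[OF that \<open>z \<noteq> 0\<close>] assms show False by blast
  qed
  with zero_in_Z show ?thesis by blast
qed

text \<open>A period \<open>r \<in> Z\<close> with \<open>0 < r < 1/b\<close> would put the support into the coarser lattice \<open>(1/r) \<int>\<close>.\<close>
lemma Z_lattice:
  assumes b: "0 < b" "msupport \<mu> \<subseteq> range (\<lambda>n::int. b * of_int n)"
    and max: "\<And>c. 0 < c \<Longrightarrow> msupport \<mu> \<subseteq> range (\<lambda>n::int. c * of_int n) \<Longrightarrow> c \<le> b"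
  shows "Z = range (\<lambda>n::int. of_int n / b)"
proof (intro equalityI subsetI)
  fix z assume z: "z \<in> Z"
  define r where "r = z - of_int \<lfloor>z * b\<rfloor> / b"
  have r: "r \<in> Z"
    unfolding r_def using z in_Z_if_lattice[OF b] by (rule Z_diff)
  have "r * b = frac (z * b)"
    using b by (simp add: r_def frac_def field_simps)
  then have "0 \<le> r * b" "r * b < 1"
    using frac_ge_0[of "z * b"] frac_lt_1[of "z * b"] by simp_all
  then have r_bounds: "0 \<le> r" "r * b < 1"
    using b by (auto simp: zero_le_mult_iff)
  have "r = 0"
  proof (rule ccontr)
    assume "r \<noteq> 0"
    with r_bounds have "0 < r" by simp
    with max[of "1 / \<bar>r\<bar>"] msupport_subset_lattice[OF r \<open>r \<noteq> 0\<close>] have "1 / r \<le> b"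
      by simp
    with \<open>0 < r\<close> r_bounds show False by (simp add: field_simps)
  qed
  then show "z \<in> range (\<lambda>n::int. of_int n / b)" by (auto simp: r_def)
qed (use in_Z_if_lattice[OF b] in auto)

end

section \<open>Sums of measures and Gaussian weights\<close>

definition sum_measure :: "'a measure \<Rightarrow> 'a measure \<Rightarrow> 'a measure" where
  "sum_measure M N = measure_of (space M) (sets M) (\<lambda>A. emeasure M A + emeasure N A)"

lemma sets_sum_measure [simp, measurable_cong]: "sets (sum_measure M N) = sets M"
  by (simp add: sum_measure_def)

lemma space_sum_measure [simp]: "space (sum_measure M N) = space M"
  by (simp add: sum_measure_def)

lemma emeasure_sum_measure:
  assumes N: "sets N = sets M" and A: "A \<in> sets M"
  shows "emeasure (sum_measure M N) A = emeasure M A + emeasure N A"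
proof (rule emeasure_measure_of[OF sum_measure_def])
  show "sets M \<subseteq> Pow (space M)"
    by (rule sets.space_closed)
  show "positive (sets (sum_measure M N)) (\<lambda>A. emeasure M A + emeasure N A)"
    by (simp add: positive_def)
  show "countably_additive (sets (sum_measure M N)) (\<lambda>A. emeasure M A + emeasure N A)"
    unfolding countably_additive_def using N by (auto simp: suminf_add[symmetric] suminf_emeasure image_subset_iff)
  show "A \<in> sets (sum_measure M N)"
    using A by simp
qed

lemma nn_integral_sum_measure:
  assumes N: "sets N = sets M" and f: "f \<in> borel_measurable M"
  shows "(\<integral>\<^sup>+x. f x \<partial>sum_measure M N) = (\<integral>\<^sup>+x. f x \<partial>M) + (\<integral>\<^sup>+x. f x \<partial>N)"
proof -
  note [measurable_cong] = N
  have sp: "space N = space M"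
    using N by (rule sets_eq_imp_space_eq)
  show ?thesis
    using f
  proof induct
    case (cong f g)
    then have "(\<integral>\<^sup>+x. f x \<partial>K) = (\<integral>\<^sup>+x. g x \<partial>K)" if "space K = space M" for K
      using that by (intro nn_integral_cong) auto
    then show ?case using cong(4) sp by simp
  next
    case (set A)
    then show ?case by (simp add: emeasure_sum_measure[OF N] N)
  next
    case (mult u c)
    then show ?case by (simp add: nn_integral_cmult distrib_left)
  next
    case (add u v)
    then show ?case by (simp add: nn_integral_add add_ac)
  next
    case (seq U)
    have mono: "incseq (\<lambda>i. \<integral>\<^sup>+x. U i x \<partial>K)" for K
      using \<open>incseq U\<close> by (auto simp: incseq_def le_fun_def intro!: nn_integral_mono)
    have eq: "(\<integral>\<^sup>+x. (SUP i. U i) x \<partial>K) = (SUP i. \<integral>\<^sup>+x. U i x \<partial>K)" if "sets K = sets M" for K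
    proof -
      note [measurable_cong] = that
      show ?thesis
        unfolding SUP_apply using seq by (intro nn_integral_monotone_convergence_SUP) auto
    qed
    show ?case
      unfolding eq[OF N] eq[OF refl] eq[OF sets_sum_measure] seq(3) by (rule ennreal_SUP_add[OF mono mono])
  qed
qed

lemma
  fixes f :: "'a \<Rightarrow> 'b::{banach, second_countable_topology}"
  assumes N: "sets N = sets M" and fM: "integrable M f" and fN: "integrable N f"
  shows integrable_sum_measure: "integrable (sum_measure M N) f"
    and integral_sum_measure: "integral\<^sup>L (sum_measure M N) f = integral\<^sup>L M f + integral\<^sup>L N f"
proof -
  note [measurable_cong] = N
  have [measurable]: "f \<in> borel_measurable M"
    using fM by auto
  show int: "integrable (sum_measure M N) f"
    using fM fN by (auto simp: integrable_iff_bounded nn_integral_sum_measure[OF N])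
  have le1: "(\<integral>\<^sup>+x. g x \<partial>M) \<le> (\<integral>\<^sup>+x. g x \<partial>sum_measure M N)" and le2: "(\<integral>\<^sup>+x. g x \<partial>N) \<le> (\<integral>\<^sup>+x. g x \<partial>sum_measure M N)"
    if "g \<in> borel_measurable M" for g
    using that by (auto simp: nn_integral_sum_measure[OF N])
  have both: "integrable M g \<and> integrable N g" if "integrable (sum_measure M N) g" for g :: "'a \<Rightarrow> 'b"
  proof -
    have [measurable]: "g \<in> borel_measurable M"
      using borel_measurable_integrable[OF that] by simp
    show ?thesis
      using that le1[of "\<lambda>x. ennreal (norm (g x))"] le2[of "\<lambda>x. ennreal (norm (g x))"]
      by (auto simp: integrable_iff_bounded intro: le_less_trans)
  qed
  show "integral\<^sup>L (sum_measure M N) f = integral\<^sup>L M f + integral\<^sup>L N f"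
    using int
  proof (induct rule: integrable_induct)
    case (base A c)
    then have fin: "emeasure M A \<noteq> \<infinity>" "emeasure N A \<noteq> \<infinity>"
      by (auto simp: emeasure_sum_measure[OF N])
    have "measure (sum_measure M N) A = measure M A + measure N A"
      using base fin by (simp add: measure_def emeasure_sum_measure[OF N] enn2real_plus less_top)
    then show ?case
      using base fin N by (simp add: scaleR_left_distrib less_top[symmetric])
  next
    case (add f g)
    then show ?case using both[OF add(1)] both[OF add(3)] by simp
  next
    case (lim f s)
    have "(\<lambda>i. integral\<^sup>L K (s i)) \<longlonglongrightarrow> integral\<^sup>L K f"
      if K: "sets K = sets M" "integrable K f" for K
    proof (rule integral_dominated_convergence)
      note [measurable_cong] = K(1)
      show "integrable K (\<lambda>x. 2 * norm (f x))" using K(2) by simp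
      show "f \<in> borel_measurable K" using K(2) by auto
      show "s i \<in> borel_measurable K" for i
        using borel_measurable_integrable[OF lim(1)] by simp
      have spK: "space K = space M" using K(1) by (rule sets_eq_imp_space_eq)
      show "AE x in K. (\<lambda>i. s i x) \<longlonglongrightarrow> f x"
        using lim(3) by (intro AE_I2) (simp add: spK)
      show "AE x in K. norm (s i x) \<le> 2 * norm (f x)" for i
        using lim(4) by (intro AE_I2) (simp add: spK)
    qed
    note this[of "sum_measure M N"] this[of M] this[of N]
    then have "(\<lambda>i. integral\<^sup>L (sum_measure M N) (s i)) \<longlonglongrightarrow> integral\<^sup>L (sum_measure M N) f"
      and "(\<lambda>i. integral\<^sup>L M (s i) + integral\<^sup>L N (s i)) \<longlonglongrightarrow> integral\<^sup>L M f + integral\<^sup>L N f"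
      using both[OF lim(5)] lim(5) N by (auto intro: tendsto_add)
    then show ?case
      unfolding lim(2) by (rule LIMSEQ_unique)
  qed
qed

lemma (in pair_sigma_finite) integrable_product:
  fixes f g :: "_ \<Rightarrow> 'c::{real_normed_field, banach, second_countable_topology}"
  assumes f: "integrable M1 f" and g: "integrable M2 g"
  shows "integrable (M1 \<Otimes>\<^sub>M M2) (\<lambda>(x, y). f x * g y)"
proof (rule Fubini_integrable)
  have [measurable]: "f \<in> borel_measurable M1" "g \<in> borel_measurable M2"
    using f g by auto
  show "(\<lambda>(x, y). f x * g y) \<in> borel_measurable (M1 \<Otimes>\<^sub>M M2)"
    by measurable
qed (use f g in \<open>auto simp: norm_mult\<close>)

section \<open>Gaussians and their Fourier transforms\<close>

definition gauss :: "real \<Rightarrow> real \<Rightarrow> real" where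
  "gauss \<sigma> k = exp (- (\<sigma> * k)\<^sup>2 / 2)"

text \<open>The Fourier transform of \<open>gauss \<sigma>\<close>, written as the normal density
  with standard deviation \<sigma> / (2 pi). Thus it has mass one and concentrates at 0 as \<sigma>
  tends to 0, while \<open>gauss \<sigma>\<close> tends to 1.\<close>

definition gauss_hat :: "real \<Rightarrow> real \<Rightarrow> real" where
  "gauss_hat \<sigma> x = 2 * pi / \<sigma> * std_normal_density (2 * pi / \<sigma> * x)"

lemma measurable_gauss [measurable]: "gauss \<sigma> \<in> borel_measurable borel"
  unfolding gauss_def[abs_def] by measurable

lemma measurable_gauss_hat [measurable]: "gauss_hat \<sigma> \<in> borel_measurable borel"
  unfolding gauss_hat_def[abs_def] by measurable

lemma gauss_pos: "0 < gauss \<sigma> k"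
  by (simp add: gauss_def)

lemma gauss_le_1: "gauss \<sigma> k \<le> 1"
  by (simp add: gauss_def)

lemma gauss_hat_nonneg: "0 < \<sigma> \<Longrightarrow> 0 \<le> gauss_hat \<sigma> x"
  by (simp add: gauss_hat_def)

lemma gauss_hat_minus [simp]: "gauss_hat \<sigma> (- x) = gauss_hat \<sigma> x"
  by (simp add: gauss_hat_def std_normal_density_def)

text \<open>The characteristic function of the standard normal law at 2 pi a / \<sigma>, after the
  substitution x = \<sigma> k and multiplication by the normalising constant of the density.\<close>

lemma has_bochner_integral_gaussian_cis:
  assumes "0 < \<sigma>"
  shows "has_bochner_integral lborel (\<lambda>k. of_real (gauss \<sigma> k) * cis (2 * pi * k * a)) (of_real (gauss_hat \<sigma> a))"
proof -
  define t where "t = 2 * pi / \<sigma> * a"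
  have "(LINT x|std_normal_distribution. iexp (t * x)) = complex_of_real (exp (- (t^2) / 2))"
    using fun_cong[OF char_std_normal_distribution, of t] by (simp add: char_def)
  also have "(LINT x|std_normal_distribution. iexp (t * x)) = (LINT x|lborel. std_normal_density x *\<^sub>R iexp (t * x))"
    by (rule integral_density) auto
  finally have *: "(LINT x|lborel. std_normal_density x *\<^sub>R iexp (t * x)) = complex_of_real (exp (- (t^2) / 2))" .
  have "integrable lborel (\<lambda>x. std_normal_density x *\<^sub>R iexp (t * x))"
    using integrable_std_normal_moment_abs[of 0]
    by (rule Bochner_Integration.integrable_bound) auto
  with * have "has_bochner_integral lborel (\<lambda>x. std_normal_density x *\<^sub>R iexp (t * x)) (complex_of_real (exp (- (t^2) / 2)))"
    by (simp add: has_bochner_integral_iff)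
  then have "has_bochner_integral lborel (\<lambda>x. std_normal_density (0 + \<sigma> * x) *\<^sub>R iexp (t * (0 + \<sigma> * x))) (complex_of_real (exp (- (t^2) / 2)) /\<^sub>R \<bar>\<sigma>\<bar>)"
    using assms by (subst (asm) lborel_has_bochner_integral_real_affine_iff[of \<sigma> _ _ 0]) auto
  from has_bochner_integral_mult_right[OF this, of "of_real (sqrt (2 * pi))"]
  show ?thesis
  proof (rule has_bochner_integral_cong[THEN iffD1, rotated -1, OF _ refl])
    have "2 * pi / sqrt (2 * pi) = sqrt (2 * pi)"
      by (rule real_div_sqrt) simp
    moreover have "gauss_hat \<sigma> a = (2 * pi / sqrt (2 * pi)) * (exp (- (t^2) / 2) / \<sigma>)"
      unfolding gauss_hat_def std_normal_density_def t_def[symmetric]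
      by (simp only: divide_inverse mult_ac mult_1)
    ultimately have kernel: "gauss_hat \<sigma> a = sqrt (2 * pi) * (exp (- (t^2) / 2) / \<sigma>)"
      by (rule trans[OF _ arg_cong[where f = "\<lambda>c. c * _"], rotated])
    show "of_real (sqrt (2 * pi)) * (complex_of_real (exp (- (t^2) / 2)) /\<^sub>R \<bar>\<sigma>\<bar>) = complex_of_real (gauss_hat \<sigma> a)"
      unfolding kernel
      by (simp only: of_real_mult of_real_divide of_real_inverse scaleR_conv_of_real abs_of_pos[OF assms] divide_inverse mult.commute)
    show "of_real (sqrt (2 * pi)) * (std_normal_density (0 + \<sigma> * k) *\<^sub>R iexp (t * (0 + \<sigma> * k))) = of_real (gauss \<sigma> k) * cis (2 * pi * k * a)" for k
    proof -
      have eq: "2 * pi * k * a = t * (\<sigma> * k)"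
        using assms by (simp add: t_def)
      show ?thesis
        unfolding eq by (simp add: gauss_def std_normal_density_def cis_conv_exp scaleR_conv_of_real)
    qed
  qed
qed

lemma integrable_gauss: "0 < \<sigma> \<Longrightarrow> integrable lborel (gauss \<sigma>)"
  using has_bochner_integral_gaussian_cis[of \<sigma> 0]
  by (simp add: has_bochner_integral_iff complex_of_real_integrable_eq)

text \<open>Completing the square in |x| - (c x)^2 / 2 gives the maximum 1 / (2 c^2). The weight exp
  (- |x|) is the common currency for integrability against \<open>\<gamma>\<close>.\<close>

lemma gauss_hat_le_exp:
  assumes "0 < \<sigma>"
  shows "\<exists>C>0. \<forall>x. gauss_hat \<sigma> x \<le> C * exp (- \<bar>x\<bar>)"
proof -
  define c where "c = 2 * pi / \<sigma>"
  have c: "0 < c" using assms by (simp add: c_def)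
  have le: "\<bar>x\<bar> - (c * x)\<^sup>2 / 2 \<le> 1 / (2 * c\<^sup>2)" for x
  proof -
    have "0 \<le> (c * \<bar>x\<bar> - 1 / c)\<^sup>2" by simp
    also have "\<dots> = (c * x)\<^sup>2 - 2 * \<bar>x\<bar> + 1 / c\<^sup>2"
      using c by (simp add: power2_diff power_mult_distrib power_divide)
    finally show ?thesis by (simp add: field_simps)
  qed
  have "gauss_hat \<sigma> x \<le> c * (1 / sqrt (2 * pi)) * exp (1 / (2 * c\<^sup>2)) * exp (- \<bar>x\<bar>)" for x
  proof -
    have "exp (- (c * x)\<^sup>2 / 2) \<le> exp (1 / (2 * c\<^sup>2)) * exp (- \<bar>x\<bar>)"
      using le[of x] by (simp add: exp_add[symmetric])
    then have "c * (1 / sqrt (2 * pi)) * exp (- (c * x)\<^sup>2 / 2) \<le> c * (1 / sqrt (2 * pi)) * (exp (1 / (2 * c\<^sup>2)) * exp (- \<bar>x\<bar>))"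
      using c by (intro mult_left_mono) auto
    then show ?thesis
      by (simp add: gauss_hat_def std_normal_density_def c_def mult.assoc)
  qed
  moreover have "0 < c * (1 / sqrt (2 * pi)) * exp (1 / (2 * c\<^sup>2))"
    using c by simp
  ultimately show ?thesis by blast
qed

section \<open>The renewal measure and Abel summation\<close>

text \<open>\<open>S n\<close> plays the role of the sum of the first \<open>n + 1\<close> gaps, with law \<open>\<mu>\<^sup>*\<^sup>(\<^sup>n\<^sup>+\<^sup>1\<^sup>)\<close>; only its two transforms matter.\<close>
locale renewal_sums = waiting_law \<mu> + M: prob_space M for \<mu> :: "real measure" and M :: "'a measure" +
  fixes S :: "nat \<Rightarrow> 'a \<Rightarrow> real"
  assumes S_meas [measurable]: "\<And>n. S n \<in> borel_measurable M"
    and S_nonneg: "\<And>n x. 0 \<le> S n x"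
    and S_cis: "\<And>n t. (LINT x|M. cis (t * S n x)) = ((LINT x|\<mu>. cis (t * x))) ^ Suc n"
    and S_exp: "\<And>n s. 0 < s \<Longrightarrow> (LINT x|M. exp (- s * S n x)) = ((LINT x|\<mu>. exp (- s * x))) ^ Suc n"
begin

text \<open>The product keeps the index n beside the sample point: \<open>\<eta>\<close> is the
  image of \<open>P\<close> under \<open>sm\<close>, and the Abel weights r^(n+1), which are not
  functions of \<open>sm\<close>, are still functions on \<open>P\<close>.\<close>

definition P :: "(nat \<times> 'a) measure" where
  "P = count_space UNIV \<Otimes>\<^sub>M M"

definition sm :: "nat \<times> 'a \<Rightarrow> real" where
  "sm p = S (fst p) (snd p)"

sublocale CM: pair_sigma_finite "count_space (UNIV :: nat set)" M
  by (intro pair_sigma_finite.intro sigma_finite_measure_count_space_countable M.sigma_finite_measure_axioms) simp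

sublocale P: sigma_finite_measure P
  unfolding P_def by (rule CM.P.sigma_finite_measure_axioms)

lemma measurable_sm [measurable]: "sm \<in> borel_measurable P"
  unfolding P_def by (rule measurable_pair_measure_countable1) (simp_all add: sm_def)

lemma measurable_fst_P [measurable]: "fst \<in> measurable P (count_space UNIV)"
  unfolding P_def by (rule measurable_fst)

lemma sm_nonneg: "0 \<le> sm p"
  by (simp add: sm_def S_nonneg)

lemma integral_P:
  fixes f :: "nat \<times> 'a \<Rightarrow> 'c::{banach, second_countable_topology}"
  assumes "integrable P f"
  shows "(\<lambda>n. (LINT x|M. f (n, x))) sums integral\<^sup>L P f"
  using sums_integral_count_space_nat[OF CM.integrable_fst'[OF assms[unfolded P_def]]]
  by (simp add: CM.integral_fst'[OF assms[unfolded P_def]] P_def)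

lemma integrable_P:
  fixes f :: "nat \<times> 'a \<Rightarrow> 'c::{banach, second_countable_topology}"
  assumes f: "f \<in> borel_measurable P" and int: "\<And>n. integrable M (\<lambda>x. f (n, x))"
    and sum: "summable (\<lambda>n. (LINT x|M. norm (f (n, x))))"
  shows "integrable P f"
  unfolding P_def
proof (rule CM.Fubini_integrable)
  show "integrable (count_space UNIV) (\<lambda>n. (LINT x|M. norm (f (n, x))))"
    using sum by (simp add: integrable_count_space_nat_iff)
qed (use f int in \<open>auto simp: P_def\<close>)

lemma laplace_bounds:
  assumes "0 < s"
  shows "0 \<le> (LINT x|\<mu>. exp (- s * x))" "(LINT x|\<mu>. exp (- s * x)) < 1"
    and "integrable \<mu> (\<lambda>x. exp (- s * x))"
proof -
  show int: "integrable \<mu> (\<lambda>x. exp (- s * x))"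
    using pos assms by (intro integrable_const_bound[of _ 1]) (auto elim!: eventually_mono)
  show "0 \<le> (LINT x|\<mu>. exp (- s * x))"
    by simp
  have "(LINT x|\<mu>. exp (- s * x)) < (LINT x|\<mu>. 1)"
  proof (rule integral_less_AE_space[OF int])
    show "AE x in \<mu>. exp (- s * x) < 1"
      using pos assms by (auto elim!: eventually_mono)
    show "emeasure \<mu> (space \<mu>) \<noteq> 0"
      using emeasure_space_1 by simp
  qed simp
  then show "(LINT x|\<mu>. exp (- s * x)) < 1"
    by (simp add: prob_space)
qed

lemma exp_sm:
  assumes "0 < s"
  shows "integrable P (\<lambda>p. exp (- s * sm p))"
    and "(LINT p|P. exp (- s * sm p)) = (LINT x|\<mu>. exp (- s * x)) / (1 - (LINT x|\<mu>. exp (- s * x)))"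
proof -
  let ?\<rho> = "(LINT x|\<mu>. exp (- s * x))"
  have \<rho>: "0 \<le> ?\<rho>" "?\<rho> < 1"
    using laplace_bounds[OF assms] by auto
  have sums: "(\<lambda>n. ?\<rho> ^ Suc n) sums (?\<rho> / (1 - ?\<rho>))"
    using sums_mult[OF geometric_sums[of ?\<rho>], of ?\<rho>] \<rho> by simp
  show int: "integrable P (\<lambda>p. exp (- s * sm p))"
  proof (rule integrable_P)
    show "integrable M (\<lambda>x. exp (- s * sm (n, x)))" for n
      by (rule M.integrable_const_bound[of _ 1]) (use S_nonneg assms in \<open>auto simp: sm_def\<close>)
    have "(LINT x|M. norm (exp (- s * sm (n, x)))) = ?\<rho> ^ Suc n" for n
      using S_exp[OF assms, of n] by (simp add: sm_def)
    then show "summable (\<lambda>n. (LINT x|M. norm (exp (- s * sm (n, x)))))"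
      using sums by (simp only: sums_iff)
  qed simp
  have "(LINT x|M. exp (- s * sm (n, x))) = ?\<rho> ^ Suc n" for n
    using S_exp[OF assms, of n] by (simp add: sm_def)
  then have "(\<lambda>n. ?\<rho> ^ Suc n) sums (LINT p|P. exp (- s * sm p))"
    using integral_P[OF int] by (simp only:)
  from sums_unique2[OF this sums] show "(LINT p|P. exp (- s * sm p)) = ?\<rho> / (1 - ?\<rho>)" .
qed

definition \<eta> :: "real measure" where
  "\<eta> = distr P borel sm"

definition \<gamma> :: "real measure" where
  "\<gamma> = sum_measure (return borel 0) (sum_measure \<eta> (distr \<eta> borel uminus))"

lemma sets_\<eta> [simp, measurable_cong]: "sets \<eta> = sets borel"
  by (simp add: \<eta>_def)

lemma sets_\<gamma> [simp, measurable_cong]: "sets \<gamma> = sets borel"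
  by (simp add: \<gamma>_def)

lemma AE_\<eta>_nonneg: "AE x in \<eta>. 0 \<le> x"
  unfolding \<eta>_def by (subst AE_distr_iff) (auto simp: sm_nonneg)

text \<open>The value \<rho> / (1 - \<rho>) is the almost sure limit found in
  \<open>AE_averages_perpetuity\<close>; this agreement identifies \<open>\<eta>\<close> as the
  limit of the pair averages.\<close>

lemma exp_\<eta>:
  assumes "0 < s"
  shows "integrable \<eta> (\<lambda>t. exp (- s * t))"
    and "(LINT t|\<eta>. exp (- s * t)) = (LINT x|\<mu>. exp (- s * x)) / (1 - (LINT x|\<mu>. exp (- s * x)))"
  using exp_sm[OF assms] by (simp_all add: \<eta>_def integrable_distr_eq integral_distr)

text \<open>A multiple of exp (- |x|) suffices for integrability against \<open>\<gamma>\<close>, by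
  the Laplace transform of \<open>\<eta>\<close> at 1. The formula over \<open>P\<close> feeds the
  Abel summation, the one over \<open>\<eta>\<close> the autocorrelation.\<close>

lemma
  fixes f :: "real \<Rightarrow> 'c::{banach, second_countable_topology}"
  assumes f [measurable]: "f \<in> borel_measurable borel" and bound: "\<And>x. norm (f x) \<le> C * exp (- \<bar>x\<bar>)"
  shows integrable_P_sm: "integrable P (\<lambda>p. f (sm p))" "integrable P (\<lambda>p. f (- sm p))"
    and integrable_\<gamma>: "integrable \<gamma> f"
    and integral_\<gamma>: "integral\<^sup>L \<gamma> f = f 0 + (LINT p|P. f (sm p) + f (- sm p))"
    and integral_\<gamma>_\<eta>: "integral\<^sup>L \<gamma> f = f 0 + (LINT x|\<eta>. f x + f (- x))"
proof -
  have dom: "integrable P (\<lambda>p. C * exp (- 1 * sm p))"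
    using exp_sm(1)[of 1] by (intro integrable_mult_right) auto
  have C: "norm (f (sm p)) \<le> norm (C * exp (- 1 * sm p))" "norm (f (- sm p)) \<le> norm (C * exp (- 1 * sm p))" for p
    using bound[of "sm p"] bound[of "- sm p"] sm_nonneg[of p] by auto
  show 1: "integrable P (\<lambda>p. f (sm p))"
    by (rule Bochner_Integration.integrable_bound[OF dom _ AE_I2[OF C(1)]]) simp
  show 2: "integrable P (\<lambda>p. f (- sm p))"
    by (rule Bochner_Integration.integrable_bound[OF dom _ AE_I2[OF C(2)]]) simp
  have \<eta>1: "integrable \<eta> f" and \<eta>2: "integrable (distr \<eta> borel uminus) f"
    using 1 2 by (simp_all add: \<eta>_def integrable_distr_eq)
  have \<delta>: "integrable (return borel (0::real)) f"
    by (rule integrableI_bounded) (simp_all add: nn_integral_return)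
  have s: "sets (distr \<eta> borel uminus) = sets \<eta>" "sets (sum_measure \<eta> (distr \<eta> borel uminus)) = sets (return borel 0)"
    by simp_all
  note int = integrable_sum_measure[OF s(1) \<eta>1 \<eta>2]
  show "integrable \<gamma> f"
    unfolding \<gamma>_def by (rule integrable_sum_measure[OF s(2) \<delta> int])
  have "integral\<^sup>L \<gamma> f = f 0 + (integral\<^sup>L \<eta> f + integral\<^sup>L (distr \<eta> borel uminus) f)"
    unfolding \<gamma>_def by (simp add: integral_sum_measure[OF s(2) \<delta> int] integral_sum_measure[OF s(1) \<eta>1 \<eta>2] integral_return)
  moreover have "integral\<^sup>L (distr \<eta> borel uminus) f = (LINT x|\<eta>. f (- x))"
    by (simp add: integral_distr)
  moreover have "integrable \<eta> (\<lambda>x. f (- x))"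
    using 2 by (simp add: \<eta>_def integrable_distr_eq)
  ultimately show *: "integral\<^sup>L \<gamma> f = f 0 + (LINT x|\<eta>. f x + f (- x))"
    using \<eta>1 by simp
  then show "integral\<^sup>L \<gamma> f = f 0 + (LINT p|P. f (sm p) + f (- sm p))"
    by (simp add: \<eta>_def integral_distr)
qed

lemma locally_finite_\<gamma>: "locally_finite_borel \<gamma>"
  unfolding locally_finite_borel_def
proof (intro conjI allI impI)
  fix K :: "real set" assume K: "compact K"
  then obtain B where B: "\<And>x. x \<in> K \<Longrightarrow> \<bar>x\<bar> \<le> B"
    using compact_imp_bounded[OF K] unfolding bounded_iff by auto
  have [measurable]: "K \<in> sets borel"
    using K by (simp add: borel_compact)
  have "integrable \<gamma> (indicator K :: real \<Rightarrow> real)"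
  proof (rule integrable_\<gamma>)
    fix x show "norm (indicator K x :: real) \<le> exp B * exp (- \<bar>x\<bar>)"
      using B[of x] by (auto simp: exp_add[symmetric] split: split_indicator)
  qed simp
  then show "emeasure \<gamma> K < \<infinity>"
    by (subst (asm) integrable_indicator_iff) auto
qed simp

text \<open>The smoothed measure \<open>\<gamma>\<close> at y. It is also the number that the
  Fourier integral of \<open>gauss \<sigma>\<close> against the diffraction measure must produce at
  y.\<close>

definition \<Psi> :: "real \<Rightarrow> real \<Rightarrow> real" where
  "\<Psi> \<sigma> y = (LINT x|\<gamma>. gauss_hat \<sigma> (x - y))"

lemma shifted_kernel_bound:
  assumes "0 < \<sigma>" shows "\<exists>C. \<forall>x. norm (gauss_hat \<sigma> (x - y)) \<le> C * exp (- \<bar>x\<bar>)"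
proof -
  obtain C where C: "C > 0" "\<And>x. gauss_hat \<sigma> x \<le> C * exp (- \<bar>x\<bar>)"
    using gauss_hat_le_exp[OF assms] by blast
  have "norm (gauss_hat \<sigma> (x - y)) \<le> C * exp \<bar>y\<bar> * exp (- \<bar>x\<bar>)" for x
  proof -
    have "norm (gauss_hat \<sigma> (x - y)) \<le> C * exp (- \<bar>x - y\<bar>)"
      using C(2)[of "x - y"] gauss_hat_nonneg[OF assms] by simp
    also have "\<dots> \<le> C * (exp \<bar>y\<bar> * exp (- \<bar>x\<bar>))"
      using C(1) by (intro mult_left_mono) (auto simp: exp_add[symmetric])
    finally show ?thesis by simp
  qed
  then show ?thesis by blast
qed

section \<open>The Abel density tested against Gaussians\<close>

text \<open>The Fourier transform of \<open>\<delta>\<^sub>0 + \<Sum>\<^sub>n r\<^sup>n (\<mu>\<^sup>*\<^sup>n + reflected \<mu>\<^sup>*\<^sup>n)\<close>.\<close>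
definition abel :: "real \<Rightarrow> real \<Rightarrow> real" where
  "abel r k = 1 + 2 * Re (of_real r * w k / (1 - of_real r * w k))"

text \<open>With v = r w this is the Poisson kernel identity: 1 + 2 Re (v / (1 - v)) = Re ((1 + v) /
  (1 - v)) = (1 - |v|^2) / |1 - v|^2. It makes positivity visible.\<close>

lemma abel_eq:
  assumes "0 \<le> r" "r < 1"
  shows "abel r k = (1 - r\<^sup>2 * (cmod (w k))\<^sup>2) / (cmod (1 - of_real r * w k))\<^sup>2"
proof -
  define v where "v = of_real r * w k"
  have "cmod v < 1"
    using assms norm_w_le[of k] mult_left_le[of "cmod (w k)" r] by (simp add: v_def norm_mult)
  then have ne: "1 - v \<noteq> 0" by auto
  then have pos: "(cmod (1 - v))\<^sup>2 > 0" by simp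
  have "v / (1 - v) = v * cnj (1 - v) / of_real ((cmod (1 - v))\<^sup>2)"
    by (rule complex_div_cnj)
  then have "Re (v / (1 - v)) = Re (v * cnj (1 - v)) / (cmod (1 - v))\<^sup>2"
    by (simp del: of_real_power)
  moreover have "Re (v * cnj (1 - v)) = Re v - (cmod v)\<^sup>2"
    unfolding cmod_power2 by (simp add: algebra_simps power2_eq_square)
  moreover have "(cmod (1 - v))\<^sup>2 = 1 - 2 * Re v + (cmod v)\<^sup>2"
    unfolding cmod_power2 by (simp add: algebra_simps power2_eq_square)
  moreover have "1 + 2 * (N / d) = (1 - c) / d" if "0 < d" "N = u - c" "d = 1 - 2 * u + c" for N d u c :: real
    using that(1) unfolding that(2) by (simp add: that(3) field_simps)
  ultimately have "1 + 2 * Re (v / (1 - v)) = (1 - (cmod v)\<^sup>2) / (cmod (1 - v))\<^sup>2"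
    using pos by presburger
  then show ?thesis
    by (simp add: abel_def v_def norm_mult power_mult_distrib)
qed

lemma measurable_abel [measurable]: "abel r \<in> borel_measurable borel"
  unfolding abel_def[abs_def] by measurable

lemma integrable_pow: 
  fixes r :: real
  assumes "0 \<le> r" "r < 1" shows "integrable P (\<lambda>p. r ^ Suc (fst p))"
proof (rule integrable_P)
  show "summable (\<lambda>n. (LINT x|M. norm (r ^ Suc (fst (n, x)))))"
    using assms by (simp add: M.prob_space summable_geometric summable_mult)
qed simp_all

lemma integral_P_cos:
  assumes "0 \<le> r" "r < 1"
  shows "(LINT p|P. r ^ Suc (fst p) * (2 * cos (2 * pi * k * sm p))) = abel r k - 1"
proof -
  have int: "integrable P (\<lambda>p. r ^ Suc (fst p) * (2 * cos (2 * pi * k * sm p)))"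
    by (rule Bochner_Integration.integrable_bound[OF integrable_mult_right[OF integrable_pow[OF assms], of 2]])
      (use assms in \<open>auto simp: abs_mult mult_left_le intro!: mult_left_mono\<close>)
  have summand: "(LINT x|M. r ^ Suc (fst (n, x)) * (2 * cos (2 * pi * k * sm (n, x)))) = 2 * Re ((of_real r * w k) ^ Suc n)" for n
  proof -
    have "integrable M (\<lambda>x. cis (- 2 * pi * k * S n x))"
      by (rule M.integrable_const_bound[of _ 1]) auto
    then have "(LINT x|M. cos (2 * pi * k * S n x)) = Re ((LINT x|M. cis (- 2 * pi * k * S n x)))"
      by (subst integral_Re[symmetric]) auto
    also have "\<dots> = Re (w k ^ Suc n)"
      by (simp only: S_cis ft_measure_def)
    finally show ?thesis
      by (simp add: sm_def power_mult_distrib del: power_Suc flip: of_real_power)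
  qed
  have "cmod (of_real r * w k) < 1"
    using assms norm_w_le[of k] mult_left_le[of "cmod (w k)" r] by (simp add: norm_mult)
  then have "(\<lambda>n. (of_real r * w k) ^ Suc n) sums (of_real r * w k / (1 - of_real r * w k))"
    using sums_mult[OF geometric_sums[of "of_real r * w k"], of "of_real r * w k"] by simp
  then have "(\<lambda>n. 2 * Re ((of_real r * w k) ^ Suc n)) sums (2 * Re (of_real r * w k / (1 - of_real r * w k)))"
    by (intro sums_mult sums_Re)
  with integral_P[OF int] have "(LINT p|P. r ^ Suc (fst p) * (2 * cos (2 * pi * k * sm p))) = 2 * Re (of_real r * w k / (1 - of_real r * w k))"
    unfolding summand by (rule sums_unique2)
  then show ?thesis by (simp add: abel_def)
qed

text \<open>The geometric factor r^(n+1) makes the double integral absolutely convergent.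
  Integrating over \<open>P\<close> first gives the Abel density; integrating over k first turns
  each cosine, split into two exponentials, into two translates of \<open>gauss_hat\<close>.\<close>

lemma abel_parseval:
  assumes r: "0 \<le> r" "r < 1" and \<sigma>: "0 < \<sigma>"
  shows "(LINT k|lborel. of_real (gauss \<sigma> k * abel r k) * cis (2 * pi * k * y))
    = of_real (gauss_hat \<sigma> (- y) + (LINT p|P. r ^ Suc (fst p) * (gauss_hat \<sigma> (sm p - y) + gauss_hat \<sigma> (- sm p - y))))"
    and "integrable lborel (\<lambda>k. of_real (gauss \<sigma> k * abel r k) * cis (2 * pi * k * y))"
proof -
  interpret PL: pair_sigma_finite P lborel ..
  define F where "F p k = of_real (r ^ Suc (fst p) * gauss \<sigma> k * (2 * cos (2 * pi * k * sm p))) * cis (2 * pi * k * y)" for p k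
  have dom: "integrable (P \<Otimes>\<^sub>M lborel) (\<lambda>(p, k). 2 * r ^ Suc (fst p) * gauss \<sigma> k)"
    using PL.integrable_product[OF integrable_mult_right[OF integrable_pow[OF r], of 2] integrable_gauss[OF \<sigma>]] by simp
  have F_int: "integrable (P \<Otimes>\<^sub>M lborel) (case_prod F)"
  proof (rule Bochner_Integration.integrable_bound[OF dom])
    show "case_prod F \<in> borel_measurable (P \<Otimes>\<^sub>M lborel)"
      unfolding F_def by measurable
    have "norm (F p k) \<le> 2 * r ^ Suc (fst p) * gauss \<sigma> k" for p k
    proof -
      have "norm (F p k) = r ^ Suc (fst p) * gauss \<sigma> k * (2 * \<bar>cos (2 * pi * k * sm p)\<bar>)"
        using r gauss_pos[of \<sigma> k] by (simp add: F_def norm_mult abs_mult del: of_real_mult of_real_power)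
      also have "\<dots> \<le> r ^ Suc (fst p) * gauss \<sigma> k * (2 * 1)"
        using r gauss_pos[of \<sigma> k] by (intro mult_left_mono) auto
      finally show ?thesis by simp
    qed
    then show "AE x in P \<Otimes>\<^sub>M lborel. norm (case_prod F x) \<le> norm (case x of (p, k) \<Rightarrow> 2 * r ^ Suc (fst p) * gauss \<sigma> k)"
      using r gauss_pos by (intro AE_I2) (auto simp: abs_mult less_imp_le)
  qed
  have inner: "integral\<^sup>L lborel (F p) = of_real (r ^ Suc (fst p) * (gauss_hat \<sigma> (sm p - y) + gauss_hat \<sigma> (- sm p - y)))" for p
  proof -
    have "has_bochner_integral lborel (\<lambda>k. of_real (r ^ Suc (fst p)) *
        (of_real (gauss \<sigma> k) * cis (2 * pi * k * (y - sm p)) + of_real (gauss \<sigma> k) * cis (2 * pi * k * (y + sm p))))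
        (of_real (r ^ Suc (fst p)) * (of_real (gauss_hat \<sigma> (y - sm p)) + of_real (gauss_hat \<sigma> (y + sm p))))"
      by (intro has_bochner_integral_mult_right has_bochner_integral_add has_bochner_integral_gaussian_cis \<sigma>)
    moreover have "F p = (\<lambda>k. of_real (r ^ Suc (fst p)) *
        (of_real (gauss \<sigma> k) * cis (2 * pi * k * (y - sm p)) + of_real (gauss \<sigma> k) * cis (2 * pi * k * (y + sm p))))"
    proof
      fix k
      have "of_real (2 * cos (2 * pi * k * sm p)) * cis (2 * pi * k * y) = cis (2 * pi * k * (y - sm p)) + cis (2 * pi * k * (y + sm p))"
        by (simp add: complex_eq_iff distrib_left right_diff_distrib cos_add cos_diff sin_add sin_diff)
      moreover have "F p k = of_real (r ^ Suc (fst p)) * (of_real (gauss \<sigma> k) * (of_real (2 * cos (2 * pi * k * sm p)) * cis (2 * pi * k * y)))"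
        by (simp add: F_def mult_ac)
      ultimately show "F p k = of_real (r ^ Suc (fst p)) *
        (of_real (gauss \<sigma> k) * cis (2 * pi * k * (y - sm p)) + of_real (gauss \<sigma> k) * cis (2 * pi * k * (y + sm p)))"
        by (simp only: distrib_left)
    qed
    moreover have "gauss_hat \<sigma> (y - sm p) = gauss_hat \<sigma> (sm p - y)" "gauss_hat \<sigma> (y + sm p) = gauss_hat \<sigma> (- sm p - y)"
      using gauss_hat_minus[of \<sigma> "y - sm p"] gauss_hat_minus[of \<sigma> "- sm p - y"]
      by (simp_all only: minus_diff_eq diff_minus_eq_add)
    ultimately have "has_bochner_integral lborel (F p)
        (of_real (r ^ Suc (fst p)) * (of_real (gauss_hat \<sigma> (sm p - y)) + of_real (gauss_hat \<sigma> (- sm p - y))))"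
      by (simp only:)
    then show ?thesis
      by (simp only: has_bochner_integral_integral_eq of_real_mult of_real_add)
  qed
  have outer: "(LINT p|P. F p k) = of_real (gauss \<sigma> k * (abel r k - 1)) * cis (2 * pi * k * y)" for k
  proof -
    have "(LINT p|P. F p k) = (LINT p|P. of_real (r ^ Suc (fst p) * (2 * cos (2 * pi * k * sm p))) * (of_real (gauss \<sigma> k) * cis (2 * pi * k * y)))"
      by (intro Bochner_Integration.integral_cong refl) (simp add: F_def)
    also have "\<dots> = of_real (abel r k - 1) * (of_real (gauss \<sigma> k) * cis (2 * pi * k * y))"
      unfolding integral_mult_left_zero integral_complex_of_real integral_P_cos[OF r] ..
    finally show ?thesis by simp
  qed
  have int1: "integrable lborel (\<lambda>k. of_real (gauss \<sigma> k * (abel r k - 1)) * cis (2 * pi * k * y))"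
    using PL.integrable_snd[OF F_int] unfolding outer .
  have g: "has_bochner_integral lborel (\<lambda>k. of_real (gauss \<sigma> k) * cis (2 * pi * k * y)) (of_real (gauss_hat \<sigma> y))"
    by (rule has_bochner_integral_gaussian_cis[OF \<sigma>])
  have split: "of_real (gauss \<sigma> k * abel r k) * cis (2 * pi * k * y)
      = of_real (gauss \<sigma> k) * cis (2 * pi * k * y) + of_real (gauss \<sigma> k * (abel r k - 1)) * cis (2 * pi * k * y)" for k
    by (simp add: algebra_simps)
  show "integrable lborel (\<lambda>k. of_real (gauss \<sigma> k * abel r k) * cis (2 * pi * k * y))"
    unfolding split using g int1 by (simp add: has_bochner_integral_iff)
  have "(LINT k|lborel. of_real (gauss \<sigma> k * (abel r k - 1)) * cis (2 * pi * k * y)) = (LINT p|P. integral\<^sup>L lborel (F p))"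
    using PL.Fubini_integral[OF F_int] unfolding outer .
  also have "\<dots> = of_real ((LINT p|P. r ^ Suc (fst p) * (gauss_hat \<sigma> (sm p - y) + gauss_hat \<sigma> (- sm p - y))))"
    unfolding inner by (rule integral_complex_of_real)
  finally show "(LINT k|lborel. of_real (gauss \<sigma> k * abel r k) * cis (2 * pi * k * y))
    = of_real (gauss_hat \<sigma> (- y) + (LINT p|P. r ^ Suc (fst p) * (gauss_hat \<sigma> (sm p - y) + gauss_hat \<sigma> (- sm p - y))))"
    unfolding split using g int1 by (simp add: has_bochner_integral_iff)
qed

end

section \<open>Regular part and peak part of the Abel density\<close>

context waiting_law
begin

text \<open>The density \<open>1 - h\<close>; on \<open>Z\<close> it takes the junk value \<open>0\<close>.\<close>
definition kappa :: "real \<Rightarrow> real" where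
  "kappa k = (1 - (cmod (w k))\<^sup>2) / (cmod (1 - w k))\<^sup>2"

definition regular_part :: "real \<Rightarrow> real \<Rightarrow> real" where
  "regular_part r k = r\<^sup>2 * (1 - (cmod (w k))\<^sup>2) / (cmod (1 - of_real r * w k))\<^sup>2"

definition peak_part :: "real \<Rightarrow> real \<Rightarrow> real" where
  "peak_part r k = (1 - r\<^sup>2) / (cmod (1 - of_real r * w k))\<^sup>2"

lemma measurable_kappa [measurable]: "kappa \<in> borel_measurable borel"
  unfolding kappa_def[abs_def] by measurable

lemma measurable_regular_part [measurable]: "regular_part r \<in> borel_measurable borel"
  unfolding regular_part_def[abs_def] by measurable

lemma measurable_peak_part [measurable]: "peak_part r \<in> borel_measurable borel"
  unfolding peak_part_def[abs_def] by measurable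

lemma norm_w_sq_le: "(cmod (w k))\<^sup>2 \<le> 1"
  using norm_w_le[of k] by (simp add: power_le_one)

lemma kappa_nonneg: "0 \<le> kappa k"
  using norm_w_sq_le[of k] by (simp add: kappa_def)

lemma regular_part_nonneg: "0 \<le> regular_part r k"
  using norm_w_sq_le[of k] by (simp add: regular_part_def)

lemma peak_part_nonneg: "0 \<le> r \<Longrightarrow> r \<le> 1 \<Longrightarrow> 0 \<le> peak_part r k"
  by (simp add: peak_part_def power_le_one)

text \<open>Since 1 - w = (1 - r w) - (1 - r) w and |(1 - r) w| \<le> 1 - r \<le> |1 - r w|, the
  modulus |1 - w| is at most twice |1 - r w|. The square of this 2 is the 4 in the following
  estimates.\<close>

lemma abel_denominator:
  assumes "0 \<le> r" "r \<le> 1"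
  shows "1 - r \<le> cmod (1 - of_real r * w k)" "cmod (1 - w k) / 2 \<le> cmod (1 - of_real r * w k)"
proof -
  have "cmod (of_real r * w k) \<le> r"
    using assms norm_w_le[of k] by (simp add: norm_mult mult_left_le)
  then show 1: "1 - r \<le> cmod (1 - of_real r * w k)"
    using norm_triangle_ineq2[of 1 "of_real r * w k"] by simp
  have "cmod (1 - w k) \<le> cmod (1 - of_real r * w k) + cmod (of_real (1 - r) * w k)"
    using norm_triangle_ineq4[of "1 - of_real r * w k" "of_real (1 - r) * w k"] by (simp add: algebra_simps)
  also have "cmod (of_real (1 - r) * w k) \<le> 1 - r"
    using assms norm_w_le[of k] by (simp add: norm_mult mult_left_le del: of_real_diff)
  finally show "cmod (1 - w k) / 2 \<le> cmod (1 - of_real r * w k)"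
    using 1 by simp
qed

lemma regular_part_le:
  assumes "0 \<le> r" "r \<le> 1" shows "regular_part r k \<le> 4 * kappa k"
\<comment> \<open>At points of \<open>Z\<close> both sides are 0: the numerator of the regular part
  vanishes, and \<open>kappa\<close> is a quotient by 0.\<close>
proof (cases "w k = 1")
  case False
  have "regular_part r k \<le> 1 * (1 - (cmod (w k))\<^sup>2) / (cmod (1 - w k) / 2)\<^sup>2"
    unfolding regular_part_def
    using assms norm_w_sq_le[of k] abel_denominator[OF assms, of k] False
    by (intro frac_le mult_mono power_mono power_le_one) auto
  then show ?thesis
    by (simp add: kappa_def power_divide mult.commute)
qed (simp add: regular_part_def kappa_def)

lemma peak_part_le:
  assumes "0 \<le> r" "r \<le> 1" "w k \<noteq> 1" shows "peak_part r k \<le> 4 * (1 - r\<^sup>2) / (cmod (1 - w k))\<^sup>2"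
proof -
  have "peak_part r k \<le> (1 - r\<^sup>2) / (cmod (1 - w k) / 2)\<^sup>2"
    unfolding peak_part_def
    using assms abel_denominator[OF assms(1,2), of k]
    by (intro divide_left_mono power_mono mult_pos_pos zero_less_power) (auto simp: power_le_one)
  then show ?thesis
    by (simp add: power_divide mult.commute)
qed

definition rr :: "nat \<Rightarrow> real" where
  "rr m = 1 - 1 / real (m + 2)"

lemma rr: "0 \<le> rr m" "rr m < 1"
  by (simp_all add: rr_def divide_simps)

lemma rr_tendsto: "rr \<longlonglongrightarrow> 1"
proof -
  have "(\<lambda>m. 1 - 1 / real (m + 2)) \<longlonglongrightarrow> 1 - 0"
    by (intro tendsto_diff tendsto_const LIMSEQ_ignore_initial_segment lim_1_over_n)
  then show ?thesis
    by (simp add: rr_def[abs_def])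
qed

lemma regular_part_tendsto: "(\<lambda>m. regular_part (rr m) k) \<longlonglongrightarrow> kappa k"
proof (cases "w k = 1")
  case False
  have "(\<lambda>m. (rr m)\<^sup>2 * (1 - (cmod (w k))\<^sup>2) / (cmod (1 - of_real (rr m) * w k))\<^sup>2)
    \<longlonglongrightarrow> 1\<^sup>2 * (1 - (cmod (w k))\<^sup>2) / (cmod (1 - of_real 1 * w k))\<^sup>2"
    using False by (intro tendsto_intros rr_tendsto) auto
  then show ?thesis
    by (simp add: regular_part_def kappa_def)
qed (simp add: regular_part_def kappa_def)

end

context renewal_sums
begin

lemma abel_split: "abel (rr m) k = peak_part (rr m) k + regular_part (rr m) k"
  unfolding abel_eq[OF rr] peak_part_def regular_part_def by (simp add: add_divide_distrib[symmetric] algebra_simps)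

lemma abel_nonneg: "0 \<le> abel (rr m) k"
  unfolding abel_split using rr[of m] by (intro add_nonneg_nonneg peak_part_nonneg regular_part_nonneg) auto

lemma \<Psi>_eq:
  assumes "0 < \<sigma>"
  shows "\<Psi> \<sigma> y = gauss_hat \<sigma> (- y) + (LINT p|P. gauss_hat \<sigma> (sm p - y) + gauss_hat \<sigma> (- sm p - y))"
    and "integrable P (\<lambda>p. gauss_hat \<sigma> (sm p - y) + gauss_hat \<sigma> (- sm p - y))"
proof -
  obtain C where C: "\<And>x. norm (gauss_hat \<sigma> (x - y)) \<le> C * exp (- \<bar>x\<bar>)"
    using shifted_kernel_bound[OF assms, of y] by blast
  have m: "(\<lambda>x. gauss_hat \<sigma> (x - y)) \<in> borel_measurable borel"
    by measurable
  show "\<Psi> \<sigma> y = gauss_hat \<sigma> (- y) + (LINT p|P. gauss_hat \<sigma> (sm p - y) + gauss_hat \<sigma> (- sm p - y))"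
    unfolding \<Psi>_def integral_\<gamma>[OF m C] by simp
  show "integrable P (\<lambda>p. gauss_hat \<sigma> (sm p - y) + gauss_hat \<sigma> (- sm p - y))"
    using integrable_P_sm[OF m C] by (rule Bochner_Integration.integrable_add)
qed

lemma abel_gaussian_tendsto:
  assumes \<sigma>: "0 < \<sigma>"
  shows "(\<lambda>m. (LINT k|lborel. of_real (gauss \<sigma> k * abel (rr m) k) * cis (2 * pi * k * y))) \<longlonglongrightarrow> of_real (\<Psi> \<sigma> y)"
proof -
  define h where "h p = gauss_hat \<sigma> (sm p - y) + gauss_hat \<sigma> (- sm p - y)" for p
  have h0: "0 \<le> h p" for p
    unfolding h_def using gauss_hat_nonneg[OF \<sigma>] by (intro add_nonneg_nonneg)
  have h: "integrable P h"
    using \<Psi>_eq(2)[OF \<sigma>] by (simp add: h_def[abs_def])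
  have "(\<lambda>m. (LINT p|P. rr m ^ Suc (fst p) * h p)) \<longlonglongrightarrow> integral\<^sup>L P h"
  proof (rule integral_dominated_convergence[OF _ _ h])
    show "AE p in P. (\<lambda>m. rr m ^ Suc (fst p) * h p) \<longlonglongrightarrow> h p"
    proof (rule AE_I2)
      fix p
      have "(\<lambda>m. rr m ^ Suc (fst p) * h p) \<longlonglongrightarrow> 1 ^ Suc (fst p) * h p"
        by (intro tendsto_intros rr_tendsto)
      then show "(\<lambda>m. rr m ^ Suc (fst p) * h p) \<longlonglongrightarrow> h p"
        by simp
    qed
    show "AE p in P. norm (rr m ^ Suc (fst p) * h p) \<le> h p" for m
      using rr[of m] h0 by (intro AE_I2) (simp add: abs_mult mult_left_le_one_le power_le_one mult_le_one del: power_Suc)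
  qed (use h in simp_all)
  then have "(\<lambda>m. of_real (gauss_hat \<sigma> (- y) + (LINT p|P. rr m ^ Suc (fst p) * h p)))
      \<longlonglongrightarrow> complex_of_real (gauss_hat \<sigma> (- y) + integral\<^sup>L P h)"
    by (intro tendsto_of_real tendsto_add tendsto_const)
  then show ?thesis
    unfolding abel_parseval(1)[OF rr \<sigma>] \<Psi>_eq(1)[OF \<sigma>] h_def .
qed

text \<open>At y = 0 all terms on the side of \<open>P\<close> are nonnegative, so the Abel weights,
  being at most 1, can only decrease the sum. Hence a bound that does not depend on m.\<close>

lemma
  assumes \<sigma>: "0 < \<sigma>"
  shows integrable_abel: "integrable lborel (\<lambda>k. gauss \<sigma> k * abel (rr m) k)"
    and integral_abel_le: "(LINT k|lborel. gauss \<sigma> k * abel (rr m) k) \<le> \<Psi> \<sigma> 0"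
proof -
  define h where "h p = gauss_hat \<sigma> (sm p - 0) + gauss_hat \<sigma> (- sm p - 0)" for p
  have h0: "0 \<le> h p" for p
    unfolding h_def using gauss_hat_nonneg[OF \<sigma>] by (intro add_nonneg_nonneg)
  have h: "integrable P h"
    using \<Psi>_eq(2)[OF \<sigma>, of 0] by (simp add: h_def[abs_def])
  have le: "rr m ^ Suc (fst p) * h p \<le> h p" for p
    using rr[of m] h0[of p] by (intro mult_left_le_one_le power_le_one) auto
  have "integrable P (\<lambda>p. rr m ^ Suc (fst p) * h p)"
  proof (rule Bochner_Integration.integrable_bound[OF h])
    show "AE p in P. norm (rr m ^ Suc (fst p) * h p) \<le> norm (h p)"
      using le h0 rr[of m] by (intro AE_I2) (simp add: abs_mult)
  qed (use h in simp)
  then have "(LINT p|P. rr m ^ Suc (fst p) * h p) \<le> integral\<^sup>L P h"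
    by (intro integral_mono h le)
  moreover show int: "integrable lborel (\<lambda>k. gauss \<sigma> k * abel (rr m) k)"
    using abel_parseval(2)[OF rr \<sigma>, of m 0] by (simp add: complex_of_real_integrable_eq del: of_real_mult)
  moreover have "(LINT k|lborel. gauss \<sigma> k * abel (rr m) k)
      = gauss_hat \<sigma> (- 0) + (LINT p|P. rr m ^ Suc (fst p) * h p)"
  proof -
    have "of_real ((LINT k|lborel. gauss \<sigma> k * abel (rr m) k)) =
      (LINT k|lborel. of_real (gauss \<sigma> k * abel (rr m) k) * cis (2 * pi * k * 0))"
      by (simp del: of_real_mult)
    also have "\<dots> = of_real (gauss_hat \<sigma> (- 0) + (LINT p|P. rr m ^ Suc (fst p) * h p))"
      unfolding abel_parseval(1)[OF rr \<sigma>] h_def ..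
    finally show ?thesis by (simp only: of_real_eq_iff)
  qed
  ultimately show "(LINT k|lborel. gauss \<sigma> k * abel (rr m) k) \<le> \<Psi> \<sigma> 0"
    unfolding \<Psi>_eq(1)[OF \<sigma>] h_def by simp
qed

text \<open>Fatou: the regular parts converge pointwise to \<open>kappa\<close> and lie below the
  Abel densities, whose Gaussian integrals are at most \<open>\<Psi> \<sigma> 0\<close>. This is the
  source of the local integrability of h.\<close>

lemma integrable_kappa_gaussian:
  assumes \<sigma>: "0 < \<sigma>"
  shows "integrable lborel (\<lambda>k. gauss \<sigma> k * kappa k)"
proof (rule integrableI_nonneg)
  show "AE k in lborel. 0 \<le> gauss \<sigma> k * kappa k"
    by (intro AE_I2 mult_nonneg_nonneg less_imp_le[OF gauss_pos] kappa_nonneg)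
  have "(\<integral>\<^sup>+k. ennreal (gauss \<sigma> k * kappa k) \<partial>lborel)
      = (\<integral>\<^sup>+k. liminf (\<lambda>m. ennreal (gauss \<sigma> k * regular_part (rr m) k)) \<partial>lborel)"
  proof (intro nn_integral_cong)
    fix k
    have "(\<lambda>m. ennreal (gauss \<sigma> k * regular_part (rr m) k)) \<longlonglongrightarrow> ennreal (gauss \<sigma> k * kappa k)"
      by (intro tendsto_ennrealI tendsto_mult tendsto_const regular_part_tendsto)
    then show "ennreal (gauss \<sigma> k * kappa k) = liminf (\<lambda>m. ennreal (gauss \<sigma> k * regular_part (rr m) k))"
      by (intro lim_imp_Liminf[symmetric]) auto
  qed
  also have "\<dots> \<le> liminf (\<lambda>m. \<integral>\<^sup>+k. ennreal (gauss \<sigma> k * regular_part (rr m) k) \<partial>lborel)"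
    by (intro nn_integral_liminf) measurable
  also have "\<dots> \<le> liminf (\<lambda>m::nat. ennreal (\<Psi> \<sigma> 0))"
  proof (intro Liminf_mono always_eventually allI)
    fix m
    have "(\<integral>\<^sup>+k. ennreal (gauss \<sigma> k * regular_part (rr m) k) \<partial>lborel) \<le> (\<integral>\<^sup>+k. ennreal (gauss \<sigma> k * abel (rr m) k) \<partial>lborel)"
      using rr[of m] unfolding abel_split
      by (intro nn_integral_mono ennreal_leI mult_left_mono) (auto intro: peak_part_nonneg less_imp_le gauss_pos)
    also have "\<dots> = ennreal ((LINT k|lborel. gauss \<sigma> k * abel (rr m) k))"
      using integrable_abel[OF \<sigma>] gauss_pos abel_nonneg
      by (intro nn_integral_eq_integral AE_I2 mult_nonneg_nonneg) (auto intro: less_imp_le)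
    also have "\<dots> \<le> ennreal (\<Psi> \<sigma> 0)"
      by (intro ennreal_leI integral_abel_le \<sigma>)
    finally show "(\<integral>\<^sup>+k. ennreal (gauss \<sigma> k * regular_part (rr m) k) \<partial>lborel) \<le> ennreal (\<Psi> \<sigma> 0)" .
  qed
  also have "\<dots> < \<infinity>"
    by (simp add: Liminf_const)
  finally show "(\<integral>\<^sup>+k. ennreal (gauss \<sigma> k * kappa k) \<partial>lborel) < \<infinity>" .
qed simp

text \<open>The contribution of the pure point part, which remains to be identified.\<close>
definition \<Lambda> :: "real \<Rightarrow> real \<Rightarrow> complex" where
  "\<Lambda> \<sigma> y = of_real (\<Psi> \<sigma> y) - (LINT k|lborel. of_real (gauss \<sigma> k * kappa k) * cis (2 * pi * k * y))"

text \<open>The peak part is the Abel density minus the regular part. The former converges to the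
  smoothed \<open>\<gamma>\<close>, the latter by dominated convergence with majorant 4
  \<open>kappa\<close>, so the limit of the peaks exists before it is known what it is.\<close>

lemma
  assumes \<sigma>: "0 < \<sigma>"
  shows integrable_peak: "integrable lborel (\<lambda>k. of_real (gauss \<sigma> k * peak_part (rr m) k) * cis (2 * pi * k * y))"
    and peak_tendsto: "(\<lambda>m. (LINT k|lborel. of_real (gauss \<sigma> k * peak_part (rr m) k) * cis (2 * pi * k * y))) \<longlonglongrightarrow> \<Lambda> \<sigma> y"
proof -
  have dom: "integrable lborel (\<lambda>k. 4 * (gauss \<sigma> k * kappa k))"
    using integrable_kappa_gaussian[OF \<sigma>] by simp
  have le: "norm (of_real (gauss \<sigma> k * regular_part (rr m) k) * cis (2 * pi * k * y)) \<le> 4 * (gauss \<sigma> k * kappa k)" for m k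
    using mult_left_mono[OF regular_part_le, of "rr m" "gauss \<sigma> k" k] rr[of m]
      regular_part_nonneg[of "rr m" k] gauss_pos[of \<sigma> k]
    by (simp add: norm_mult)
  have reg: "integrable lborel (\<lambda>k. of_real (gauss \<sigma> k * regular_part (rr m) k) * cis (2 * pi * k * y))" for m
  proof (rule Bochner_Integration.integrable_bound[OF dom])
    show "AE k in lborel. norm (of_real (gauss \<sigma> k * regular_part (rr m) k) * cis (2 * pi * k * y)) \<le> norm (4 * (gauss \<sigma> k * kappa k))"
      using order_trans[OF le abs_ge_self] by (intro AE_I2) (simp only: real_norm_def)
  qed measurable
  have split: "of_real (gauss \<sigma> k * peak_part (rr m) k) * cis (2 * pi * k * y)
      = of_real (gauss \<sigma> k * abel (rr m) k) * cis (2 * pi * k * y) - of_real (gauss \<sigma> k * regular_part (rr m) k) * cis (2 * pi * k * y)" for k m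
    by (simp add: abel_split algebra_simps)
  note ab = abel_parseval(2)[OF rr \<sigma>]
  show "integrable lborel (\<lambda>k. of_real (gauss \<sigma> k * peak_part (rr m) k) * cis (2 * pi * k * y))"
    unfolding split by (intro Bochner_Integration.integrable_diff ab reg)
  have "(\<lambda>m. (LINT k|lborel. of_real (gauss \<sigma> k * regular_part (rr m) k) * cis (2 * pi * k * y)))
      \<longlonglongrightarrow> (LINT k|lborel. of_real (gauss \<sigma> k * kappa k) * cis (2 * pi * k * y))"
  proof (rule integral_dominated_convergence[OF _ _ dom])
    show "AE k in lborel. (\<lambda>m. of_real (gauss \<sigma> k * regular_part (rr m) k) * cis (2 * pi * k * y))
        \<longlonglongrightarrow> of_real (gauss \<sigma> k * kappa k) * cis (2 * pi * k * y)"
      by (intro AE_I2 tendsto_mult tendsto_of_real tendsto_const regular_part_tendsto)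
  qed (use le in auto)
  then show "(\<lambda>m. (LINT k|lborel. of_real (gauss \<sigma> k * peak_part (rr m) k) * cis (2 * pi * k * y))) \<longlonglongrightarrow> \<Lambda> \<sigma> y"
    unfolding split Bochner_Integration.integral_diff[OF ab reg] \<Lambda>_def
    by (intro tendsto_diff abel_gaussian_tendsto \<sigma>)
qed

end

section \<open>Concentration of the Abel kernels at the peaks\<close>

lemma has_bochner_integral_inverse_1_plus_square:
  "has_bochner_integral lborel (\<lambda>v::real. inverse (1 + v\<^sup>2)) pi"
proof -
  have "integrable lborel (\<lambda>v::real. inverse (1 + v\<^sup>2))"
    using integrable_inverse_1_plus_square by (simp add: set_integrable_def einterval_eq)
  moreover have "integral\<^sup>L lborel (\<lambda>v::real. inverse (1 + v\<^sup>2)) = pi"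
    using LBINT_inverse_1_plus_square by (simp add: interval_lebesgue_integral_def set_lebesgue_integral_def einterval_eq)
  ultimately show ?thesis by (simp add: has_bochner_integral_iff)
qed

text \<open>The integrand is the limiting profile of a rescaled peak; its mass 1 is the weight of
  each atom.\<close>

lemma integral_cauchy_density: "(LINT v|lborel. 2 / (1 + (2 * pi * v)\<^sup>2)) = 1"
proof -
  have "has_bochner_integral lborel (\<lambda>v. inverse (1 + (0 + 2 * pi * v)\<^sup>2)) (pi /\<^sub>R \<bar>2 * pi\<bar>)"
    using has_bochner_integral_inverse_1_plus_square
    by (subst (asm) lborel_has_bochner_integral_real_affine_iff[of "2 * pi" _ _ 0]) auto
  from has_bochner_integral_integral_eq[OF has_bochner_integral_mult_right[OF this, of 2]]
  have "(LINT v|lborel. 2 * inverse (1 + (2 * pi * v)\<^sup>2)) = 2 * (pi /\<^sub>R \<bar>2 * pi\<bar>)"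
    by (simp only: add_0)
  also have "2 * (pi /\<^sub>R \<bar>2 * pi\<bar>) = 1"
    by simp
  finally show ?thesis
    by (simp only: divide_inverse)
qed

context waiting_law
begin

definition aa :: "nat \<Rightarrow> real" where
  "aa m = 1 / real (m + 2)"

lemma aa: "0 < aa m" "1 - rr m = aa m"
  by (simp_all add: aa_def rr_def)

lemma aa_tendsto: "aa \<longlonglongrightarrow> 0"
  unfolding aa_def[abs_def] by (intro LIMSEQ_ignore_initial_segment lim_1_over_n)

text \<open>Under \<open>k = z + (1 - r) v\<close> the peak at \<open>z\<close> turns into the Cauchy density in the limit,
  because \<open>w u = 1 - 2 \<pi> i u + o(u)\<close>.\<close>
lemma peak_local:
  fixes f :: "real \<Rightarrow> complex"
  assumes z: "z \<in> Z" and cont: "isCont f z" and f [measurable]: "f \<in> borel_measurable borel"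
    and bound: "\<And>k. norm (f k) \<le> C"
  shows "(\<lambda>m. (LINT k|lborel. indicator (ball z (gap / 2)) k *\<^sub>R (of_real (peak_part (rr m) k) * f k))) \<longlonglongrightarrow> f z"
proof -
  have C0: "0 \<le> C"
    using bound[of 0] norm_ge_zero order_trans by blast
  define d where "d = gap / 2"
  have d: "0 < d" "d < gap"
    using gap_pos by (auto simp: d_def)
  define F where "F m k = indicator (ball z d) k *\<^sub>R (of_real (peak_part (rr m) k) * f k)" for m k
  define s where "s m v = aa m *\<^sub>R F m (z + aa m * v)" for m v
  have [measurable]: "ball z d \<in> sets borel"
    by simp
  have Fm [measurable]: "F m \<in> borel_measurable borel" for m
    unfolding F_def[abs_def] by measurable
  have eq: "integral\<^sup>L lborel (F m) = integral\<^sup>L lborel (s m)" for m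
    using lborel_integral_real_affine[of "aa m" "F m" z] aa(1)[of m] by (simp add: s_def[abs_def])
  define q where "q m v = aa m * peak_part (rr m) (z + aa m * v)" for m v
  have s_eq: "s m v = indicator (ball z d) (z + aa m * v) *\<^sub>R (of_real (q m v) * f (z + aa m * v))" for m v
    by (simp only: s_def F_def q_def scaleR_conv_of_real of_real_mult mult_ac)
  \<comment> \<open>Periodicity of \<open>w\<close> moves the peak to the origin.\<close>
  have q_eq: "q m v = aa m * (1 - (rr m)\<^sup>2) / (cmod (1 - of_real (rr m) * w (aa m * v)))\<^sup>2" for m v
    unfolding q_def peak_part_def Z_shift[OF z] by simp
  have fac: "aa m * (1 - (rr m)\<^sup>2) = (aa m)\<^sup>2 * (1 + rr m)" for m
    unfolding aa(2)[symmetric] by (simp add: power2_eq_square algebra_simps)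
  have av: "(\<lambda>m. aa m * v) \<longlonglongrightarrow> 0" for v
    using tendsto_mult[OF aa_tendsto tendsto_const[of v]] by simp
  have quot: "(\<lambda>m. (1 - w (aa m * v)) / of_real (aa m)) \<longlonglongrightarrow> 2 * pi * \<i> * of_real v" for v
  proof (cases "v = 0")
    case False
    have "filterlim (\<lambda>m. aa m * v) (at 0) sequentially"
      using av[of v] aa(1) False by (auto simp: filterlim_at intro!: always_eventually) (metis less_irrefl)
    from filterlim_compose[OF w_diff_quotient this]
    have "(\<lambda>m. (1 - w (aa m * v)) / of_real (aa m * v)) \<longlonglongrightarrow> 2 * pi * \<i>" .
    from tendsto_mult[OF this tendsto_const[of "of_real v"]] show ?thesis
      using False by simp
  qed simp
  have q_lim: "(\<lambda>m. q m v) \<longlonglongrightarrow> 2 / (1 + (2 * pi * v)\<^sup>2)" for v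
  proof -
    \<comment> \<open>\<open>D\<close> is (1 - r w) / (1 - r), obtained from 1 - r w = (1 - r) + r
      (1 - w). By the difference quotient of \<open>w\<close> it tends to 1 + 2 pi i v.\<close>
    define D where "D m = 1 + of_real (rr m) * ((1 - w (aa m * v)) / of_real (aa m))" for m
    have D: "D \<longlonglongrightarrow> 1 + of_real 1 * (2 * pi * \<i> * of_real v)"
      unfolding D_def[abs_def] by (intro tendsto_intros rr_tendsto quot)
    have norm_lim: "cmod (1 + of_real 1 * (2 * pi * \<i> * of_real v)) ^ 2 = 1 + (2 * pi * v)\<^sup>2"
      by (simp add: cmod_power2)
    have "(\<lambda>m. (1 + rr m) / (cmod (D m))\<^sup>2) \<longlonglongrightarrow> (1 + 1) / (cmod (1 + of_real 1 * (2 * pi * \<i> * of_real v)))\<^sup>2"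
    proof (intro tendsto_intros rr_tendsto D)
      show "(cmod (1 + of_real 1 * (2 * pi * \<i> * of_real v)))\<^sup>2 \<noteq> 0"
        unfolding norm_lim using zero_le_power2[of "2 * pi * v"] by linarith
    qed
    moreover have "q m v = (1 + rr m) / (cmod (D m))\<^sup>2" for m
    proof -
      have "1 - of_real (rr m) * w (aa m * v) = of_real (aa m) * D m"
      proof -
        have "of_real (aa m) * D m = of_real (aa m) + of_real (rr m) * (1 - w (aa m * v))"
          using aa(1)[of m] by (simp add: D_def distrib_left)
        also have "\<dots> = of_real (aa m + rr m) - of_real (rr m) * w (aa m * v)"
          by (simp add: right_diff_distrib)
        also have "aa m + rr m = 1"
          using aa(2)[of m] by simp
        finally show ?thesis by simp
      qed
      then have "(cmod (1 - of_real (rr m) * w (aa m * v)))\<^sup>2 = (aa m)\<^sup>2 * (cmod (D m))\<^sup>2"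
        by (simp add: norm_mult power_mult_distrib)
      then show ?thesis
        unfolding q_eq fac using aa(1)[of m] by simp
    qed
    ultimately show ?thesis
      unfolding norm_lim by simp
  qed
  \<comment> \<open>In the ball |1 - r w| is at least 1 - r and at least (1 - r) |v| / 2. Adding the
    first square to four times the second gives (1 - r)^2 (1 + v^2) \<le> 5 |1 - r w|^2, and 1 - r^2
    = (1 - r) (1 + r) with 1 + r \<le> 2 turns the 5 into 10.\<close>
  have q_bound: "q m v \<le> 10 / (1 + v\<^sup>2)" if "\<bar>aa m * v\<bar> < d" for m v
  proof -
    let ?D = "cmod (1 - of_real (rr m) * w (aa m * v))"
    have r: "0 \<le> rr m" "rr m \<le> 1" using rr[of m] by auto
    have D1: "aa m \<le> ?D"
      using abel_denominator(1)[OF r, of "aa m * v"] by (simp add: aa(2))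
    have "\<bar>aa m * v\<bar> \<le> cmod (1 - w (aa m * v))"
      using that d by (intro gap) auto
    then have D2: "aa m * \<bar>v\<bar> / 2 \<le> ?D"
      using abel_denominator(2)[OF r, of "aa m * v"] aa(1)[of m] by (simp add: abs_mult)
    have "(aa m)\<^sup>2 * (1 + v\<^sup>2) \<le> 5 * ?D\<^sup>2"
    proof -
      have "(aa m)\<^sup>2 \<le> ?D\<^sup>2"
        using D1 aa(1)[of m] by (intro power_mono) auto
      moreover have "(aa m * \<bar>v\<bar> / 2)\<^sup>2 \<le> ?D\<^sup>2"
        using D2 aa(1)[of m] by (intro power_mono) auto
      ultimately show ?thesis
        by (simp add: power_mult_distrib power_divide distrib_left)
    qed
    then have "(aa m)\<^sup>2 * (1 + rr m) * (1 + v\<^sup>2) \<le> 10 * ?D\<^sup>2"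
      using mult_mono[of "(aa m)\<^sup>2 * (1 + v\<^sup>2)" "5 * ?D\<^sup>2" "1 + rr m" 2] r by (simp add: mult_ac)
    moreover have "0 < ?D\<^sup>2"
      using D1 aa(1)[of m] by (intro zero_less_power) linarith
    moreover have "0 < 1 + v\<^sup>2"
      by (simp add: add_pos_nonneg)
    ultimately show ?thesis
      unfolding q_eq fac by (simp add: divide_le_eq le_divide_eq mult_ac)
  qed
  have q0: "0 \<le> q m v" for m v
    unfolding q_def using aa(1)[of m] rr[of m] by (intro mult_nonneg_nonneg peak_part_nonneg) auto
  have "(\<lambda>m. integral\<^sup>L lborel (s m)) \<longlonglongrightarrow> (LINT v|lborel. of_real (2 / (1 + (2 * pi * v)\<^sup>2)) * f z)"
  proof (rule integral_dominated_convergence)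
    show "integrable lborel (\<lambda>v. 10 * C * inverse (1 + v\<^sup>2))"
      using has_bochner_integral_inverse_1_plus_square by (intro integrable_mult_right) (simp add: has_bochner_integral_iff)
    show "AE v in lborel. norm (s m v) \<le> 10 * C * inverse (1 + v\<^sup>2)" for m
    proof (rule AE_I2)
      fix v
      show "norm (s m v) \<le> 10 * C * inverse (1 + v\<^sup>2)"
      proof (cases "z + aa m * v \<in> ball z d")
        case True
        then have "\<bar>aa m * v\<bar> < d" by (simp add: dist_real_def)
        have "norm (s m v) = q m v * norm (f (z + aa m * v))"
          using True q0[of m v] by (simp add: s_eq norm_mult)
        also have "\<dots> \<le> 10 / (1 + v\<^sup>2) * C"
          using q_bound[OF \<open>\<bar>aa m * v\<bar> < d\<close>] by (intro mult_mono bound) (auto simp: add_nonneg_nonneg)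
        finally show ?thesis
          by (simp add: divide_inverse mult_ac)
      next
        case False
        then show ?thesis using C0 by (simp add: s_eq add_nonneg_nonneg)
      qed
    qed
    show "AE v in lborel. (\<lambda>m. s m v) \<longlonglongrightarrow> of_real (2 / (1 + (2 * pi * v)\<^sup>2)) * f z"
    proof (rule AE_I2)
      fix v
      have lim: "(\<lambda>m. z + aa m * v) \<longlonglongrightarrow> z"
        using tendsto_add[OF tendsto_const[of z] av[of v]] by simp
      have "(\<lambda>m. of_real (q m v) * f (z + aa m * v)) \<longlonglongrightarrow> of_real (2 / (1 + (2 * pi * v)\<^sup>2)) * f z"
        by (intro tendsto_mult tendsto_of_real q_lim isCont_tendsto_compose[OF cont lim])
      moreover have "\<forall>\<^sub>F m in sequentially. of_real (q m v) * f (z + aa m * v) = s m v"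
        using tendstoD[OF lim d(1)] by eventually_elim (simp add: s_eq dist_commute)
      ultimately show "(\<lambda>m. s m v) \<longlonglongrightarrow> of_real (2 / (1 + (2 * pi * v)\<^sup>2)) * f z"
        by (rule Lim_transform_eventually)
    qed
    show "s m \<in> borel_measurable lborel" for m
      unfolding s_def[abs_def] by measurable
  qed simp
  also have "(LINT v|lborel. of_real (2 / (1 + (2 * pi * v)\<^sup>2)) * f z) = f z"
    unfolding integral_mult_left_zero integral_complex_of_real integral_cauchy_density by simp
  finally show ?thesis
    unfolding eq[symmetric] F_def d_def .
qed

end

context renewal_sums
begin

text \<open>Of the two equal factors one is small outside a window, while the other keeps the Abel
  density integrable there.\<close>

lemma gauss_split:
  "gauss \<sigma> k = gauss (\<sigma> / sqrt 2) k * gauss (\<sigma> / sqrt 2) k"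
proof -
  have "(\<sigma> / sqrt 2 * k)\<^sup>2 = (\<sigma> * k)\<^sup>2 / 2"
    by (simp add: power_mult_distrib power_divide)
  then show ?thesis
    unfolding gauss_def mult_exp_exp by simp
qed

lemma isCont_gaussian_cis: "isCont (\<lambda>k. of_real (gauss \<sigma> k) * cis (2 * pi * k * y)) z"
  unfolding gauss_def cis_conv_exp by (intro continuous_intros) simp_all

text \<open>The line is cut into balls around the finitely many peaks in the window, the rest of the
  window, and the outside. The balls yield the sum, the rest tends to 0 with 1 - r^2, and the
  outside is bounded uniformly in r by \<open>gauss_split\<close> and
  \<open>integral_abel_le\<close>.\<close>

lemma peaks_in_window:
  assumes \<sigma>: "0 < \<sigma>" and R: "0 \<le> R"
  shows "norm (\<Lambda> \<sigma> y - (\<Sum>z\<in>Z \<inter> {-R..R}. of_real (gauss \<sigma> z) * cis (2 * pi * z * y)))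
    \<le> gauss (\<sigma> / sqrt 2) R * \<Psi> (\<sigma> / sqrt 2) 0"
proof -
  define f where "f k = of_real (gauss \<sigma> k) * cis (2 * pi * k * y)" for k
  have f_meas [measurable]: "f \<in> borel_measurable borel"
    unfolding f_def[abs_def] by measurable
  have f_norm: "norm (f k) = gauss \<sigma> k" for k
    using gauss_pos[of \<sigma> k] by (simp add: f_def norm_mult)
  define ZR where "ZR = Z \<inter> {-R..R}"
  have fin: "finite ZR"
    unfolding ZR_def by (rule finite_Z_bounded) simp
  define B where "B z = ball z (gap / 2)" for z :: real
  define K where "K = {-R..R} - (\<Union>z\<in>ZR. B z)"
  \<comment> \<open>Balls around peaks near the ends may reach beyond the window; they are taken out
    of \<open>T\<close> so that the pieces form a partition.\<close>
  define T where "T = - ({-R..R} \<union> (\<Union>z\<in>ZR. B z))"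
  have [measurable]: "B z \<in> sets borel" "K \<in> sets borel" "T \<in> sets borel" for z
    unfolding B_def K_def T_def using fin by (auto intro!: sets.Diff sets.finite_UN)
  have part: "(\<Sum>z\<in>ZR. indicator (B z) k) + indicator K k + indicator T k = (1::real)" for k
  proof -
    have "(\<Sum>z\<in>ZR. indicator (B z) k) = (indicator (\<Union>z\<in>ZR. B z) k :: real)"
    proof (rule indicator_UN_disjoint[OF fin, symmetric])
      show "disjoint_family_on B ZR"
        unfolding disjoint_family_on_def
      proof (intro ballI impI)
        fix z z' assume zz: "z \<in> ZR" "z' \<in> ZR" "z \<noteq> z'"
        show "B z \<inter> B z' = {}"
        proof (rule ccontr)
          assume "B z \<inter> B z' \<noteq> {}"
          then obtain k where "\<bar>z - k\<bar> < gap / 2" "\<bar>z' - k\<bar> < gap / 2"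
            by (auto simp: B_def dist_real_def)
          then have "\<bar>z - z'\<bar> < gap" by linarith
          with Z_separated zz show False by (auto simp: ZR_def)
        qed
      qed
    qed
    then show ?thesis
      by (auto simp: K_def T_def split: split_indicator)
  qed
  define pk where "pk m k = of_real (peak_part (rr m) k) * f k" for m k
  have pk_int: "integrable lborel (pk m)" for m
    using integrable_peak[OF \<sigma>, of m y] by (simp add: pk_def[abs_def] f_def mult_ac)
  have pk_norm: "norm (pk m k) = peak_part (rr m) k * gauss \<sigma> k" for m k
    using peak_part_nonneg[of "rr m" k] rr[of m] by (simp add: pk_def norm_mult f_norm)
  have pk_ind: "integrable lborel (\<lambda>k. indicator A k *\<^sub>R pk m k)" if "A \<in> sets borel" for A m
    using integrable_mult_indicator[OF _ pk_int] that by simp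
  define IB where "IB m = (\<Sum>z\<in>ZR. (LINT k|lborel. indicator (B z) k *\<^sub>R pk m k))" for m
  define IK where "IK m = (LINT k|lborel. indicator K k *\<^sub>R pk m k)" for m
  define IT where "IT m = (LINT k|lborel. indicator T k *\<^sub>R pk m k)" for m
  have decomp: "integral\<^sup>L lborel (pk m) = IB m + IK m + IT m" for m
  proof -
    have "pk m k = (\<Sum>z\<in>ZR. indicator (B z) k *\<^sub>R pk m k) + indicator K k *\<^sub>R pk m k + indicator T k *\<^sub>R pk m k" for k
      unfolding scaleR_left.sum[symmetric] scaleR_left_distrib[symmetric] part by simp
    then have "integral\<^sup>L lborel (pk m) = (LINT k|lborel. (\<Sum>z\<in>ZR. indicator (B z) k *\<^sub>R pk m k) + indicator K k *\<^sub>R pk m k + indicator T k *\<^sub>R pk m k)"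
      by (intro Bochner_Integration.integral_cong refl)
    also have "\<dots> = IB m + IK m + IT m"
      unfolding IB_def IK_def IT_def
      by (subst Bochner_Integration.integral_add Bochner_Integration.integral_sum; (intro Bochner_Integration.integrable_add Bochner_Integration.integrable_sum pk_ind)?; measurable?)+
    finally show ?thesis .
  qed
  have "IB \<longlonglongrightarrow> (\<Sum>z\<in>ZR. f z)"
    unfolding IB_def[abs_def] pk_def B_def
  proof (intro tendsto_sum peak_local)
    fix z assume "z \<in> ZR"
    then show "z \<in> Z" by (simp add: ZR_def)
    show "isCont f z" unfolding f_def[abs_def] by (rule isCont_gaussian_cis)
    show "norm (f k) \<le> 1" for k using gauss_le_1 by (simp add: f_norm)
  qed measurable
  moreover have "IK \<longlonglongrightarrow> 0"
  proof -
    have "compact K"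
      unfolding K_def by (intro compact_diff) (auto simp: B_def)
    \<comment> \<open>On the compact set \<open>K\<close> the continuous function |1 - w| attains
      its minimum, and this is positive because every zero in the window was removed together with
      its ball.\<close>
    have "\<exists>c>0. \<forall>k\<in>K. c \<le> cmod (1 - w k)"
    proof (cases "K = {}")
      case False
      have "continuous_on K (\<lambda>k. cmod (1 - w k))"
        by (intro continuous_intros continuous_at_imp_continuous_on ballI isCont_w)
      then obtain k0 where k0: "k0 \<in> K" "\<And>k. k \<in> K \<Longrightarrow> cmod (1 - w k0) \<le> cmod (1 - w k)"
        using continuous_attains_inf[OF \<open>compact K\<close> False] by blast
      have "k0 \<notin> Z"
      proof
        assume "k0 \<in> Z"
        moreover have "k0 \<in> B k0" using gap_pos by (simp add: B_def)
        ultimately show False using k0(1) by (auto simp: K_def ZR_def)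
      qed
      then have "0 < cmod (1 - w k0)" by (simp add: Z_def)
      with k0 show ?thesis by blast
    qed (auto intro: exI[of _ 1])
    then obtain c where c: "c > 0" "\<And>k. k \<in> K \<Longrightarrow> c \<le> cmod (1 - w k)" by blast
    have "norm (IK m) \<le> 4 * (1 - (rr m)\<^sup>2) / c\<^sup>2 * integral\<^sup>L lborel (gauss \<sigma>)" for m
    proof -
      have "norm (IK m) \<le> (LINT k|lborel. norm (indicator K k *\<^sub>R pk m k))"
        unfolding IK_def by (rule integral_norm_bound)
      also have "\<dots> \<le> (LINT k|lborel. 4 * (1 - (rr m)\<^sup>2) / c\<^sup>2 * gauss \<sigma> k)"
      proof (rule integral_mono)
        show "integrable lborel (\<lambda>k. norm (indicator K k *\<^sub>R pk m k))"
          by (intro integrable_norm pk_ind) measurable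
        show "integrable lborel (\<lambda>k. 4 * (1 - (rr m)\<^sup>2) / c\<^sup>2 * gauss \<sigma> k)"
          by (intro integrable_mult_right integrable_gauss \<sigma>)
        fix k
        have r: "0 \<le> 1 - (rr m)\<^sup>2" "0 \<le> rr m" "rr m \<le> 1"
          using rr[of m] by (auto simp: power_le_one)
        show "norm (indicator K k *\<^sub>R pk m k) \<le> 4 * (1 - (rr m)\<^sup>2) / c\<^sup>2 * gauss \<sigma> k"
        proof (cases "k \<in> K")
          case True
          then have wk: "w k \<noteq> 1" using c by force
          then have "peak_part (rr m) k \<le> 4 * (1 - (rr m)\<^sup>2) / (cmod (1 - w k))\<^sup>2"
            by (rule peak_part_le[OF r(2,3)])
          also have "\<dots> \<le> 4 * (1 - (rr m)\<^sup>2) / c\<^sup>2"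
            using r c True wk by (intro divide_left_mono power_mono mult_pos_pos zero_less_power) auto
          finally have "peak_part (rr m) k * gauss \<sigma> k \<le> 4 * (1 - (rr m)\<^sup>2) / c\<^sup>2 * gauss \<sigma> k"
            by (rule mult_right_mono) (rule less_imp_le[OF gauss_pos])
          then show ?thesis
            using True by (simp only: norm_scaleR pk_norm indicator_simps abs_one mult_1)
        next
          case False
          have "0 \<le> 4 * (1 - (rr m)\<^sup>2) / c\<^sup>2 * gauss \<sigma> k"
            using r(1) by (intro mult_nonneg_nonneg divide_nonneg_nonneg less_imp_le[OF gauss_pos]) auto
          moreover have "indicator K k *\<^sub>R pk m k = 0" using False by simp
          ultimately show ?thesis by (simp only: norm_zero)
        qed
      qed
      finally show ?thesis by simp
    qed
    then have "\<forall>\<^sub>F m in sequentially. norm (IK m) \<le> 4 * (1 - (rr m)\<^sup>2) / c\<^sup>2 * integral\<^sup>L lborel (gauss \<sigma>)"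
      by (rule always_eventually[OF allI])
    moreover have "(\<lambda>m. 4 * (1 - (rr m)\<^sup>2) / c\<^sup>2 * integral\<^sup>L lborel (gauss \<sigma>)) \<longlonglongrightarrow> 4 * (1 - 1\<^sup>2) / c\<^sup>2 * integral\<^sup>L lborel (gauss \<sigma>)"
      by (intro tendsto_mult tendsto_divide tendsto_diff tendsto_power tendsto_const rr_tendsto) (use c in simp)
    then have "(\<lambda>m. 4 * (1 - (rr m)\<^sup>2) / c\<^sup>2 * integral\<^sup>L lborel (gauss \<sigma>)) \<longlonglongrightarrow> 0"
      by simp
    ultimately show ?thesis
      by (rule Lim_null_comparison)
  qed
  moreover have "(\<lambda>m. integral\<^sup>L lborel (pk m)) \<longlonglongrightarrow> \<Lambda> \<sigma> y"
    using peak_tendsto[OF \<sigma>, of y] by (simp add: pk_def[abs_def] f_def mult_ac)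
  ultimately have "(\<lambda>m. integral\<^sup>L lborel (pk m) - IB m - IK m) \<longlonglongrightarrow> \<Lambda> \<sigma> y - (\<Sum>z\<in>ZR. f z) - 0"
    by (intro tendsto_diff)
  then have lim: "IT \<longlonglongrightarrow> \<Lambda> \<sigma> y - (\<Sum>z\<in>ZR. f z)"
    by (simp add: decomp)
  have "norm (IT m) \<le> gauss (\<sigma> / sqrt 2) R * \<Psi> (\<sigma> / sqrt 2) 0" for m
  proof -
    let ?\<tau> = "\<sigma> / sqrt 2"
    have \<tau>: "0 < ?\<tau>" using \<sigma> by simp
    have "norm (IT m) \<le> (LINT k|lborel. norm (indicator T k *\<^sub>R pk m k))"
      unfolding IT_def by (rule integral_norm_bound)
    also have "\<dots> \<le> (LINT k|lborel. gauss ?\<tau> R * (gauss ?\<tau> k * abel (rr m) k))"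
    proof (rule integral_mono)
      show "integrable lborel (\<lambda>k. norm (indicator T k *\<^sub>R pk m k))"
        by (intro integrable_norm pk_ind) measurable
      show "integrable lborel (\<lambda>k. gauss ?\<tau> R * (gauss ?\<tau> k * abel (rr m) k))"
        by (intro integrable_mult_right integrable_abel \<tau>)
      fix k
      show "norm (indicator T k *\<^sub>R pk m k) \<le> gauss ?\<tau> R * (gauss ?\<tau> k * abel (rr m) k)"
      proof (cases "k \<in> T")
        case True
        then have "R \<le> \<bar>k\<bar>" by (auto simp: T_def)
        then have "R\<^sup>2 \<le> k\<^sup>2"
          using R power_mono[of R "\<bar>k\<bar>" 2] by simp
        then have "(?\<tau> * R)\<^sup>2 \<le> (?\<tau> * k)\<^sup>2"
          unfolding power_mult_distrib by (rule mult_left_mono) simp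
        then have "gauss ?\<tau> k \<le> gauss ?\<tau> R"
          by (simp add: gauss_def)
        moreover have "peak_part (rr m) k \<le> abel (rr m) k"
          using regular_part_nonneg by (simp add: abel_split)
        ultimately have "gauss ?\<tau> k * (gauss ?\<tau> k * peak_part (rr m) k) \<le> gauss ?\<tau> R * (gauss ?\<tau> k * abel (rr m) k)"
          using rr[of m] by (intro mult_mono mult_nonneg_nonneg peak_part_nonneg order_refl less_imp_le[OF gauss_pos]) auto
        then show ?thesis
          using True by (simp only: norm_scaleR pk_norm indicator_simps abs_one mult_1 gauss_split[of \<sigma>] mult_ac)
      next
        case False
        have "0 \<le> gauss ?\<tau> R * (gauss ?\<tau> k * abel (rr m) k)"
          by (intro mult_nonneg_nonneg abel_nonneg less_imp_le[OF gauss_pos])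
        moreover have "indicator T k *\<^sub>R pk m k = 0" using False by simp
        ultimately show ?thesis by (simp only: norm_zero)
      qed
    qed
    also have "\<dots> = gauss ?\<tau> R * (LINT k|lborel. gauss ?\<tau> k * abel (rr m) k)"
      by (rule integral_mult_right_zero)
    also have "\<dots> \<le> gauss ?\<tau> R * \<Psi> ?\<tau> 0"
      using gauss_pos[of ?\<tau> R] by (intro mult_left_mono integral_abel_le \<tau>) auto
    finally show ?thesis .
  qed
  then have "norm (\<Lambda> \<sigma> y - (\<Sum>z\<in>ZR. f z)) \<le> gauss (\<sigma> / sqrt 2) R * \<Psi> (\<sigma> / sqrt 2) 0"
    by (intro tendsto_upperbound[OF tendsto_norm[OF lim] always_eventually[OF allI]]) simp_all
  then show ?thesis
    by (simp add: ZR_def f_def)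
qed

end

section \<open>Summation over \<open>Z\<close> and the diffraction measure\<close>

lemma has_bochner_integral_count_space_finite:
  fixes f :: "'b \<Rightarrow> 'c::{banach, second_countable_topology}"
  assumes "finite F" "F \<subseteq> A"
  shows "has_bochner_integral (count_space A) (\<lambda>z. indicator F z *\<^sub>R f z) (\<Sum>z\<in>F. f z)"
proof -
  have one: "has_bochner_integral (count_space A) (\<lambda>z. indicator {v} z *\<^sub>R f v) (f v)" if "v \<in> F" for v
    using has_bochner_integral_indicator[of "{v}" "count_space A" "f v"] that assms(2)
    by (auto simp: emeasure_count_space_finite measure_def)
  have "has_bochner_integral (count_space A) (\<lambda>z. \<Sum>v\<in>F. indicator {v} z *\<^sub>R f v) (\<Sum>z\<in>F. f z)"
    by (intro has_bochner_integral_sum one)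
  moreover have "(\<Sum>v\<in>F. indicator {v} z *\<^sub>R f v) = indicator F z *\<^sub>R f z" for z
  proof -
    have "(\<Sum>v\<in>F. indicator {v} z *\<^sub>R f v) = (\<Sum>v\<in>F. if v = z then f v else 0)"
      by (intro sum.cong) auto
    then show ?thesis using assms(1) by (simp add: sum.delta)
  qed
  ultimately show ?thesis by simp
qed

lemma sigma_finite_if_locally_finite:
  assumes "locally_finite_borel \<nu>" shows "sigma_finite_measure \<nu>"
proof
  have sets: "sets \<nu> = sets borel" and fin: "\<And>K. compact K \<Longrightarrow> emeasure \<nu> K < \<infinity>"
    using assms by (auto simp: locally_finite_borel_def)
  have space: "space \<nu> = UNIV"
    using sets_eq_imp_space_eq[OF sets] by simp
  have cover: "(\<Union>n::nat. {-real n..real n}) = UNIV"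
  proof (intro equalityI subsetI UNIV_I)
    fix x :: real
    obtain n :: nat where "\<bar>x\<bar> \<le> real n" using real_arch_simple by blast
    then have "x \<in> {-real n..real n}" by auto
    then show "x \<in> (\<Union>n::nat. {-real n..real n})" by blast
  qed
  have "emeasure \<nu> {-real n..real n} \<noteq> \<infinity>" for n
    using fin[OF compact_Icc, of "-real n" "real n"] by simp
  then show "\<exists>A. countable A \<and> A \<subseteq> sets \<nu> \<and> \<Union> A = space \<nu> \<and> (\<forall>a\<in>A. emeasure \<nu> a \<noteq> \<infinity>)"
    using cover by (intro exI[of _ "range (\<lambda>n::nat. {-real n..real n})"]) (simp add: sets space image_subset_iff)
qed

text \<open>By |v| \<le> 1 + v^2 / 4 half of the Gaussian exponent absorbs exp |v|. This is the
  majorant, independent of \<sigma>, for the mollification.\<close>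

lemma integrable_exp_abs_std_normal: "integrable lborel (\<lambda>v. exp \<bar>v\<bar> * std_normal_density v)"
proof (rule Bochner_Integration.integrable_bound)
  show "integrable lborel (\<lambda>v. exp 1 * (1 / sqrt (2 * pi)) * gauss (1 / sqrt 2) v)"
    by (intro integrable_mult_right integrable_gauss) simp
  have "\<bar>v\<bar> + (- v\<^sup>2 / 2) \<le> 1 + - (1 / sqrt 2 * v)\<^sup>2 / 2" for v :: real
  proof -
    have "0 \<le> (\<bar>v\<bar> / 2 - 1)\<^sup>2" by simp
    then show ?thesis
      by (simp add: power2_diff power_divide power_mult_distrib)
  qed
  then have le: "exp \<bar>v\<bar> * exp (- v\<^sup>2 / 2) \<le> exp 1 * gauss (1 / sqrt 2) v" for v
    unfolding gauss_def mult_exp_exp exp_le_cancel_iff .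
  have "exp \<bar>v\<bar> * std_normal_density v \<le> exp 1 * (1 / sqrt (2 * pi)) * gauss (1 / sqrt 2) v" for v
  proof -
    have "(1 / sqrt (2 * pi)) * (exp \<bar>v\<bar> * exp (- v\<^sup>2 / 2)) \<le> (1 / sqrt (2 * pi)) * (exp 1 * gauss (1 / sqrt 2) v)"
      by (intro mult_left_mono le) simp
    then show ?thesis
      unfolding std_normal_density_def by (simp only: mult_ac)
  qed
  moreover have "0 \<le> exp \<bar>v\<bar> * std_normal_density v" for v
    by simp
  ultimately show "AE v in lborel. norm (exp \<bar>v\<bar> * std_normal_density v) \<le> norm (exp 1 * (1 / sqrt (2 * pi)) * gauss (1 / sqrt 2) v)"
    by (intro AE_I2) (metis abs_of_nonneg order_trans real_norm_def)
qed simp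

context renewal_sums
begin

sublocale \<gamma>: sigma_finite_measure \<gamma>
  by (rule sigma_finite_if_locally_finite[OF locally_finite_\<gamma>])

lemma gauss_tendsto_0:
  assumes "0 < \<sigma>" shows "(\<lambda>n. gauss \<sigma> (real n)) \<longlonglongrightarrow> 0"
proof -
  have "filterlim (\<lambda>n. (\<sigma>\<^sup>2 / 2) * (real n)\<^sup>2) at_top sequentially"
    using assms by (intro filterlim_tendsto_pos_mult_at_top[OF tendsto_const] filterlim_pow_at_top filterlim_real_sequentially) auto
  then have "filterlim (\<lambda>n. - ((\<sigma>\<^sup>2 / 2) * (real n)\<^sup>2)) at_bot sequentially"
    by (simp add: filterlim_uminus_at_bot)
  from filterlim_compose[OF exp_at_bot this] show ?thesis
    by (simp add: gauss_def power_mult_distrib)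
qed

lemma peaks_tendsto:
  assumes \<sigma>: "0 < \<sigma>"
  shows "(\<lambda>n. \<Sum>z\<in>Z \<inter> {-real n..real n}. of_real (gauss \<sigma> z) * cis (2 * pi * z * y)) \<longlonglongrightarrow> \<Lambda> \<sigma> y"
proof (rule LIM_zero_cancel, rule Lim_null_comparison)
  let ?s = "\<lambda>n. \<Sum>z\<in>Z \<inter> {-real n..real n}. of_real (gauss \<sigma> z) * cis (2 * pi * z * y)"
  show "\<forall>\<^sub>F n in sequentially. norm (?s n - \<Lambda> \<sigma> y) \<le> gauss (\<sigma> / sqrt 2) (real n) * \<Psi> (\<sigma> / sqrt 2) 0"
    using peaks_in_window[OF \<sigma>, of "real _" y] by (intro always_eventually allI) (simp add: norm_minus_commute)
  have "0 < \<sigma> / sqrt 2" using \<sigma> by simp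
  from tendsto_mult_left_zero[OF gauss_tendsto_0[OF this]]
  show "(\<lambda>n. gauss (\<sigma> / sqrt 2) (real n) * \<Psi> (\<sigma> / sqrt 2) 0) \<longlonglongrightarrow> 0" .
qed

text \<open>At y = 0 the sums over growing windows increase and converge, so monotone convergence
  yields summability of the Gaussian weights over \<open>Z\<close>. With these as majorant, the
  limit for arbitrary y is the full sum.\<close>

lemma
  assumes \<sigma>: "0 < \<sigma>"
  shows integrable_count_Z: "integrable (count_space Z) (gauss \<sigma>)"
    and integral_count_Z: "(LINT z|count_space Z. of_real (gauss \<sigma> z) * cis (2 * pi * z * y)) = \<Lambda> \<sigma> y"
    and integrable_count_Z_cis: "integrable (count_space Z) (\<lambda>z. of_real (gauss \<sigma> z) * cis (2 * pi * z * y))"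
proof -
  define W where "W n = Z \<inter> {-real n..real n}" for n
  have W: "finite (W n)" "W n \<subseteq> Z" for n
    unfolding W_def by (auto intro: finite_Z_bounded)
  have ev: "\<forall>\<^sub>F n in sequentially. z \<in> W n" if "z \<in> Z" for z
    using eventually_ge_at_top[of "nat \<lceil>\<bar>z\<bar>\<rceil>"]
  proof eventually_elim
    case (elim n)
    then have "\<bar>z\<bar> \<le> real n" by linarith
    then show ?case using that by (auto simp: W_def)
  qed
  note fin = has_bochner_integral_count_space_finite[OF W]
  show int: "integrable (count_space Z) (gauss \<sigma>)"
  proof (rule integrable_monotone_convergence[where f = "\<lambda>n z. indicator (W n) z *\<^sub>R gauss \<sigma> z"])
    show "integrable (count_space Z) (\<lambda>z. indicator (W n) z *\<^sub>R gauss \<sigma> z)" for n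
      using fin[of n "gauss \<sigma>"] by (simp only: has_bochner_integral_iff)
    show "AE z in count_space Z. mono (\<lambda>n. indicator (W n) z *\<^sub>R gauss \<sigma> z)"
    proof (intro AE_I2 monoI)
      fix z and m n :: nat assume "m \<le> n"
      then have "indicator (W m) z \<le> (indicator (W n) z :: real)"
        by (auto simp: W_def split: split_indicator)
      then show "indicator (W m) z *\<^sub>R gauss \<sigma> z \<le> indicator (W n) z *\<^sub>R gauss \<sigma> z"
        unfolding real_scaleR_def by (intro mult_right_mono less_imp_le[OF gauss_pos])
    qed
    show "AE z in count_space Z. (\<lambda>n. indicator (W n) z *\<^sub>R gauss \<sigma> z) \<longlonglongrightarrow> gauss \<sigma> z"
    proof (rule AE_I2)
      fix z assume "z \<in> space (count_space Z)"
      then have "\<forall>\<^sub>F n in sequentially. z \<in> W n" by (intro ev) simp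
      then have "\<forall>\<^sub>F n in sequentially. indicator (W n) z *\<^sub>R gauss \<sigma> z = gauss \<sigma> z"
        by eventually_elim simp
      then show "(\<lambda>n. indicator (W n) z *\<^sub>R gauss \<sigma> z) \<longlonglongrightarrow> gauss \<sigma> z"
        by (rule tendsto_eventually)
    qed
    have "(\<lambda>n. Re (\<Sum>z\<in>W n. of_real (gauss \<sigma> z) * cis (2 * pi * z * 0))) \<longlonglongrightarrow> Re (\<Lambda> \<sigma> 0)"
      unfolding W_def by (intro tendsto_Re peaks_tendsto \<sigma>)
    moreover have "(LINT z|count_space Z. indicator (W n) z *\<^sub>R gauss \<sigma> z) = Re (\<Sum>z\<in>W n. of_real (gauss \<sigma> z) * cis (2 * pi * z * 0))" for n
      using fin[of n "gauss \<sigma>"] by (simp add: has_bochner_integral_iff)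
    ultimately show "(\<lambda>n. (LINT z|count_space Z. indicator (W n) z *\<^sub>R gauss \<sigma> z)) \<longlonglongrightarrow> Re (\<Lambda> \<sigma> 0)"
      by presburger
  qed simp
  define f where "f z = of_real (gauss \<sigma> z) * cis (2 * pi * z * y)" for z
  have nf: "norm (f z) = gauss \<sigma> z" for z
    using gauss_pos[of \<sigma> z] by (simp add: f_def norm_mult)
  show "integrable (count_space Z) (\<lambda>z. of_real (gauss \<sigma> z) * cis (2 * pi * z * y))"
    by (rule Bochner_Integration.integrable_bound[OF int]) (use nf in \<open>simp_all add: f_def\<close>)
  have "(\<lambda>n. (LINT z|count_space Z. indicator (W n) z *\<^sub>R f z)) \<longlonglongrightarrow> integral\<^sup>L (count_space Z) f"
  proof (rule integral_dominated_convergence[OF _ _ int])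
    show "AE z in count_space Z. (\<lambda>n. indicator (W n) z *\<^sub>R f z) \<longlonglongrightarrow> f z"
    proof (rule AE_I2)
      fix z assume "z \<in> space (count_space Z)"
      then have "\<forall>\<^sub>F n in sequentially. z \<in> W n" by (intro ev) simp
      then have "\<forall>\<^sub>F n in sequentially. indicator (W n) z *\<^sub>R f z = f z"
        by eventually_elim simp
      then show "(\<lambda>n. indicator (W n) z *\<^sub>R f z) \<longlonglongrightarrow> f z"
        by (rule tendsto_eventually)
    qed
    show "AE z in count_space Z. norm (indicator (W n) z *\<^sub>R f z) \<le> gauss \<sigma> z" for n
      using gauss_pos by (intro AE_I2) (auto simp: nf less_imp_le split: split_indicator)
  qed simp_all
  moreover have "(LINT z|count_space Z. indicator (W n) z *\<^sub>R f z) = (\<Sum>z\<in>W n. f z)" for n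
    using fin[of n f] by (simp only: has_bochner_integral_iff)
  ultimately have "(\<lambda>n. \<Sum>z\<in>W n. f z) \<longlonglongrightarrow> integral\<^sup>L (count_space Z) f"
    by simp
  moreover have "(\<lambda>n. \<Sum>z\<in>W n. f z) \<longlonglongrightarrow> \<Lambda> \<sigma> y"
    unfolding W_def f_def by (rule peaks_tendsto[OF \<sigma>])
  ultimately show "(LINT z|count_space Z. of_real (gauss \<sigma> z) * cis (2 * pi * z * y)) = \<Lambda> \<sigma> y"
    unfolding f_def[symmetric] by (rule LIMSEQ_unique)
qed

text \<open>\<open>count_space Z\<close> lives on the power set of \<open>Z\<close>; its image under
  the identity is the same Dirac comb on the Borel sets of the line.\<close>

definition \<nu> :: "real measure" where
  "\<nu> = sum_measure (distr (count_space Z) borel (\<lambda>z. z)) (density lborel (\<lambda>k. ennreal (kappa k)))"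

lemma sets_\<nu> [simp, measurable_cong]: "sets \<nu> = sets borel"
  by (simp add: \<nu>_def)

lemma
  fixes g :: "real \<Rightarrow> 'c::{banach, second_countable_topology}"
  assumes g [measurable]: "g \<in> borel_measurable borel"
    and Zint: "integrable (count_space Z) g" and kint: "integrable lborel (\<lambda>k. kappa k *\<^sub>R g k)"
  shows integrable_\<nu>: "integrable \<nu> g"
    and integral_\<nu>: "integral\<^sup>L \<nu> g = integral\<^sup>L (count_space Z) g + (LINT k|lborel. kappa k *\<^sub>R g k)"
proof -
  have s: "sets (density lborel (\<lambda>k. ennreal (kappa k))) = sets (distr (count_space Z) borel (\<lambda>z. z))"
    by simp
  have 1: "integrable (distr (count_space Z) borel (\<lambda>z. z)) g"
    using Zint by (subst integrable_distr_eq) auto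
  have 2: "integrable (density lborel (\<lambda>k. ennreal (kappa k))) g"
    using kint by (subst integrable_density) (auto simp: kappa_nonneg)
  show "integrable \<nu> g"
    unfolding \<nu>_def by (rule integrable_sum_measure[OF s 1 2])
  show "integral\<^sup>L \<nu> g = integral\<^sup>L (count_space Z) g + (LINT k|lborel. kappa k *\<^sub>R g k)"
    unfolding \<nu>_def integral_sum_measure[OF s 1 2]
    by (subst integral_distr, simp, simp, subst integral_density) (auto simp: kappa_nonneg)
qed

lemma
  assumes \<sigma>: "0 < \<sigma>"
  shows integrable_\<nu>_gaussian: "integrable \<nu> (gauss \<sigma>)"
    and integral_\<nu>_gaussian: "(LINT k|\<nu>. of_real (gauss \<sigma> k) * cis (2 * pi * k * y)) = of_real (\<Psi> \<sigma> y)"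
proof -
  have k: "integrable lborel (\<lambda>k. kappa k *\<^sub>R gauss \<sigma> k)"
    using integrable_kappa_gaussian[OF \<sigma>] by (simp add: mult.commute)
  show "integrable \<nu> (gauss \<sigma>)"
    by (rule integrable_\<nu>[OF measurable_gauss integrable_count_Z[OF \<sigma>] k])
  have kc: "integrable lborel (\<lambda>k. kappa k *\<^sub>R (of_real (gauss \<sigma> k) * cis (2 * pi * k * y)))"
    by (rule Bochner_Integration.integrable_bound[OF k]) (auto simp: norm_mult)
  have m: "(\<lambda>k. of_real (gauss \<sigma> k) * cis (2 * pi * k * y)) \<in> borel_measurable borel"
    by measurable
  have "kappa k *\<^sub>R (of_real (gauss \<sigma> k) * cis (2 * pi * k * y)) = of_real (gauss \<sigma> k * kappa k) * cis (2 * pi * k * y)" for k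
    by (simp add: scaleR_conv_of_real mult_ac)
  then show "(LINT k|\<nu>. of_real (gauss \<sigma> k) * cis (2 * pi * k * y)) = of_real (\<Psi> \<sigma> y)"
    unfolding integral_\<nu>[OF m integrable_count_Z_cis[OF \<sigma>] kc] integral_count_Z[OF \<sigma>] \<Lambda>_def by simp
qed

lemma locally_finite_\<nu>: "locally_finite_borel \<nu>"
  unfolding locally_finite_borel_def
proof (intro conjI allI impI)
  fix K :: "real set" assume K: "compact K"
  then obtain B where B: "\<And>x. x \<in> K \<Longrightarrow> \<bar>x\<bar> \<le> B"
    using compact_imp_bounded[OF K] unfolding bounded_iff by auto
  have [measurable]: "K \<in> sets borel"
    using K by (simp add: borel_compact)
  have "integrable \<nu> (\<lambda>k. exp (B\<^sup>2 / 2) * gauss 1 k)"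
    by (intro integrable_mult_right integrable_\<nu>_gaussian) simp
  then have "integrable \<nu> (indicator K :: real \<Rightarrow> real)"
  proof (rule Bochner_Integration.integrable_bound)
    have "norm (indicator K k :: real) \<le> norm (exp (B\<^sup>2 / 2) * gauss 1 k)" for k
    proof (cases "k \<in> K")
      case True
      have "k\<^sup>2 \<le> B\<^sup>2"
        using power_mono[OF B[OF True], of 2] by simp
      then have "1 \<le> exp (B\<^sup>2 / 2) * gauss 1 k"
        by (simp add: gauss_def mult_exp_exp)
      then show ?thesis using True by simp
    qed simp
    then show "AE k in \<nu>. norm (indicator K k :: real) \<le> norm (exp (B\<^sup>2 / 2) * gauss 1 k)"
      by (rule AE_I2)
  qed simp
  then show "emeasure \<nu> K < \<infinity>"
    by (subst (asm) integrable_indicator_iff) auto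
qed simp

sublocale \<nu>: sigma_finite_measure \<nu>
  by (rule sigma_finite_if_locally_finite[OF locally_finite_\<nu>])

end

section \<open>From Gaussians to general test functions\<close>

lemma Cc_bounds:
  fixes \<phi> :: "real \<Rightarrow> 'b::real_normed_vector"
  assumes "Cc \<phi>"
  shows "\<exists>K>0. \<exists>A>0. (\<forall>x. K < \<bar>x\<bar> \<longrightarrow> \<phi> x = 0) \<and> (\<forall>x. norm (\<phi> x) \<le> A)"
proof -
  obtain K where K: "0 < K" "\<And>x. \<phi> x \<noteq> 0 \<Longrightarrow> \<bar>x\<bar> \<le> K"
    using assms unfolding Cc_def bounded_pos by auto
  have "compact (\<phi> ` {-K..K})"
    using assms by (intro compact_continuous_image) (auto simp: Cc_def intro: continuous_on_subset)
  then have "bounded (\<phi> ` {-K..K})"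
    by (rule compact_imp_bounded)
  then obtain A where A: "0 < A" "\<And>x. x \<in> {-K..K} \<Longrightarrow> norm (\<phi> x) \<le> A"
    unfolding bounded_pos by auto
  have "norm (\<phi> x) \<le> A" for x
    using A(1) A(2)[of x] K(2)[of x] by (cases "\<phi> x = 0") (auto simp: abs_le_iff)
  moreover have "\<phi> x = 0" if "K < \<bar>x\<bar>" for x
    using K(2)[of x] that by (cases "\<phi> x = 0") simp_all
  ultimately show ?thesis
    using K(1) A(1) by blast
qed

lemma Cc_measurable:
  fixes \<phi> :: "real \<Rightarrow> 'b::real_normed_vector"
  assumes "Cc \<phi>" shows "\<phi> \<in> borel_measurable borel"
  using assms unfolding Cc_def by (intro borel_measurable_continuous_onI) (rule conjunct1)

lemma Cc_bound_exp:
  fixes \<phi> :: "real \<Rightarrow> 'b::real_normed_vector"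
  assumes "Cc \<phi>"
  shows "\<exists>C>0. \<forall>x. norm (\<phi> x) \<le> C * exp (- \<bar>x\<bar>)"
proof -
  obtain K A where K: "0 < K" "0 < A" "\<And>x. K < \<bar>x\<bar> \<Longrightarrow> \<phi> x = 0" "\<And>x. norm (\<phi> x) \<le> A"
    using Cc_bounds[OF assms] by blast
  have "norm (\<phi> x) \<le> A * exp K * exp (- \<bar>x\<bar>)" for x
  proof (cases "K < \<bar>x\<bar>")
    case False
    have "A * 1 \<le> A * exp (K + - \<bar>x\<bar>)"
      using False K(2) by (intro mult_left_mono) auto
    then have "A \<le> A * exp K * exp (- \<bar>x\<bar>)"
      by (simp only: mult.assoc mult_exp_exp mult_1_right)
    then show ?thesis
      using K(4)[of x] by (rule order_trans[rotated])
  qed (use K in simp)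
  moreover have "0 < A * exp K" using K(2) by simp
  ultimately show ?thesis by blast
qed

lemma Cc_integrable:
  fixes \<phi> :: "real \<Rightarrow> 'b::{banach, second_countable_topology}"
  assumes "Cc \<phi>"
  shows "integrable lborel \<phi>"
proof -
  obtain K A where "0 < K" "0 < A" and K: "\<And>x. K < \<bar>x\<bar> \<Longrightarrow> \<phi> x = 0" "\<And>x. norm (\<phi> x) \<le> A"
    using Cc_bounds[OF assms] by blast
  have "integrable lborel (\<lambda>x. indicator {-K..K} x * A)"
    by (intro integrable_mult_left integrable_real_indicator) (simp_all add: emeasure_lborel_Icc_eq)
  then show ?thesis
  proof (rule Bochner_Integration.integrable_bound)
    have "norm (\<phi> x) \<le> norm (indicator {-K..K} x * A)" for x
      using K(1)[of x] K(2)[of x] order_trans[OF norm_ge_zero K(2)[of x]]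
      by (cases "K < \<bar>x\<bar>") (auto simp: indicator_def abs_le_iff)
    then show "AE x in lborel. norm (\<phi> x) \<le> norm (indicator {-K..K} x * A)"
      by (rule AE_I2)
  qed (use Cc_measurable[OF assms] in simp)
qed

lemma measurable_cnj [measurable]: "cnj \<in> borel_measurable borel"
  by (intro borel_measurable_continuous_onI continuous_intros)

text \<open>Reduces the test functions in \<open>fourier_transform_measure\<close> to a single
  function of compact support with a nonnegative transform. The transform is computed by Fubini; the
  support of the integrand in x lies in \<open>{-2*K..2*K}\<close>.\<close>

lemma autoconvolution:
  fixes \<phi> :: "real \<Rightarrow> complex"
  assumes \<phi>: "Cc \<phi>"
  defines "F \<equiv> \<lambda>x. (LINT y|lborel. \<phi> y * cnj (\<phi> (y - x)))"
  shows "Cc F" and "(LINT x|lborel. F x * cis (2 * pi * k * x)) = of_real ((cmod (ift \<phi> k))\<^sup>2)"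
proof -
  obtain K A where K: "0 < K" "0 < A" "\<And>x. K < \<bar>x\<bar> \<Longrightarrow> \<phi> x = 0" "\<And>x. norm (\<phi> x) \<le> A"
    using Cc_bounds[OF \<phi>] by blast
  have cont: "continuous_on UNIV \<phi>"
    using \<phi> by (simp add: Cc_def)
  note int = Cc_integrable[OF \<phi>]
  have [measurable]: "\<phi> \<in> borel_measurable borel"
    by (rule Cc_measurable[OF \<phi>])
  have dom: "integrable lborel (\<lambda>y. norm (\<phi> y) * A)"
    using int by (intro integrable_mult_left integrable_norm)
  have "isCont F x" for x
    unfolding continuous_within
  proof (rule tendsto_at_iff_sequentially[THEN iffD2], intro allI impI)
    fix u :: "nat \<Rightarrow> real" assume u: "u \<longlonglongrightarrow> x"
    show "(F \<circ> u) \<longlonglongrightarrow> F x"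
      unfolding F_def comp_def
    proof (rule integral_dominated_convergence[OF _ _ dom])
      show "AE y in lborel. (\<lambda>i. \<phi> y * cnj (\<phi> (y - u i))) \<longlonglongrightarrow> \<phi> y * cnj (\<phi> (y - x))"
      proof (rule AE_I2)
        fix y
        have "isCont \<phi> (y - x)"
          using cont by (simp add: continuous_on_eq_continuous_at)
        then have "(\<lambda>i. \<phi> (y - u i)) \<longlonglongrightarrow> \<phi> (y - x)"
          by (rule isCont_tendsto_compose) (intro tendsto_diff tendsto_const u)
        then show "(\<lambda>i. \<phi> y * cnj (\<phi> (y - u i))) \<longlonglongrightarrow> \<phi> y * cnj (\<phi> (y - x))"
          by (intro tendsto_mult tendsto_const tendsto_cnj)
      qed
      show "AE y in lborel. norm (\<phi> y * cnj (\<phi> (y - u i))) \<le> norm (\<phi> y) * A" for i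
        by (intro AE_I2) (simp add: norm_mult mult_left_mono K(4))
    qed simp_all
  qed
  then have "continuous_on UNIV F"
    by (simp add: continuous_on_eq_continuous_at)
  moreover have "bounded {x. F x \<noteq> 0}"
  proof (rule boundedI)
    fix x assume "x \<in> {x. F x \<noteq> 0}"
    have "\<not> (\<forall>y. \<phi> y * cnj (\<phi> (y - x)) = 0)"
    proof
      assume "\<forall>y. \<phi> y * cnj (\<phi> (y - x)) = 0"
      then have "F x = integral\<^sup>L lborel (\<lambda>y::real. 0)"
        unfolding F_def by (intro Bochner_Integration.integral_cong refl) (rule spec)
      with \<open>x \<in> {x. F x \<noteq> 0}\<close> show False by simp
    qed
    then obtain y where "\<phi> y \<noteq> 0" "\<phi> (y - x) \<noteq> 0" by auto
    then have "\<bar>y\<bar> \<le> K" "\<bar>y - x\<bar> \<le> K"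
      using K(3) by (meson not_le)+
    then show "norm x \<le> 2 * K" by simp
  qed
  ultimately show "Cc F" by (simp add: Cc_def)
  define H where "H x y = \<phi> y * cnj (\<phi> (y - x)) * cis (2 * pi * k * x)" for x y
  have H_int: "integrable (lborel \<Otimes>\<^sub>M lborel) (case_prod H)"
  proof (rule Bochner_Integration.integrable_bound)
    show "integrable (lborel \<Otimes>\<^sub>M lborel) (\<lambda>(x, y). (indicator {-2*K..2*K} x * A) * norm (\<phi> y))"
      using int by (intro lborel_pair.integrable_product integrable_mult_left integrable_norm integrable_real_indicator) (simp_all add: emeasure_lborel_Icc_eq)
    show "case_prod H \<in> borel_measurable (lborel \<Otimes>\<^sub>M lborel)"
      unfolding H_def by measurable
    have "norm (H x y) \<le> norm ((indicator {-2*K..2*K} x * A) * norm (\<phi> y))" for x y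
    proof (cases "\<phi> y = 0 \<or> \<phi> (y - x) = 0")
      case False
      then have "\<bar>y\<bar> \<le> K" "\<bar>y - x\<bar> \<le> K"
        using K(3) by (meson not_le)+
      then have "x \<in> {-2*K..2*K}" by auto
      then show ?thesis
        using K(2) mult_right_mono[OF K(4)[of "y - x"], of "norm (\<phi> y)"] by (simp add: H_def norm_mult mult.commute)
    qed (auto simp: H_def)
    then show "AE p in lborel \<Otimes>\<^sub>M lborel. norm (case_prod H p) \<le> norm (case p of (x, y) \<Rightarrow> (indicator {-2*K..2*K} x * A) * norm (\<phi> y))"
      by (intro AE_I2) auto
  qed
  have "(LINT x|lborel. F x * cis (2 * pi * k * x)) = (LINT x|lborel. integral\<^sup>L lborel (H x))"
    unfolding F_def H_def[abs_def] by (simp only: integral_mult_left_zero)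
  also have "\<dots> = (LINT y|lborel. (LINT x|lborel. H x y))"
    by (rule lborel_pair.Fubini_integral[OF H_int, symmetric])
  also have "\<dots> = (LINT y|lborel. \<phi> y * cis (2 * pi * k * y) * cnj (ift \<phi> k))"
  proof (intro Bochner_Integration.integral_cong refl)
    fix y
    \<comment> \<open>With x = y - t the character splits into one factor in y and a conjugate one
      in t, so the inner integral becomes the conjugate of \<open>ift \<phi> k\<close>.\<close>
    have "(LINT x|lborel. H x y) = (LINT t|lborel. H (y + (-1) * t) y)"
      using lborel_integral_real_affine[of "-1" "\<lambda>x. H x y" y] by simp
    also have "\<dots> = (LINT t|lborel. (\<phi> y * cis (2 * pi * k * y)) * cnj (\<phi> t * cis (2 * pi * k * t)))"
      by (intro Bochner_Integration.integral_cong refl)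
        (simp add: H_def right_diff_distrib cis_divide[symmetric] cis_cnj inverse_eq_divide[symmetric] divide_inverse cis_inverse)
    also have "\<dots> = \<phi> y * cis (2 * pi * k * y) * cnj (ift \<phi> k)"
    proof -
      have "integrable lborel (\<lambda>t. \<phi> t * cis (2 * pi * k * t))"
        by (rule Bochner_Integration.integrable_bound[OF int]) (auto simp: norm_mult)
      from integral_bounded_linear[OF bounded_linear_cnj this] show ?thesis
        unfolding ift_def integral_mult_right_zero by (simp only:)
    qed
    finally show "(LINT x|lborel. H x y) = \<phi> y * cis (2 * pi * k * y) * cnj (ift \<phi> k)" .
  qed
  also have "\<dots> = ift \<phi> k * cnj (ift \<phi> k)"
    unfolding ift_def[of \<phi>] by (rule integral_mult_left_zero)
  also have "\<dots> = of_real ((cmod (ift \<phi> k))\<^sup>2)"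
    by (rule complex_norm_square[symmetric])
  finally show "(LINT x|lborel. F x * cis (2 * pi * k * x)) = of_real ((cmod (ift \<phi> k))\<^sup>2)" .
qed

text \<open>Rescaling the variable replaces the shrinking kernel by a fixed normal density and moves
  \<sigma> into the argument of F, where dominated convergence can handle it.\<close>

lemma gaussian_mollifier:
  fixes F :: "real \<Rightarrow> complex"
  assumes "0 < \<sigma>"
  shows "(LINT y|lborel. F y * of_real (gauss_hat \<sigma> (x - y))) = (LINT v|lborel. F (x - \<sigma> / (2 * pi) * v) * of_real (std_normal_density v))"
proof -
  let ?c = "- (\<sigma> / (2 * pi))"
  have "(LINT y|lborel. F y * of_real (gauss_hat \<sigma> (x - y)))
    = \<bar>?c\<bar> *\<^sub>R (LINT v|lborel. F (x + ?c * v) * of_real (gauss_hat \<sigma> (x - (x + ?c * v))))"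
    by (rule lborel_integral_real_affine) (use assms in simp)
  also have "\<dots> = (LINT v|lborel. \<bar>?c\<bar> *\<^sub>R (F (x + ?c * v) * of_real (gauss_hat \<sigma> (x - (x + ?c * v)))))"
    by (rule integral_scaleR_right[symmetric])
  also have "\<dots> = (LINT v|lborel. F (x - \<sigma> / (2 * pi) * v) * of_real (std_normal_density v))"
  proof (intro Bochner_Integration.integral_cong refl)
    fix v
    have "2 * pi / \<sigma> * (x - (x + ?c * v)) = v"
      using assms by simp
    then have "\<bar>?c\<bar> * gauss_hat \<sigma> (x - (x + ?c * v)) = std_normal_density v"
      using assms by (simp only: gauss_hat_def) simp
    then have "of_real \<bar>?c\<bar> * of_real (gauss_hat \<sigma> (x - (x + ?c * v))) = complex_of_real (std_normal_density v)"
      by (simp only: of_real_mult[symmetric])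
    then show "\<bar>?c\<bar> *\<^sub>R (F (x + ?c * v) * of_real (gauss_hat \<sigma> (x - (x + ?c * v)))) = F (x - \<sigma> / (2 * pi) * v) * of_real (std_normal_density v)"
      by (simp only: scaleR_conv_of_real mult.left_commute[of "of_real \<bar>?c\<bar>"]) simp
  qed
  finally show ?thesis .
qed

context renewal_sums
begin

text \<open>The identity \<open>integral_\<nu>_gaussian\<close> for each y is integrated over y with
  weight F y, with one application of Fubini on each side.\<close>

lemma fourier_gaussian:
  fixes F :: "real \<Rightarrow> complex"
  assumes F: "Cc F" and \<sigma>: "0 < \<sigma>"
  shows "(LINT x|\<gamma>. (LINT y|lborel. F y * of_real (gauss_hat \<sigma> (x - y))))
    = (LINT k|\<nu>. of_real (gauss \<sigma> k) * (LINT y|lborel. F y * cis (2 * pi * k * y)))"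
    and "integrable \<nu> (\<lambda>k. of_real (gauss \<sigma> k) * (LINT y|lborel. F y * cis (2 * pi * k * y)))"
proof -
  note [measurable] = Cc_measurable[OF F]
  interpret GL: pair_sigma_finite \<gamma> "lborel :: real measure" ..
  interpret NL: pair_sigma_finite \<nu> "lborel :: real measure" ..
  obtain C where C: "C > 0" "\<And>x. gauss_hat \<sigma> x \<le> C * exp (- \<bar>x\<bar>)"
    using gauss_hat_le_exp[OF \<sigma>] by blast
  \<comment> \<open>From exp (- |x - y|) \<le> exp (- |x|) exp |y| the majorant for Fubini becomes a
    product, and the factor in y is still continuous with compact support.\<close>
  have Cc_exp: "Cc (\<lambda>y. of_real (exp \<bar>y\<bar>) * F y)"
    using F by (auto simp: Cc_def intro!: continuous_intros intro: bounded_subset)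
  have exp_\<gamma>: "integrable \<gamma> (\<lambda>x. C * exp (- \<bar>x\<bar>))"
    by (rule integrable_\<gamma>[where C = C]) (use C in auto)
  have int1: "integrable (\<gamma> \<Otimes>\<^sub>M lborel) (\<lambda>(x, y). F y * of_real (gauss_hat \<sigma> (x - y)))"
  proof (rule Bochner_Integration.integrable_bound)
    show "integrable (\<gamma> \<Otimes>\<^sub>M lborel) (\<lambda>(x, y). C * exp (- \<bar>x\<bar>) * norm (of_real (exp \<bar>y\<bar>) * F y))"
      by (intro GL.integrable_product exp_\<gamma> integrable_norm Cc_integrable[OF Cc_exp])
    have "norm (F y * of_real (gauss_hat \<sigma> (x - y))) \<le> norm (C * exp (- \<bar>x\<bar>) * norm (of_real (exp \<bar>y\<bar>) * F y))" for x y
    proof -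
      have "gauss_hat \<sigma> (x - y) \<le> C * exp (- \<bar>x - y\<bar>)" by (rule C)
      also have "\<dots> \<le> C * (exp (- \<bar>x\<bar>) * exp \<bar>y\<bar>)"
        using C(1) by (intro mult_left_mono) (auto simp: mult_exp_exp)
      finally have "norm (F y) * gauss_hat \<sigma> (x - y) \<le> norm (F y) * (C * (exp (- \<bar>x\<bar>) * exp \<bar>y\<bar>))"
        by (intro mult_left_mono) auto
      then show ?thesis
        using C(1) gauss_hat_nonneg[OF \<sigma>] by (simp add: norm_mult abs_mult mult_ac)
    qed
    then show "AE p in \<gamma> \<Otimes>\<^sub>M lborel. norm (case p of (x, y) \<Rightarrow> F y * of_real (gauss_hat \<sigma> (x - y)))
        \<le> norm (case p of (x, y) \<Rightarrow> C * exp (- \<bar>x\<bar>) * norm (of_real (exp \<bar>y\<bar>) * F y))"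
      by (intro AE_I2) auto
  qed measurable
  have int2: "integrable (\<nu> \<Otimes>\<^sub>M lborel) (\<lambda>(k, y). of_real (gauss \<sigma> k) * cis (2 * pi * k * y) * F y)"
  proof (rule Bochner_Integration.integrable_bound)
    show "integrable (\<nu> \<Otimes>\<^sub>M lborel) (\<lambda>(k, y). gauss \<sigma> k * norm (F y))"
      by (intro NL.integrable_product integrable_\<nu>_gaussian \<sigma> integrable_norm Cc_integrable[OF F])
    show "AE p in \<nu> \<Otimes>\<^sub>M lborel. norm (case p of (k, y) \<Rightarrow> of_real (gauss \<sigma> k) * cis (2 * pi * k * y) * F y)
        \<le> norm (case p of (k, y) \<Rightarrow> gauss \<sigma> k * norm (F y))"
      by (intro AE_I2) (auto simp: norm_mult abs_mult)
  qed measurable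
  have "(LINT x|\<gamma>. (LINT y|lborel. F y * of_real (gauss_hat \<sigma> (x - y))))
      = (LINT y|lborel. (LINT x|\<gamma>. F y * of_real (gauss_hat \<sigma> (x - y))))"
    by (rule GL.Fubini_integral[OF int1, symmetric])
  also have "\<dots> = (LINT y|lborel. F y * of_real (\<Psi> \<sigma> y))"
    by (simp only: integral_mult_right_zero integral_complex_of_real \<Psi>_def)
  also have "\<dots> = (LINT y|lborel. (LINT k|\<nu>. of_real (gauss \<sigma> k) * cis (2 * pi * k * y) * F y))"
    by (simp only: integral_mult_left_zero integral_\<nu>_gaussian[OF \<sigma>] mult.commute[of "F _"])
  also have "\<dots> = (LINT k|\<nu>. (LINT y|lborel. of_real (gauss \<sigma> k) * cis (2 * pi * k * y) * F y))"
    by (rule NL.Fubini_integral[OF int2])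
  also have inner: "(\<lambda>k. (LINT y|lborel. of_real (gauss \<sigma> k) * cis (2 * pi * k * y) * F y))
      = (\<lambda>k. of_real (gauss \<sigma> k) * (LINT y|lborel. F y * cis (2 * pi * k * y)))"
    by (simp only: mult.assoc integral_mult_right_zero mult.commute[of "cis _" "F _"])
  finally show "(LINT x|\<gamma>. (LINT y|lborel. F y * of_real (gauss_hat \<sigma> (x - y))))
    = (LINT k|\<nu>. of_real (gauss \<sigma> k) * (LINT y|lborel. F y * cis (2 * pi * k * y)))" .
  show "integrable \<nu> (\<lambda>k. of_real (gauss \<sigma> k) * (LINT y|lborel. F y * cis (2 * pi * k * y)))"
    using NL.integrable_fst[OF int2] unfolding inner .
qed

text \<open>Pointwise convergence is not enough against \<open>\<gamma>\<close>: the mollified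
  functions need a common majorant of the form c exp (- |x|). The condition \<sigma> n \<le> 1 gives
  |x - \<sigma> v / (2 pi)| \<ge> |x| - |v|, and the resulting exp |v| is absorbed by the normal
  density.\<close>

lemma mollified_tendsto:
  fixes F :: "real \<Rightarrow> complex"
  assumes F: "Cc F" and \<sigma>: "\<And>n. 0 < \<sigma> n" "\<And>n. \<sigma> n \<le> 1" "\<sigma> \<longlonglongrightarrow> 0"
  shows "(\<lambda>n. (LINT x|\<gamma>. (LINT y|lborel. F y * of_real (gauss_hat (\<sigma> n) (x - y))))) \<longlonglongrightarrow> integral\<^sup>L \<gamma> F"
proof -
  note [measurable] = Cc_measurable[OF F]
  obtain C where C: "C > 0" "\<And>x. norm (F x) \<le> C * exp (- \<bar>x\<bar>)"
    using Cc_bound_exp[OF F] by blast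
  define N where "N = (LINT v|lborel. exp \<bar>v\<bar> * std_normal_density v)"
  define g where "g n x = (LINT v|lborel. F (x - \<sigma> n / (2 * pi) * v) * of_real (std_normal_density v))" for n x
  have small: "\<bar>\<sigma> n / (2 * pi) * v\<bar> \<le> \<bar>v\<bar>" for n v
  proof -
    have "\<sigma> n / (2 * pi) \<le> 1" "0 \<le> \<sigma> n / (2 * pi)"
      using \<sigma>(1,2)[of n] pi_gt3 by (simp_all add: divide_le_eq)
    then show ?thesis
      unfolding abs_mult by (intro mult_left_le_one_le) (simp_all only: abs_ge_zero abs_of_nonneg)
  qed
  have dom: "integrable lborel (\<lambda>v. C * exp (- \<bar>x\<bar>) * (exp \<bar>v\<bar> * std_normal_density v))" for x
    by (intro integrable_mult_right integrable_exp_abs_std_normal)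
  have bd: "norm (F (x - \<sigma> n / (2 * pi) * v) * of_real (std_normal_density v)) \<le> C * exp (- \<bar>x\<bar>) * (exp \<bar>v\<bar> * std_normal_density v)" for n x v
  proof -
    have "norm (F (x - \<sigma> n / (2 * pi) * v)) \<le> C * exp (- \<bar>x - \<sigma> n / (2 * pi) * v\<bar>)"
      by (rule C)
    also have "\<dots> \<le> C * (exp (- \<bar>x\<bar>) * exp \<bar>v\<bar>)"
    proof -
      have "- \<bar>x - t\<bar> \<le> - \<bar>x\<bar> + \<bar>v\<bar>" if "\<bar>t\<bar> \<le> \<bar>v\<bar>" for t
        using that by linarith
      from this[OF small] show ?thesis
        using C(1) unfolding mult_exp_exp by (intro mult_left_mono) simp_all
    qed
    finally have "norm (F (x - \<sigma> n / (2 * pi) * v)) * std_normal_density v \<le> C * (exp (- \<bar>x\<bar>) * exp \<bar>v\<bar>) * std_normal_density v"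
      by (intro mult_right_mono) auto
    then show ?thesis
      by (simp add: norm_mult mult.assoc)
  qed
  have g_bound: "norm (g n x) \<le> C * N * exp (- \<bar>x\<bar>)" for n x
  proof -
    have "norm (g n x) \<le> (LINT v|lborel. norm (F (x - \<sigma> n / (2 * pi) * v) * of_real (std_normal_density v)))"
      unfolding g_def by (rule integral_norm_bound)
    also have "\<dots> \<le> (LINT v|lborel. C * exp (- \<bar>x\<bar>) * (exp \<bar>v\<bar> * std_normal_density v))"
    proof (rule integral_mono[OF _ dom bd])
      show "integrable lborel (\<lambda>v. norm (F (x - \<sigma> n / (2 * pi) * v) * of_real (std_normal_density v)))"
      proof (intro integrable_norm Bochner_Integration.integrable_bound[OF dom])
        show "AE v in lborel. norm (F (x - \<sigma> n / (2 * pi) * v) * of_real (std_normal_density v)) \<le> norm (C * exp (- \<bar>x\<bar>) * (exp \<bar>v\<bar> * std_normal_density v))"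
          using order_trans[OF bd abs_ge_self] by (intro AE_I2) (simp only: real_norm_def)
      qed measurable
    qed
    finally have "norm (g n x) \<le> C * exp (- \<bar>x\<bar>) * N"
      by (simp only: integral_mult_right_zero N_def)
    then show ?thesis by (simp only: mult_ac)
  qed
  have g_meas: "g n \<in> borel_measurable borel" for n
    unfolding g_def by measurable
  have g_lim: "(\<lambda>n. g n x) \<longlonglongrightarrow> F x" for x
  proof -
    have "(\<lambda>n. g n x) \<longlonglongrightarrow> (LINT v|lborel. F x * of_real (std_normal_density v))"
      unfolding g_def
    proof (rule integral_dominated_convergence[OF _ _ dom])
      show "AE v in lborel. (\<lambda>n. F (x - \<sigma> n / (2 * pi) * v) * of_real (std_normal_density v)) \<longlonglongrightarrow> F x * of_real (std_normal_density v)"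
      proof (rule AE_I2)
        fix v
        have "isCont F x"
          using F by (simp add: Cc_def continuous_on_eq_continuous_at)
        moreover have "(\<lambda>n. x - \<sigma> n / (2 * pi) * v) \<longlonglongrightarrow> x - 0 / (2 * pi) * v"
          by (intro tendsto_intros \<sigma>) simp
        then have "(\<lambda>n. x - \<sigma> n / (2 * pi) * v) \<longlonglongrightarrow> x"
          by simp
        ultimately have "(\<lambda>n. F (x - \<sigma> n / (2 * pi) * v)) \<longlonglongrightarrow> F x"
          by (rule isCont_tendsto_compose)
        then show "(\<lambda>n. F (x - \<sigma> n / (2 * pi) * v) * of_real (std_normal_density v)) \<longlonglongrightarrow> F x * of_real (std_normal_density v)"
          by (intro tendsto_mult tendsto_const)
      qed
      show "AE v in lborel. norm (F (x - \<sigma> n / (2 * pi) * v) * of_real (std_normal_density v)) \<le> C * exp (- \<bar>x\<bar>) * (exp \<bar>v\<bar> * std_normal_density v)" for n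
        by (rule AE_I2[OF bd])
    qed measurable
    moreover have "integral\<^sup>L lborel std_normal_density = 1"
      by (rule integral_normal_density) simp
    ultimately show ?thesis
      by (simp only: integral_mult_right_zero integral_complex_of_real of_real_1 mult_1_right)
  qed
  have "(\<lambda>n. integral\<^sup>L \<gamma> (g n)) \<longlonglongrightarrow> integral\<^sup>L \<gamma> F"
  proof (rule integral_dominated_convergence)
    have N0: "0 \<le> N" unfolding N_def by (intro Bochner_Integration.integral_nonneg) simp
    show "integrable \<gamma> (\<lambda>x. C * N * exp (- \<bar>x\<bar>))"
      by (rule integrable_\<gamma>[where C = "C * N"]) (use C N0 in \<open>auto simp: abs_mult\<close>)
    show "AE x in \<gamma>. (\<lambda>n. g n x) \<longlonglongrightarrow> F x"
      by (rule AE_I2[OF g_lim])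
    show "AE x in \<gamma>. norm (g n x) \<le> C * N * exp (- \<bar>x\<bar>)" for n
      by (rule AE_I2[OF g_bound])
  qed (use g_meas in simp_all)
  then show ?thesis
    unfolding gaussian_mollifier[OF \<sigma>(1)] g_def .
qed

text \<open>Removes the Gaussian factor as \<sigma> tends to 0. On the side of \<open>\<nu>\<close>
  the nonnegative integrands increase, so monotone convergence gives the limit, with no prior
  integrability of |ift \<phi>|^2; on the side of \<open>\<gamma>\<close> it is the mollification
  limit.\<close>

lemma fourier_transform_\<gamma>: "fourier_transform_measure \<gamma> \<nu>"
  unfolding fourier_transform_measure_def
proof (intro conjI allI impI)
  fix \<phi> :: "real \<Rightarrow> complex" assume \<phi>: "Cc \<phi>"
  define F where "F x = (LINT y|lborel. \<phi> y * cnj (\<phi> (y - x)))" for x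
  have F: "Cc F" and FT: "(LINT x|lborel. F x * cis (2 * pi * k * x)) = of_real ((cmod (ift \<phi> k))\<^sup>2)" for k
    unfolding F_def using autoconvolution[OF \<phi>] by auto
  define p where "p k = (cmod (ift \<phi> k))\<^sup>2" for k
  define \<sigma> where "\<sigma> n = 1 / real (Suc n)" for n
  have \<sigma>: "0 < \<sigma> n" "\<sigma> n \<le> 1" for n
    by (simp_all add: \<sigma>_def)
  have \<sigma>0: "\<sigma> \<longlonglongrightarrow> 0"
    unfolding \<sigma>_def[abs_def] by (rule LIMSEQ_Suc[OF lim_1_over_n])
  have pint: "integrable \<nu> (\<lambda>k. gauss (\<sigma> n) k * p k)" for n
    using fourier_gaussian(2)[OF F \<sigma>(1)[of n]] unfolding FT p_def[symmetric] of_real_mult[symmetric] complex_of_real_integrable_eq .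
  have eq: "(LINT x|\<gamma>. (LINT y|lborel. F y * of_real (gauss_hat (\<sigma> n) (x - y)))) = of_real ((LINT k|\<nu>. gauss (\<sigma> n) k * p k))" for n
    unfolding fourier_gaussian(1)[OF F \<sigma>(1)] FT p_def[symmetric] of_real_mult[symmetric] integral_complex_of_real ..
  have lim: "(\<lambda>n. complex_of_real ((LINT k|\<nu>. gauss (\<sigma> n) k * p k))) \<longlonglongrightarrow> integral\<^sup>L \<gamma> F"
    using mollified_tendsto[OF F \<sigma> \<sigma>0] unfolding eq .
  have p_meas: "p \<in> borel_measurable \<nu>"
  proof -
    have "(\<lambda>k. complex_of_real (p k)) \<in> borel_measurable borel"
      unfolding p_def FT[symmetric] using Cc_measurable[OF F] by measurable
    then have "(\<lambda>k. Re (complex_of_real (p k))) \<in> borel_measurable borel"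
      by measurable
    then show ?thesis by simp
  qed
  have "integral\<^sup>L \<nu> p = Re (integral\<^sup>L \<gamma> F)"
  proof (rule integral_monotone_convergence[OF pint])
    show "AE k in \<nu>. mono (\<lambda>n. gauss (\<sigma> n) k * p k)"
    proof (intro AE_I2 monoI mult_right_mono)
      fix k and m n :: nat assume "m \<le> n"
      then have "\<sigma> n \<le> \<sigma> m"
        by (simp add: \<sigma>_def frac_le)
      then have "(\<sigma> n)\<^sup>2 * k\<^sup>2 \<le> (\<sigma> m)\<^sup>2 * k\<^sup>2"
        using \<sigma>(1)[of n] by (intro mult_right_mono power_mono) auto
      then show "gauss (\<sigma> m) k \<le> gauss (\<sigma> n) k"
        by (simp add: gauss_def power_mult_distrib)
    qed (simp add: p_def)
    show "AE k in \<nu>. (\<lambda>n. gauss (\<sigma> n) k * p k) \<longlonglongrightarrow> p k"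
    proof (rule AE_I2)
      fix k
      have "(\<lambda>n. exp (- (\<sigma> n * k)\<^sup>2 / 2) * p k) \<longlonglongrightarrow> exp (- (0 * k)\<^sup>2 / 2) * p k"
        by (intro tendsto_intros \<sigma>0) simp
      then show "(\<lambda>n. gauss (\<sigma> n) k * p k) \<longlonglongrightarrow> p k"
        by (simp add: gauss_def)
    qed
    show "(\<lambda>n. (LINT k|\<nu>. gauss (\<sigma> n) k * p k)) \<longlonglongrightarrow> Re (integral\<^sup>L \<gamma> F)"
      using tendsto_Re[OF lim] by simp
  qed (rule p_meas)
  moreover have "Im (integral\<^sup>L \<gamma> F) = 0"
    using LIMSEQ_unique[OF tendsto_Im[OF lim]] by simp
  ultimately have "integral\<^sup>L \<gamma> F = of_real (integral\<^sup>L \<nu> p)"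
    by (simp add: complex_eq_iff)
  then show "(LINT x|\<gamma>. (LINT y|lborel. \<phi> y * cnj (\<phi> (y - x)))) = complex_of_real ((LINT k|\<nu>. (cmod (ift \<phi> k))\<^sup>2))"
    by (simp only: F_def[abs_def] p_def[abs_def])
qed (rule locally_finite_\<nu>)

end

section \<open>The points of the renewal process\<close>

lemma (in prob_space) indep_vars_reindex:
  assumes ind: "indep_vars M' X I" and inj: "inj_on f J" and sub: "f ` J \<subseteq> I"
  shows "indep_vars (\<lambda>j. M' (f j)) (\<lambda>j. X (f j)) J"
  unfolding indep_vars_def2
proof (intro conjI ballI)
  show "random_variable (M' (f j)) (X (f j))" if "j \<in> J" for j
    using ind that sub by (auto simp: indep_vars_def2)
  let ?S = "\<lambda>i. {X i -` A \<inter> space M |A. A \<in> sets (M' i)}"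
  have S: "indep_sets ?S I"
    using ind by (simp add: indep_vars_def2)
  show "indep_sets (\<lambda>j. ?S (f j)) J"
  proof (rule indep_setsI)
    show "?S (f j) \<subseteq> events" if "j \<in> J" for j
      using S that sub unfolding indep_sets_def by blast
    fix A K assume K: "K \<noteq> {}" "K \<subseteq> J" "finite K" "\<forall>j\<in>K. A j \<in> ?S (f j)"
    have injK: "inj_on f K"
      using inj K(2) by (rule inj_on_subset)
    define g where "g = inv_into K f"
    have g: "g (f j) = j" if "j \<in> K" for j
      unfolding g_def using injK that by (rule inv_into_f_f)
    have "prob (\<Inter>i\<in>f ` K. A (g i)) = (\<Prod>i\<in>f ` K. prob (A (g i)))"
    proof (rule indep_setsD[OF S])
      show "f ` K \<subseteq> I" using K(2) sub by blast
    qed (use K in \<open>auto simp: g\<close>)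
    then show "prob (\<Inter>j\<in>K. A j) = (\<Prod>j\<in>K. prob (A j))"
      by (simp add: prod.reindex[OF injK] g cong: INF_cong)
  qed
qed

lemma perpetuity_eq_sum:
  assumes "\<And>n. y (Suc n) = y n + X n"
  shows "perpetuity s X j = (\<Sum>i<j. exp (- s * (y j - y i)))"
proof (induction j)
  case (Suc j)
  have "perpetuity s X (Suc j) = exp (- s * X j) * (1 + (\<Sum>i<j. exp (- s * (y j - y i))))"
    by (simp only: perpetuity.simps Suc)
  also have "\<dots> = exp (- s * X j) + (\<Sum>i<j. exp (- s * X j) * exp (- s * (y j - y i)))"
    by (simp only: distrib_left mult_1_right sum_distrib_left)
  also have "\<dots> = exp (- s * (y (Suc j) - y j)) + (\<Sum>i<j. exp (- s * (y (Suc j) - y i)))"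
    by (simp add: assms mult_exp_exp algebra_simps)
  finally show ?case by simp
qed simp

lemma sum_offset:
  fixes y :: "nat \<Rightarrow> real"
  assumes "\<And>n. y (Suc n) = y n + X n" shows "y n = y 0 + (\<Sum>i<n. X i)"
proof (induction n)
  case (Suc n)
  then show ?case unfolding assms by simp
qed simp

lemma pair_averages_of_renewal:
  fixes y :: "nat \<Rightarrow> real"
  assumes y: "\<And>n. y (Suc n) = y n + X n" and X: "\<And>n. 0 < X n"
    and perp: "\<And>s::nat. 1 \<le> s \<Longrightarrow>
      (\<lambda>n. (\<Sum>j<n. perpetuity (real s) X j) / real n) \<longlonglongrightarrow> (LINT t|\<eta>. exp (- real s * t))"
    and \<eta>: "sets \<eta> = sets borel" "AE t in \<eta>. 0 \<le> t" "\<And>s::nat. 1 \<le> s \<Longrightarrow> integrable \<eta> (\<lambda>t. exp (- real s * t))"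
    and \<psi>: "continuous_on UNIV \<psi>" "\<And>t. K < t \<Longrightarrow> \<psi> t = 0"
  shows "(\<lambda>n. (\<Sum>j<n. \<Sum>i<j. \<psi> (y j - y i)) / real n) \<longlonglongrightarrow> (LINT t|\<eta>. \<psi> t)"
proof (rule pair_averages_tendsto_of_laplace[OF _ \<eta> _ \<psi>])
  show "mono y"
    unfolding mono_iff_le_Suc using X by (simp add: y less_imp_le)
  show "(\<lambda>n. (\<Sum>j<n. \<Sum>i<j. exp (- real s * (y j - y i))) / real n) \<longlonglongrightarrow> (LINT t|\<eta>. exp (- real s * t))" if "1 \<le> s" for s :: nat
    using perp[OF that] by (simp only: perpetuity_eq_sum[where y = y and X = X, OF y])
qed

lemma renewal_averages:
  fixes y :: "nat \<Rightarrow> real"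
  assumes y: "\<And>n. y (Suc n) = y n + X n" and lim: "(\<lambda>n. (\<Sum>i<n. X i) / real n) \<longlonglongrightarrow> 1"
  shows "(\<lambda>n. y n / real n) \<longlonglongrightarrow> 1"
proof -
  have "(\<lambda>n. y 0 * (1 / real n) + (\<Sum>i<n. X i) / real n) \<longlonglongrightarrow> y 0 * 0 + 1"
    by (intro tendsto_intros lim lim_1_over_n)
  then show ?thesis
    by (subst sum_offset[where y = y and X = X, OF y]) (simp add: add_divide_distrib)
qed

section \<open>The explicit density and the mass of bounded sets\<close>

context waiting_law
begin

lemma isCont_kappa:
  assumes "w k \<noteq> 1" shows "isCont kappa k"
proof -
  have w: "(w \<longlongrightarrow> w k) (at k)"
    using isCont_w[of k] by (simp only: isCont_def)
  have "((\<lambda>x. (1 - (cmod (w x))\<^sup>2) / (cmod (1 - w x))\<^sup>2) \<longlongrightarrow> (1 - (cmod (w k))\<^sup>2) / (cmod (1 - w k))\<^sup>2) (at k)"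
    by (intro tendsto_divide tendsto_diff tendsto_const tendsto_power tendsto_norm w) (use assms in simp)
  then show ?thesis
    by (simp only: isCont_def kappa_def[abs_def])
qed

lemma one_minus_kappa:
  assumes "w k \<noteq> 1"
  shows "1 - kappa k = 2 * ((cmod (w k))\<^sup>2 - Re (w k)) / (cmod (1 - w k))\<^sup>2"
proof -
  have pos: "(cmod (1 - w k))\<^sup>2 \<noteq> 0" using assms by simp
  have "(cmod (1 - w k))\<^sup>2 - (1 - (cmod (w k))\<^sup>2) = 2 * ((cmod (w k))\<^sup>2 - Re (w k))"
    unfolding cmod_power2 by (simp add: power2_eq_square algebra_simps)
  then show ?thesis
    using pos unfolding kappa_def by (simp add: diff_divide_distrib[symmetric] divide_simps)
qed

end

context renewal_sums
begin

lemma set_integrable_kappa: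
  assumes A: "A \<in> sets borel" "bounded A"
  shows "set_integrable lborel A kappa"
proof -
  note [measurable] = A(1)
  obtain B where B: "\<And>x. x \<in> A \<Longrightarrow> \<bar>x\<bar> \<le> B"
    using A(2) unfolding bounded_iff by auto
  show ?thesis
    unfolding set_integrable_def
  proof (rule Bochner_Integration.integrable_bound)
    show "integrable lborel (\<lambda>k. exp (B\<^sup>2 / 2) * (gauss 1 k * kappa k))"
      by (intro integrable_mult_right integrable_kappa_gaussian) simp
    have "norm (indicator A k *\<^sub>R kappa k) \<le> norm (exp (B\<^sup>2 / 2) * (gauss 1 k * kappa k))" for k
    proof (cases "k \<in> A")
      case True
      have "k\<^sup>2 \<le> B\<^sup>2"
        using power_mono[OF B[OF True], of 2] by simp
      then have "1 \<le> exp (B\<^sup>2 / 2) * gauss 1 k"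
        by (simp add: gauss_def mult_exp_exp)
      then have "1 * kappa k \<le> exp (B\<^sup>2 / 2) * gauss 1 k * kappa k"
        by (intro mult_right_mono kappa_nonneg)
      then show ?thesis
        using True kappa_nonneg[of k] gauss_pos[of 1 k] by (simp add: abs_mult mult.assoc)
    qed simp
    then show "AE k in lborel. norm (indicator A k *\<^sub>R kappa k) \<le> norm (exp (B\<^sup>2 / 2) * (gauss 1 k * kappa k))"
      by (rule AE_I2)
  qed measurable
qed

lemma measure_\<nu>:
  assumes A: "A \<in> sets borel" "bounded A"
  shows "measure \<nu> A = real (card (Z \<inter> A)) + (LINT k:A|lborel. kappa k)"
proof -
  note [measurable] = A(1)
  have "emeasure (distr (count_space Z) borel (\<lambda>z. z)) A = of_nat (card (Z \<inter> A))"
    using finite_Z_bounded[OF A(2)] by (simp add: emeasure_distr emeasure_count_space Int_commute)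
  moreover have "emeasure (density lborel (\<lambda>k. ennreal (kappa k))) A = ennreal (LINT k:A|lborel. kappa k)"
  proof -
    have "emeasure (density lborel (\<lambda>k. ennreal (kappa k))) A = (\<integral>\<^sup>+k. ennreal (indicator A k *\<^sub>R kappa k) \<partial>lborel)"
      by (subst emeasure_density) (auto intro!: nn_integral_cong split: split_indicator)
    also have "\<dots> = ennreal (LINT k:A|lborel. kappa k)"
      unfolding set_lebesgue_integral_def
      using set_integrable_kappa[OF A] kappa_nonneg
      by (intro nn_integral_eq_integral) (auto simp: set_integrable_def)
    finally show ?thesis .
  qed
  moreover have "0 \<le> (LINT k:A|lborel. kappa k)"
    unfolding set_lebesgue_integral_def using kappa_nonneg by (intro Bochner_Integration.integral_nonneg) auto
  ultimately show ?thesis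
    unfolding \<nu>_def measure_def by (simp add: emeasure_sum_measure ennreal_of_nat_eq_real_of_nat ennreal_plus[symmetric] del: ennreal_plus)
qed

end


text \<open>One sequence over the integers in which \<open>G n\<close> is the step from point n to
  point n + 1. Point 0 is - U G 0 and point 1 is (1 - U) G 0, so \<open>G 0\<close> is the gap
  around the origin when 0 \<le> U \<le> 1.\<close>

definition renewal_position :: "(int \<Rightarrow> 'a \<Rightarrow> real) \<Rightarrow> ('a \<Rightarrow> real) \<Rightarrow> 'a \<Rightarrow> int \<Rightarrow> real" where
  "renewal_position G U \<omega> n =
    (if 0 \<le> n then - U \<omega> * G 0 \<omega> + (\<Sum>j\<in>{0..<n}. G j \<omega>) else - U \<omega> * G 0 \<omega> - (\<Sum>j\<in>{n..<0}. G j \<omega>))"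

lemma range_renewal_position: "range (renewal_position G U \<omega>) = renewal_points G U \<omega>"
proof -
  have "range (\<lambda>n. if 0 \<le> n then p n else q n) = {p n | n. n \<ge> 0} \<union> {q n | n. n < 0}" for p q :: "int \<Rightarrow> real"
  proof (intro equalityI subsetI)
    fix t assume "t \<in> {p n | n. n \<ge> 0} \<union> {q n | n. n < 0}"
    then show "t \<in> range (\<lambda>n. if 0 \<le> n then p n else q n)"
      by (auto simp: image_iff) (metis not_le)+
  qed auto
  then show ?thesis
    unfolding renewal_points_def renewal_position_def[abs_def] .
qed

lemma renewal_position_step: "renewal_position G U \<omega> (n + 1) = renewal_position G U \<omega> n + G n \<omega>"
proof -
  consider "0 \<le> n" | "n = -1" | "n < -1" by linarith
  then show ?thesis
  proof cases
    case 1
    then have "{0..<n + 1} = insert n {0..<n}" by auto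
    with 1 show ?thesis by (simp add: renewal_position_def)
  next
    case 2
    then have "{n..<0} = {n}" by auto
    with 2 show ?thesis by (simp add: renewal_position_def)
  next
    case 3
    then have "{n..<0} = insert n {n + 1..<0}" by auto
    with 3 show ?thesis by (simp add: renewal_position_def)
  qed
qed

lemma renewal_position_strict_mono:
  assumes "\<And>n. 0 < G n \<omega>"
  shows "strict_mono (renewal_position G U \<omega>)"
proof (rule strict_monoI)
  fix m n :: int assume "m < n"
  then show "renewal_position G U \<omega> m < renewal_position G U \<omega> n"
  proof (induction rule: int_gr_induct)
    case base
    then show ?case using assms[of m] by (simp add: renewal_position_step)
  next
    case (step i)
    then show ?case using assms[of i] by (simp add: renewal_position_step)
  qed
qed

text \<open>The deterministic part: the premises collect what holds almost surely for one sample.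
  The right half starts at point 1 and the left half at point 0, so their gaps are
  \<open>G 1\<close>, \<open>G 2\<close>, ... and \<open>G (-1)\<close>, \<open>G (-2)\<close>, ...,
  all with law \<open>\<mu>\<close>.\<close>

lemma (in renewal_sums) autocorrelation_renewal_points:
  assumes pos: "\<And>n. 0 < G n \<omega>"
    and X: "\<And>n. X n = G (int n + 1) \<omega>" and Y: "\<And>n. Y n = G (- int n - 1) \<omega>"
    and Xlim: "(\<lambda>n. (\<Sum>i<n. X i) / real n) \<longlonglongrightarrow> 1" and Ylim: "(\<lambda>n. (\<Sum>i<n. Y i) / real n) \<longlonglongrightarrow> 1"
    and Xperp: "\<And>s::nat. 1 \<le> s \<Longrightarrow> (\<lambda>n. (\<Sum>j<n. perpetuity (real s) X j) / real n) \<longlonglongrightarrow> (LINT t|\<eta>. exp (- real s * t))"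
    and Yperp: "\<And>s::nat. 1 \<le> s \<Longrightarrow> (\<lambda>n. (\<Sum>j<n. perpetuity (real s) Y j) / real n) \<longlonglongrightarrow> (LINT t|\<eta>. exp (- real s * t))"
  shows "autocorrelation (renewal_points G U \<omega>) \<gamma>"
proof -
  define x where "x = renewal_position G U \<omega>"
  define y where "y j = x (int j + 1)" for j
  define z where "z j = - x (- int j)" for j
  have x: "strict_mono x"
    unfolding x_def by (rule renewal_position_strict_mono[where G = G and \<omega> = \<omega>, OF pos])
  have yS: "y (Suc n) = y n + X n" for n
    using renewal_position_step[of G U \<omega> "int n + 1"] by (simp add: y_def x_def X add.commute)
  have zS: "z (Suc n) = z n + Y n" for n
  proof -
    have "- int (Suc n) = - int n - 1" by simp
    moreover have "x (- int n) = x (- int n - 1) + G (- int n - 1) \<omega>"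
      using renewal_position_step[of G U \<omega> "- int n - 1"] by (simp only: x_def diff_add_cancel)
    ultimately show ?thesis
      by (simp only: z_def Y)
  qed
  have Xpos: "0 < X n" and Ypos: "0 < Y n" for n
    using pos by (simp_all add: X Y)
  note ylim = renewal_averages[OF yS Xlim] and zlim = renewal_averages[OF zS Ylim]
  have exp_int: "integrable \<eta> (\<lambda>t. exp (- real s * t))" if "1 \<le> s" for s :: nat
    using exp_\<eta>(1)[of "real s"] that by simp
  have main: "finite (range x \<inter> {-R<..<R}) \<and>
      ((\<lambda>R. (\<Sum>(s, t) \<in> (range x \<inter> {-R<..<R}) \<times> (range x \<inter> {-R<..<R}). \<phi> (s - t)) / (2 * R)) \<longlongrightarrow> integral\<^sup>L \<gamma> \<phi>) at_top"
    if \<phi>: "Cc \<phi>" for \<phi> :: "real \<Rightarrow> real" and R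
  proof -
    obtain K A where K: "K > 0" "\<forall>x. K < \<bar>x\<bar> \<longrightarrow> \<phi> x = 0"
      using Cc_bounds[OF \<phi>] by blast
    obtain C where C: "\<And>x. norm (\<phi> x) \<le> C * exp (- \<bar>x\<bar>)"
      using Cc_bound_exp[OF \<phi>] by blast
    define \<psi> where "\<psi> t = \<phi> t + \<phi> (- t)" for t
    have cont: "continuous_on UNIV \<phi>"
      using \<phi> by (simp add: Cc_def)
    have \<psi>_cont: "continuous_on UNIV \<psi>"
      unfolding \<psi>_def
      by (rule continuous_on_add[OF cont continuous_on_compose2[OF cont continuous_on_minus[OF continuous_on_id]]]) auto
    have \<psi>_zero: "\<psi> t = 0" if "K < t" for t
      using K that by (simp add: \<psi>_def)
    have L: "(\<lambda>n. (\<Sum>j<n. \<Sum>i<j. \<phi> (u j - u i) + \<phi> (u i - u j)) / real n) \<longlonglongrightarrow> (LINT t|\<eta>. \<psi> t)"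
      if u: "\<And>n. u (Suc n) = u n + V n" "\<And>n. 0 < V n"
        and perp: "\<And>s::nat. 1 \<le> s \<Longrightarrow> (\<lambda>n. (\<Sum>j<n. perpetuity (real s) V j) / real n) \<longlonglongrightarrow> (LINT t|\<eta>. exp (- real s * t))"
      for u V :: "nat \<Rightarrow> real"
    proof -
      have "(\<lambda>n. (\<Sum>j<n. \<Sum>i<j. \<psi> (u j - u i)) / real n) \<longlonglongrightarrow> (LINT t|\<eta>. \<psi> t)"
        by (rule pair_averages_of_renewal[OF u perp sets_\<eta> AE_\<eta>_nonneg exp_int \<psi>_cont \<psi>_zero])
      then show ?thesis
        unfolding \<psi>_def minus_diff_eq .
    qed
    have "integral\<^sup>L \<gamma> \<phi> = \<phi> 0 + (LINT t|\<eta>. \<psi> t)"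
      unfolding \<psi>_def by (rule integral_\<gamma>_\<eta>[OF Cc_measurable[OF \<phi>] C])
    moreover have "\<And>t. K < \<bar>t\<bar> \<Longrightarrow> \<phi> t = 0"
      using K(2) by blast
    note autocorrelation_two_sided[OF x y_def z_def ylim zlim L[OF yS Xpos Xperp] L[OF zS Ypos Yperp] this]
    ultimately show ?thesis
      by (simp only: simp_thms)
  qed
  have fin: "finite (range x \<inter> {-R<..<R})" for R
    using main[of "\<lambda>_. 0" R] by (simp add: Cc_def)
  show ?thesis
    unfolding autocorrelation_def range_renewal_position[of G U \<omega>, folded x_def, symmetric]
    by (intro conjI allI impI locally_finite_\<gamma> fin) (rule conjunct2[OF main])
qed

text \<open>The gaps are positive only almost surely. Replacing them by their positive parts makes
  them nonnegative everywhere without changing the law.\<close>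

lemma distr_max_0:
  assumes "sets \<mu> = sets borel" "AE x in \<mu>. (0::real) < x" "G \<in> borel_measurable M" "distr M borel G = \<mu>"
  shows "distr M borel (\<lambda>\<omega>. max 0 (G \<omega>)) = \<mu>"
proof -
  have "distr M borel (\<lambda>\<omega>. max 0 (G \<omega>)) = distr (distr M borel G) borel (max 0)"
    using assms(3) by (subst distr_distr) (auto simp: comp_def)
  also have "\<dots> = distr \<mu> \<mu> (\<lambda>x. x)"
    unfolding assms(4) using assms(1,2)
    by (intro distr_cong_AE) (auto elim!: eventually_mono simp: measurable_def)
  also have "\<dots> = \<mu>"
    by simp
  finally show ?thesis .
qed

text \<open>\<open>S\<close> is kept apart from \<open>X\<close> so that both half-lines are
  compared with one and the same renewal measure, which depends on \<open>\<mu>\<close> through its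
  Laplace transform here.\<close>

lemma AE_iid_limits:
  fixes X :: "nat \<Rightarrow> 'a \<Rightarrow> real" and \<mu> :: "real measure"
  assumes "renewal_sums \<mu> M S"
    and ind: "prob_space.indep_vars M (\<lambda>_. borel) X UNIV"
    and nonneg: "\<And>i x. 0 \<le> X i x" and law: "\<And>i. distr M borel (X i) = \<mu>"
    and moment: "0 < \<epsilon>" "integrable \<mu> (\<lambda>x. \<bar>x\<bar> powr (1 + \<epsilon>))"
  shows "AE \<omega> in M. (\<lambda>n. (\<Sum>i<n. X i \<omega>) / real n) \<longlonglongrightarrow> 1"
    and "AE \<omega> in M. \<forall>s::nat. 1 \<le> s \<longrightarrow>
      (\<lambda>n. (\<Sum>j<n. perpetuity (real s) (\<lambda>i. X i \<omega>) j) / real n) \<longlonglongrightarrow> (LINT t|renewal_sums.\<eta> M S. exp (- real s * t))"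
proof -
  interpret renewal_sums \<mu> M S by fact
  have Xm: "X i \<in> borel_measurable M" for i
    using ind by (auto simp: M.indep_vars_def)
  \<comment> \<open>The strong law is stated for exponents up to 1; a higher moment dominates the
    reduced one up to the constant 1.\<close>
  define \<delta> where "\<delta> = min \<epsilon> 1"
  have \<delta>: "0 < \<delta>" "\<delta> \<le> 1" "\<delta> \<le> \<epsilon>"
    using moment(1) by (auto simp: \<delta>_def)
  have "integrable \<mu> (\<lambda>x. \<bar>x\<bar> powr (1 + \<delta>))"
  proof (rule Bochner_Integration.integrable_bound)
    show "integrable \<mu> (\<lambda>x. 1 + \<bar>x\<bar> powr (1 + \<epsilon>))"
      using moment(2) by (intro Bochner_Integration.integrable_add) auto
    have "\<bar>x\<bar> powr (1 + \<delta>) \<le> 1 + \<bar>x\<bar> powr (1 + \<epsilon>)" for x :: real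
    proof (cases "\<bar>x\<bar> \<le> 1")
      case True
      then have "\<bar>x\<bar> powr (1 + \<delta>) \<le> 1"
        using \<delta> by (intro powr_le1) auto
      then show ?thesis using powr_ge_zero[of "\<bar>x\<bar>" "1 + \<epsilon>"] by linarith
    next
      case False
      then have "\<bar>x\<bar> powr (1 + \<delta>) \<le> \<bar>x\<bar> powr (1 + \<epsilon>)"
        using \<delta> by (intro powr_mono) auto
      then show ?thesis by linarith
    qed
    then show "AE x in \<mu>. norm (\<bar>x\<bar> powr (1 + \<delta>)) \<le> norm (1 + \<bar>x\<bar> powr (1 + \<epsilon>))"
      by (intro AE_I2) (simp add: abs_of_nonneg)
  qed simp
  then show "AE \<omega> in M. (\<lambda>n. (\<Sum>i<n. X i \<omega>) / real n) \<longlonglongrightarrow> 1"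
    by (rule AE_averages_iid_moment[OF M.prob_space_axioms ind nonneg law \<delta>(1,2) _ mean])
  show "AE \<omega> in M. \<forall>s::nat. 1 \<le> s \<longrightarrow>
      (\<lambda>n. (\<Sum>j<n. perpetuity (real s) (\<lambda>i. X i \<omega>) j) / real n) \<longlonglongrightarrow> (LINT t|\<eta>. exp (- real s * t))"
    unfolding AE_all_countable
  proof
    fix s :: nat
    show "AE \<omega> in M. 1 \<le> s \<longrightarrow> (\<lambda>n. (\<Sum>j<n. perpetuity (real s) (\<lambda>i. X i \<omega>) j) / real n) \<longlonglongrightarrow> (LINT t|\<eta>. exp (- real s * t))"
    proof (cases "1 \<le> s")
      case True
      then have s: "0 < real s" by simp
      have m: "(\<lambda>x. exp (- real s * x)) \<in> borel_measurable borel"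
        by measurable
      have E: "(LINT x|M. exp (- real s * X i x)) = (LINT x|\<mu>. exp (- real s * x))" for i
        using integral_distr[OF Xm[of i] m] by (simp only: law)
      have "AE \<omega> in M. (\<lambda>n. (\<Sum>j<n. perpetuity (real s) (\<lambda>i. X i \<omega>) j) / real n) \<longlonglongrightarrow> (LINT t|\<eta>. exp (- real s * t))"
        unfolding exp_\<eta>(2)[OF s]
        by (rule AE_averages_perpetuity[OF M.prob_space_axioms ind nonneg s E laplace_bounds(1,2)[OF s]])
      then show ?thesis by eventually_elim simp
    qed simp
  qed
qed

lemma renewal_sums_iid:
  fixes X :: "nat \<Rightarrow> 'a \<Rightarrow> real" and \<mu> :: "real measure"
  assumes W: "waiting_law \<mu>" and "prob_space M"
    and ind: "prob_space.indep_vars M (\<lambda>_. borel) X UNIV"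
    and nonneg: "\<And>i x. 0 \<le> X i x" and law: "\<And>i. distr M borel (X i) = \<mu>"
  shows "renewal_sums \<mu> M (\<lambda>n x. \<Sum>k<Suc n. X k x)"
proof -
  interpret waiting_law \<mu> by fact
  interpret M: prob_space M by fact
  have Xm [measurable]: "X i \<in> borel_measurable M" for i
    using ind by (auto simp: M.indep_vars_def)
  have prod: "(LINT x|M. (\<Prod>k<Suc n. f (X k x))) = (integral\<^sup>L \<mu> f) ^ Suc n"
    if f [measurable]: "f \<in> borel_measurable borel" and "\<And>k. integrable M (\<lambda>x. f (X k x))"
    for f :: "real \<Rightarrow> 'c::{real_normed_field, banach, second_countable_topology}" and n
  proof -
    have "M.indep_vars (\<lambda>_. borel) (\<lambda>k x. f (X k x)) {..<Suc n}"
      by (rule M.indep_vars_compose2[OF M.indep_vars_subset[OF ind subset_UNIV], of _ "\<lambda>_. f"]) (rule f)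
    then have "(LINT x|M. (\<Prod>k<Suc n. f (X k x))) = (\<Prod>k<Suc n. (LINT x|M. f (X k x)))"
      using that(2) by (rule M.indep_vars_lebesgue_integral[OF finite_lessThan])
    also have "\<dots> = (\<Prod>k<Suc n. integral\<^sup>L \<mu> f)"
      using integral_distr[OF Xm f] by (simp only: law)
    finally show ?thesis by simp
  qed
  have cis_sum: "cis (t * (\<Sum>k<n. X k x)) = (\<Prod>k<n. cis (t * X k x))" for t n x
    by (induction n) (simp_all add: distrib_left cis_mult[symmetric])
  have exp_sum: "exp (- s * (\<Sum>k<n. X k x)) = (\<Prod>k<n. exp (- s * X k x))" for s n x
    by (induction n) (simp_all only: sum.lessThan_Suc prod.lessThan_Suc distrib_left mult_exp_exp[symmetric], simp_all)
  show ?thesis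
  proof unfold_locales
    show "(\<lambda>x. \<Sum>k<Suc n. X k x) \<in> borel_measurable M" for n
      by measurable
    show "0 \<le> (\<Sum>k<Suc n. X k x)" for n x
      by (intro sum_nonneg nonneg)
    show "(LINT x|M. cis (t * (\<Sum>k<Suc n. X k x))) = ((LINT x|\<mu>. cis (t * x))) ^ Suc n" for n t
      unfolding cis_sum
      by (rule prod) (auto intro!: M.integrable_const_bound[of _ 1])
    show "(LINT x|M. exp (- s * (\<Sum>k<Suc n. X k x))) = ((LINT x|\<mu>. exp (- s * x))) ^ Suc n" if "0 < s" for n s
      unfolding exp_sum
      by (rule prod) (use that nonneg in \<open>auto intro!: M.integrable_const_bound[of _ 1]\<close>)
  qed
qed

theorem theorem2:
  fixes \<mu> :: "real measure" and M :: "'a measure"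
    and G :: "int \<Rightarrow> 'a \<Rightarrow> real" and U :: "'a \<Rightarrow> real"
  assumes mu_prob: "prob_space \<mu>" and mu_sets: "sets \<mu> = sets borel"
    and mu_pos: "AE x in \<mu>. x > 0"
    and mu_mean: "integrable \<mu> (\<lambda>x. x)" "integral\<^sup>L \<mu> (\<lambda>x. x) = 1"
    and mu_moment: "\<exists>\<epsilon>>0. integrable \<mu> (\<lambda>x. \<bar>x\<bar> powr (1 + \<epsilon>))"
    and M_prob: "prob_space M"
    and G_meas: "\<And>n. G n \<in> borel_measurable M" and U_meas: "U \<in> borel_measurable M"
    and indep: "prob_space.indep_vars M (\<lambda>_. borel)
                  (\<lambda>i. case i of None \<Rightarrow> U | Some n \<Rightarrow> G n) (UNIV :: int option set)"
    and G_law: "\<And>n. n \<noteq> 0 \<Longrightarrow> distr M borel (G n) = \<mu>"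
    and G0_law: "distr M borel (G 0) = density \<mu> (\<lambda>x. ennreal x)"
    and U_law: "distr M borel U = uniform_measure lborel {0..1}"
  shows "\<exists>h :: real \<Rightarrow> real.
     (\<forall>K. compact K \<longrightarrow> set_integrable lborel K h) \<and>
     countable {k. \<not> isCont h k} \<and>
     (\<forall>k. ft_measure \<mu> k \<noteq> 1 \<longrightarrow>
        h k = 2 * ((cmod (ft_measure \<mu> k))\<^sup>2 - Re (ft_measure \<mu> k)) / (cmod (1 - ft_measure \<mu> k))\<^sup>2) \<and>
     (AE \<omega> in M. \<exists>\<gamma> \<nu>. autocorrelation (renewal_points G U \<omega>) \<gamma> \<and>
        fourier_transform_measure \<gamma> \<nu> \<and>
        ((\<not> (\<exists>b>0. msupport \<mu> \<subseteq> range (\<lambda>n::int. b * of_int n))) \<longrightarrow>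
           (\<forall>A \<in> sets borel. bounded A \<longrightarrow>
              measure \<nu> A = indicator A 0 + (LINT k:A|lborel. 1 - h k))) \<and>
        (\<forall>b>0. msupport \<mu> \<subseteq> range (\<lambda>n::int. b * of_int n) \<and>
               (\<forall>c>0. msupport \<mu> \<subseteq> range (\<lambda>n::int. c * of_int n) \<longrightarrow> c \<le> b) \<longrightarrow>
           (\<forall>A \<in> sets borel. bounded A \<longrightarrow>
              measure \<nu> A = real (card {n::int. of_int n / b \<in> A}) + (LINT k:A|lborel. 1 - h k))))"
proof -
  interpret waiting_law \<mu>
    by (intro waiting_law.intro waiting_law_axioms.intro mu_prob mu_sets mu_pos mu_mean)
  interpret M: prob_space M
    by (rule M_prob)
  obtain \<epsilon> where \<epsilon>: "0 < \<epsilon>" "integrable \<mu> (\<lambda>x. \<bar>x\<bar> powr (1 + \<epsilon>))"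
    using mu_moment by blast
  \<comment> \<open>Gaps to the right of point 1 and to the left of point 0. The size-biased
    \<open>G 0\<close> is in neither sequence, so each is identically distributed with law
    \<open>\<mu>\<close>.\<close>
  define X where "X n \<omega> = max 0 (G (int n + 1) \<omega>)" for n :: nat and \<omega>
  define Y where "Y n \<omega> = max 0 (G (- int n - 1) \<omega>)" for n :: nat and \<omega>
  have ind: "M.indep_vars (\<lambda>_. borel) (\<lambda>n \<omega>. max 0 (G (f n) \<omega>)) UNIV" if "inj f" for f :: "nat \<Rightarrow> int"
  proof -
    have "inj (\<lambda>n. Some (f n))"
      using that by (simp add: inj_def)
    from M.indep_vars_reindex[OF indep this subset_UNIV]
    have "M.indep_vars (\<lambda>_. borel) (\<lambda>n. G (f n)) UNIV"
      by simp
    then show ?thesis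
      by (rule M.indep_vars_compose2) simp
  qed
  have X_ind: "M.indep_vars (\<lambda>_. borel) X UNIV"
    unfolding X_def[abs_def] by (rule ind) (simp add: inj_def)
  have Y_ind: "M.indep_vars (\<lambda>_. borel) Y UNIV"
    unfolding Y_def[abs_def] by (rule ind) (simp add: inj_def)
  have X_law: "distr M borel (X n) = \<mu>" and Y_law: "distr M borel (Y n) = \<mu>" for n
    unfolding X_def[abs_def] Y_def[abs_def]
    by (rule distr_max_0[OF mu_sets mu_pos G_meas G_law]; simp)+
  have X0: "0 \<le> X n \<omega>" and Y0: "0 \<le> Y n \<omega>" for n \<omega>
    by (simp_all add: X_def Y_def)
  \<comment> \<open>Partial sums of the right gaps realise the convolution powers. The left gaps
    have the same law, so the renewal measure built here also describes them.\<close>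
  define S where "S n \<omega> = (\<Sum>k<Suc n. X k \<omega>)" for n \<omega>
  have RS: "renewal_sums \<mu> M S"
    unfolding S_def[abs_def] by (rule renewal_sums_iid[OF waiting_law_axioms M_prob X_ind X0 X_law])
  interpret renewal_sums \<mu> M S
    by (rule RS)
  have gap_pos: "AE \<omega> in M. 0 < G n \<omega>" for n
  proof -
    have "AE x in distr M borel (G n). 0 < x"
    \<comment> \<open>The weight \<open>ennreal x\<close> is 0 for x \<le> 0, so the size-biased law
      gives no mass to nonpositive numbers.\<close>
    proof (cases "n = 0")
      case True
      then show ?thesis
        unfolding G0_law[folded True] by (subst AE_density) (auto intro!: AE_I2)
    next
      case False
      then show ?thesis using mu_pos by (simp only: G_law not_False_eq_True)
    qed
    then show ?thesis
      by (subst (asm) AE_distr_iff) (use G_meas in auto)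
  qed
  then have "AE \<omega> in M. \<forall>n. 0 < G n \<omega>"
    by (simp add: AE_all_countable)
  moreover note AE_iid_limits[OF RS X_ind X0 X_law \<epsilon>] AE_iid_limits[OF RS Y_ind Y0 Y_law \<epsilon>]
  ultimately have auto: "AE \<omega> in M. autocorrelation (renewal_points G U \<omega>) \<gamma>"
  proof eventually_elim
    case (elim \<omega>)
    have pos: "0 < G n \<omega>" for n
      using elim(1) by blast
    have "X n \<omega> = G (int n + 1) \<omega>" "Y n \<omega> = G (- int n - 1) \<omega>" for n
      using pos[of "int n + 1"] pos[of "- int n - 1"] by (simp_all add: X_def Y_def)
    then show ?case
      using autocorrelation_renewal_points[where G = G and U = U and \<omega> = \<omega> and X = "\<lambda>n. X n \<omega>" and Y = "\<lambda>n. Y n \<omega>",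
          OF pos _ _ elim(2,4) elim(3,5)[rule_format]] by blast
  qed
  \<comment> \<open>At points of \<open>Z\<close> the value is 1, because \<open>kappa\<close> is 0
    there; elsewhere it is the stated quotient.\<close>
  define h where "h k = 1 - kappa k" for k
  have h_int: "set_integrable lborel K h" if "compact K" for K
  proof -
    have K: "K \<in> sets borel" "bounded K"
      using that by (simp_all add: borel_compact compact_imp_bounded)
    have "set_integrable lborel K (\<lambda>_. 1::real)"
      using emeasure_bounded_finite[OF K(2)] K(1) by (simp add: set_integrable_def)
    from set_integral_diff(1)[OF this set_integrable_kappa[OF K]] show ?thesis
      by (simp add: h_def[abs_def])
  qed
  have "{k. \<not> isCont h k} \<subseteq> Z"
    using isCont_kappa by (auto simp: h_def[abs_def] Z_def intro!: continuous_intros)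
  then have h_cont: "countable {k. \<not> isCont h k}"
    using countable_Z by (rule countable_subset)
  have meas: "measure \<nu> A = real (card (Z \<inter> A)) + (LINT k:A|lborel. 1 - h k)" if "A \<in> sets borel" "bounded A" for A
    using measure_\<nu>[OF that] by (simp add: h_def)
  have nonlattice: "measure \<nu> A = indicator A 0 + (LINT k:A|lborel. 1 - h k)"
    if "\<not> (\<exists>b>0. msupport \<mu> \<subseteq> range (\<lambda>n::int. b * of_int n))" "A \<in> sets borel" "bounded A" for A
    using meas[OF that(2,3)] unfolding Z_nonlattice[OF that(1)] by (cases "0 \<in> A") simp_all
  have lattice: "measure \<nu> A = real (card {n::int. of_int n / b \<in> A}) + (LINT k:A|lborel. 1 - h k)"
    if b: "b > 0" "msupport \<mu> \<subseteq> range (\<lambda>n::int. b * of_int n)"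
      and max: "\<forall>c>0. msupport \<mu> \<subseteq> range (\<lambda>n::int. c * of_int n) \<longrightarrow> c \<le> b"
      and A: "A \<in> sets borel" "bounded A" for b A
  proof -
    have "Z = range (\<lambda>n::int. of_int n / b)"
      using max by (intro Z_lattice[OF b]) blast
    then have "Z \<inter> A = (\<lambda>n::int. of_int n / b) ` {n. of_int n / b \<in> A}"
      by auto
    moreover have "inj_on (\<lambda>n::int. of_int n / b) {n. of_int n / b \<in> A}"
      using b(1) by (simp add: inj_on_def)
    ultimately have "card (Z \<inter> A) = card {n::int. of_int n / b \<in> A}"
      by (simp add: card_image)
    then show ?thesis
      using meas[OF A] by simp
  qed
  show ?thesis
  proof (intro exI[of _ h] conjI allI impI)
    show "h k = 2 * ((cmod (ft_measure \<mu> k))\<^sup>2 - Re (ft_measure \<mu> k)) / (cmod (1 - ft_measure \<mu> k))\<^sup>2"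
      if "ft_measure \<mu> k \<noteq> 1" for k
      unfolding h_def by (rule one_minus_kappa[OF that])
    show "AE \<omega> in M. \<exists>\<gamma> \<nu>. autocorrelation (renewal_points G U \<omega>) \<gamma> \<and>
        fourier_transform_measure \<gamma> \<nu> \<and>
        ((\<not> (\<exists>b>0. msupport \<mu> \<subseteq> range (\<lambda>n::int. b * of_int n))) \<longrightarrow>
           (\<forall>A \<in> sets borel. bounded A \<longrightarrow>
              measure \<nu> A = indicator A 0 + (LINT k:A|lborel. 1 - h k))) \<and>
        (\<forall>b>0. msupport \<mu> \<subseteq> range (\<lambda>n::int. b * of_int n) \<and>
               (\<forall>c>0. msupport \<mu> \<subseteq> range (\<lambda>n::int. c * of_int n) \<longrightarrow> c \<le> b) \<longrightarrow>
           (\<forall>A \<in> sets borel. bounded A \<longrightarrow>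
              measure \<nu> A = real (card {n::int. of_int n / b \<in> A}) + (LINT k:A|lborel. 1 - h k)))"
      using auto
    proof eventually_elim
      case (elim \<omega>)
      \<comment> \<open>Both witnesses are the same for almost all samples: only the point set
        depends on \<omega>.\<close>
      show ?case
        by (rule exI[of _ \<gamma>], rule exI[of _ \<nu>], intro conjI allI impI ballI elim fourier_transform_\<gamma>)
          (rule nonlattice lattice; (elim conjE)?; assumption)+
    qed
  qed (rule h_int h_cont, assumption?)+
qed

end
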